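(* Assume there exist polynomials $t(n)>0$, $p(n)>0$ such that $K^t$ is $\frac{1}{p(\cdot)}$-hard-on-average. Then there exists a weak one-way function $f$ (and thus also a one-way function).
   Context: Let $U$ be a fixed universal Turing machine that emulates any Turing machine with polynomial overhead; for a description $\Pi$ encoding a pair $(M,w)$ of a Turing machine $M$ and input $w$, $U(\Pi,1^t)$ denotes the output of $M(w)$ when emulated on $U$ for $t$ steps. The $t$-time-bounded Kolmogorov complexity of a string $x$ is $K^t(x)=\min_{\Pi\in\{0,1\}^*}\{|\Pi| : U(\Pi,1^{t(|x|)})=x\}$. A function $g$ is $\alpha(\cdot)$-hard-on-average if for every probabilistic polynomial-time (PPT) heuristic $H$ and all sufficiently large $n$, $\Pr[x\leftarrow\{0,1\}^n : H(x)=g(x)] < 1-\alpha(n)$. A polynomial-time computable function $f$ is a weak one-way function if there is a polynomial $q>0$ such that for every PPT algorithm $A$ and all sufficiently large $n$, $\Pr[x\leftarrow\{0,1\}^n : A(1^n,f(x))\in f^{-1}(f(x))] < 1-\frac{1}{q(n)}$; it is a one-way function if for every PPT $A$ this inversion probability is bounded by a negligible function of $n$. By Yao's hardness amplification theorem, a weak one-way function implies a one-way function. *)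

theory Defs
  imports
    "HOL-Probability.Probability_Mass_Function"
    "HOL-Computational_Algebra.Polynomial"
begin

section \<open>Turing machines\<close>

text \<open>
  Deterministic multi-tape Turing machines with two-way infinite tapes. A tape is stored relative
  to its head, which always scans cell 0, so head movements shift the tape. States are natural
  numbers, the initial state is 0, and a machine halts when its transition table has no entry
  for the current state and scanned symbols. Because the table of a well-formed machine is finite,
  only finitely many states and symbols are relevant to it.
\<close>

datatype symbol = Blank | Bit bool | Aux nat

datatype direction = Left | Stay | Right

type_synonym tape = "int \<Rightarrow> symbol"
type_synonym config = "nat \<times> tape list"

datatype tm = TM
  (tapes: nat)
  (delta: "nat \<times> symbol list \<rightharpoonup> nat \<times> (symbol \<times> direction) list")

definition wf_tm :: "tm \<Rightarrow> bool" where
  "wf_tm M \<longleftrightarrow> tapes M \<ge> 1 \<and> finite (dom (delta M)) \<and>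
     (\<forall>q ss q' as. delta M (q, ss) = Some (q', as) \<longrightarrow> length ss = tapes M \<and> length as = tapes M)"

fun offset :: "direction \<Rightarrow> int" where
  "offset Left = -1"
| "offset Stay = 0"
| "offset Right = 1"

fun act :: "symbol \<times> direction \<Rightarrow> tape \<Rightarrow> tape" where
  "act (s, d) \<tau> = (\<lambda>i. (\<tau>(0 := s)) (i + offset d))"

definition scanned :: "tape list \<Rightarrow> symbol list" where
  "scanned \<tau>s = map (\<lambda>\<tau>. \<tau> 0) \<tau>s"

definition halted :: "tm \<Rightarrow> config \<Rightarrow> bool" where
  "halted M = (\<lambda>(q, \<tau>s). delta M (q, scanned \<tau>s) = None)"

definition step :: "tm \<Rightarrow> config \<Rightarrow> config" where
  "step M = (\<lambda>(q, \<tau>s).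
     case delta M (q, scanned \<tau>s) of
       None \<Rightarrow> (q, \<tau>s)
     | Some (q', as) \<Rightarrow> (q', map2 act as \<tau>s))"

definition input_tape :: "bool list \<Rightarrow> tape" where
  "input_tape x = (\<lambda>i. if 0 \<le> i \<and> i < int (length x) then Bit (x ! nat i) else Blank)"

text \<open>Several inputs are placed on separate tapes; no pairing function is involved.\<close>

definition init :: "tm \<Rightarrow> bool list list \<Rightarrow> config" where
  "init M xs = (0, map input_tape (xs @ replicate (tapes M - length xs) []))"

definition run :: "tm \<Rightarrow> bool list list \<Rightarrow> nat \<Rightarrow> config" where
  "run M xs k = (step M ^^ k) (init M xs)"

definition halts_within :: "tm \<Rightarrow> bool list list \<Rightarrow> nat \<Rightarrow> bool" where
  "halts_within M xs k \<longleftrightarrow> halted M (run M xs k)"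

text \<open>
  The output is the bit string that starts at the head of the first tape and ends before the
  first blank. A machine that halts scanning anything else (for example \<open>Aux\<close> symbols) has
  no output; this is how a machine signals failure.
\<close>

definition holds_string :: "tape \<Rightarrow> bool list \<Rightarrow> bool" where
  "holds_string \<tau> y \<longleftrightarrow> (\<forall>i < length y. \<tau> (int i) = Bit (y ! i)) \<and> \<tau> (int (length y)) = Blank"

definition tape_output :: "tape \<Rightarrow> bool list option" where
  "tape_output \<tau> = (if \<exists>y. holds_string \<tau> y then Some (THE y. holds_string \<tau> y) else None)"

definition result_within :: "tm \<Rightarrow> bool list list \<Rightarrow> nat \<Rightarrow> bool list option" where
  "result_within M xs k =
     (if halts_within M xs k then tape_output (hd (snd (run M xs k))) else None)"

definition result :: "tm \<Rightarrow> bool list list \<Rightarrow> bool list option" where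
  "result M xs =
     (if \<exists>k. halts_within M xs k then result_within M xs (LEAST k. halts_within M xs k) else None)"

definition input_size :: "bool list list \<Rightarrow> nat" where
  "input_size xs = sum_list (map length xs)"


section \<open>Time-bounded Kolmogorov complexity\<close>

abbreviation unary :: "nat \<Rightarrow> bool list" where
  "unary n \<equiv> replicate n True"

text \<open>
  \<open>dec d = Some (M, w)\<close> means that \<open>d\<close> encodes the pair \<open>(M, w)\<close>. On inputs \<open>d\<close> and
  \<open>1\<^sup>t\<close> the machine \<open>U\<close> yields the output of \<open>M(w)\<close> if that computation halts within \<open>t\<close>
  steps of \<open>M\<close>, and no output otherwise or if \<open>d\<close> encodes nothing; polynomial overhead means
  that this takes time polynomial in \<open>\<bar>d\<bar> + t\<close>. As usual for Kolmogorov complexity, descriptions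
  are efficient in the input: \<open>(M, w)\<close> has a description of length \<open>\<bar>w\<bar> + O(1)\<close>, with
  the constant depending only on \<open>M\<close>.
\<close>

definition universal_tm :: "tm \<Rightarrow> bool" where
  "universal_tm U \<longleftrightarrow> wf_tm U \<and> tapes U \<ge> 2 \<and>
     (\<exists>(dec :: bool list \<Rightarrow> (tm \<times> bool list) option) (T :: nat poly).
        (\<forall>d M w. dec d = Some (M, w) \<longrightarrow> wf_tm M) \<and>
        (\<forall>M. wf_tm M \<longrightarrow>
           (\<exists>c. \<forall>w. \<exists>d. dec d = Some (M, w) \<and> length d \<le> length w + c)) \<and>
        (\<forall>d t. halts_within U [d, unary t] (poly T (length d + t)) \<and>
           result U [d, unary t] =
             (case dec d of None \<Rightarrow> None | Some (M, w) \<Rightarrow> result_within M [w] t)))"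

text \<open>
  The infimum is over a nonempty set when \<open>U\<close> is universal: the machine with empty transition
  table outputs its input after 0 steps.
\<close>

definition K :: "tm \<Rightarrow> (nat \<Rightarrow> nat) \<Rightarrow> bool list \<Rightarrow> nat" where
  "K U t x = Inf {length d | d. result U [d, unary (t (length x))] = Some x}"


section \<open>Hardness on average and one-way functions\<close>

definition polynomial_fun :: "(nat \<Rightarrow> real) \<Rightarrow> bool" where
  "polynomial_fun f \<longleftrightarrow> (\<exists>P :: real poly. \<forall>n. f n = poly P (real n))"

definition uniform_bits :: "nat \<Rightarrow> bool list pmf" where
  "uniform_bits n = pmf_of_set {x. length x = n}"

definition poly_time_computable :: "(bool list \<Rightarrow> bool list) \<Rightarrow> bool" where
  "poly_time_computable f \<longleftrightarrow> (\<exists>M (T :: nat poly). wf_tm M \<and>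
     (\<forall>x. halts_within M [x] (poly T (length x)) \<and> result M [x] = Some (f x)))"

text \<open>
  A probabilistic algorithm with \<open>m\<close> inputs is a machine \<open>A\<close> that finds on tape \<open>m\<close>, next
  to its inputs \<open>xs\<close> on tapes \<open>0, \<dots>, m - 1\<close>, a uniformly random string \<open>r\<close> of length
  \<open>\<rho>(\<bar>xs\<bar>)\<close>. It is polynomial-time if its running time is bounded by a polynomial in
  the size of \<open>xs\<close>, for every \<open>r\<close>.
\<close>

definition ppt :: "nat \<Rightarrow> tm \<Rightarrow> nat poly \<Rightarrow> bool" where
  "ppt m A \<rho> \<longleftrightarrow> wf_tm A \<and> tapes A > m \<and>
     (\<exists>T :: nat poly. \<forall>xs r. length xs = m \<longrightarrow> length r = poly \<rho> (input_size xs) \<longrightarrow>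
        halts_within A (xs @ [r]) (poly T (input_size xs)))"

definition random_result :: "tm \<Rightarrow> nat poly \<Rightarrow> bool list list \<Rightarrow> bool list option pmf" where
  "random_result A \<rho> xs =
     map_pmf (\<lambda>r. result A (xs @ [r])) (uniform_bits (poly \<rho> (input_size xs)))"

definition success_prob :: "tm \<Rightarrow> nat poly \<Rightarrow> (bool list \<Rightarrow> bool list) \<Rightarrow> nat \<Rightarrow> real" where
  "success_prob H \<rho> g n =
     pmf (do { x \<leftarrow> uniform_bits n;
               y \<leftarrow> random_result H \<rho> [x];
               return_pmf (y = Some (g x)) }) True"

definition hard_on_average :: "(nat \<Rightarrow> real) \<Rightarrow> (bool list \<Rightarrow> bool list) \<Rightarrow> bool" where
  "hard_on_average \<alpha> g \<longleftrightarrow>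
     (\<forall>H \<rho>. ppt 1 H \<rho> \<longrightarrow> (\<forall>\<^sub>F n in sequentially. success_prob H \<rho> g n < 1 - \<alpha> n))"

text \<open>Binary representation, least significant bit first, as output format for numbers.\<close>

fun bits_of_nat :: "nat \<Rightarrow> bool list" where
  "bits_of_nat n = (if n = 0 then [] else odd n # bits_of_nat (n div 2))"

declare bits_of_nat.simps [simp del]

definition inversion_prob :: "tm \<Rightarrow> nat poly \<Rightarrow> (bool list \<Rightarrow> bool list) \<Rightarrow> nat \<Rightarrow> real" where
  "inversion_prob A \<rho> f n =
     pmf (do { x \<leftarrow> uniform_bits n;
               y \<leftarrow> random_result A \<rho> [unary n, f x];
               return_pmf (y \<in> Some ` (f -` {f x})) }) True"

definition weak_one_way :: "(bool list \<Rightarrow> bool list) \<Rightarrow> bool" where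
  "weak_one_way f \<longleftrightarrow> poly_time_computable f \<and>
     (\<exists>q. polynomial_fun q \<and> (\<forall>n. q n > 0) \<and>
        (\<forall>A \<rho>. ppt 2 A \<rho> \<longrightarrow> (\<forall>\<^sub>F n in sequentially. inversion_prob A \<rho> f n < 1 - 1 / q n)))"

definition negligible_fun :: "(nat \<Rightarrow> real) \<Rightarrow> bool" where
  "negligible_fun \<epsilon> \<longleftrightarrow> (\<forall>c :: nat. \<forall>\<^sub>F n in sequentially. \<bar>\<epsilon> n\<bar> < 1 / real n ^ c)"

definition one_way :: "(bool list \<Rightarrow> bool list) \<Rightarrow> bool" where
  "one_way f \<longleftrightarrow> poly_time_computable f \<and>
     (\<forall>A \<rho>. ppt 2 A \<rho> \<longrightarrow> (\<exists>\<epsilon>. negligible_fun \<epsilon> \<and> (\<forall>n. inversion_prob A \<rho> f n \<le> \<epsilon> n)))"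

end

theory Submission
  imports Defs
begin

text \<open>
  A description of \<open>x\<close> of length \<open>\<bar>x\<bar> + c\<close> always exists. The weak one-way function reads its input as
  \<open>1\<^sup>j 0 \<Pi>\<close>, emulates the description \<open>\<Pi>\<close>, and outputs \<open>\<bar>\<Pi>\<bar>\<close>, the length of its own input, and the result
  \<open>x\<close>. To compute \<open>K\<^sup>t(x)\<close>, a heuristic asks an inverter for preimages of \<open>(q, x)\<close> for \<open>q = 0, 1, \<dots>\<close>
  and returns the first \<open>q\<close> for which it obtains one. It can only err on \<open>x\<close> if the inverter fails on
  the image of one particular input that belongs to \<open>x\<close>, and inputs are only \<open>c + 1\<close> bits longer than
  \<open>x\<close>; hence the error probability of the heuristic is at most \<open>2\<^sup>c\<^sup>+\<^sup>1\<close> times that of the inverter.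

  The one-way function is the direct product of many copies of the weak one (Yao). From an inverter of
  the product with noticeable success one inverts the factor by planting the challenge at every
  position among random blocks, with many repetitions; strings for which no position has a noticeable
  success probability must be rare, since almost every input of the product would contain one of them.

  Polynomial time is treated as a class of functions on strings that is closed under composition,
  bounded recursion on notation and clocked calls of arbitrary machines. The closure properties are
  proved on Turing machines whose tapes serve as stacks: since a tape is stored relative to its
  head, pushing and popping at the front of an input string take a constant number of steps.
\<close>

section \<open>Combining Turing machines\<close>

text \<open>The heuristic for \<open>K\<close> pays for one query only: an answer counts after
  \<open>f\<close> has been recomputed on it, and for q < K^t(x) there is no preimage, so only the
  query with q = K^t(x) can go wrong. Images also carry the input length, because the time bound t
  depends on it. On the machine side the obstacle is that a called machine stops with arbitrary
  symbols on both sides of its heads. Its clock bounds that region, so its tapes can be swept clean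
  before the next call. Moreover, combinators must treat all symbols of an infinite type uniformly,
  while a well-formed table is finite. In the amplification, an inverter whose success is not
  negligible succeeds at infinitely many lengths N, of any form. The product is therefore defined on
  every length, surplus bits being ignored, and each N belongs to exactly one block length n. A
  single large n of this kind contradicts weak one-wayness.\<close>

definition tv :: "nat \<Rightarrow> (nat \<Rightarrow> tape) \<Rightarrow> tape list" where
  "tv W t = map t [0..<W]"

lemma length_tv [simp]: "length (tv W t) = W"
  by (simp add: tv_def)

lemma nth_tv [simp]: "i < W \<Longrightarrow> tv W t ! i = t i"
  by (simp add: tv_def)

lemma tv_cong: "(\<And>i. i < W \<Longrightarrow> t i = u i) \<Longrightarrow> tv W t = tv W u"
  by (simp add: tv_def)

lemma tv_eq_iff: "tv W t = tv W u \<longleftrightarrow> (\<forall>i<W. t i = u i)"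
  by (auto simp: tv_def)

section \<open>Runs, and machines with finite control\<close>

lemma length_scanned [simp]: "length (scanned \<tau>s) = length \<tau>s"
  by (simp add: scanned_def)

lemma scanned_nth [simp]: "i < length \<tau>s \<Longrightarrow> scanned \<tau>s ! i = (\<tau>s ! i) 0"
  by (simp add: scanned_def)

text \<open>\<open>step\<close> stutters in a halted configuration; here \<open>n\<close> counts
  table transitions only. Such a run survives inside a larger machine that goes on after
  \<open>M\<close> has halted.\<close>

inductive reaches :: "tm \<Rightarrow> config \<Rightarrow> nat \<Rightarrow> config \<Rightarrow> bool" for M where
  reaches_refl: "reaches M c 0 c"
| reaches_step: "delta M (q, scanned \<tau>s) = Some (q', as) \<Longrightarrow> reaches M (q', map2 act as \<tau>s) n c
    \<Longrightarrow> reaches M (q, \<tau>s) (Suc n) c"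

lemma reaches_trans: "reaches M c m c' \<Longrightarrow> reaches M c' n c'' \<Longrightarrow> reaches M c (m + n) c''"
  by (induction rule: reaches.induct) (auto intro: reaches.intros)

lemma reaches_steps: "reaches M c n c' \<Longrightarrow> (step M ^^ n) c = c'"
proof (induction rule: reaches.induct)
  case (reaches_step q \<tau>s q' as n c)
  have "step M (q, \<tau>s) = (q', map2 act as \<tau>s)"
    using reaches_step(1) by (simp add: step_def)
  then show ?case using reaches_step.IH by (simp only: funpow_Suc_right o_apply)
qed simp

definition stops :: "tm \<Rightarrow> tape list \<Rightarrow> nat \<Rightarrow> tape list \<Rightarrow> bool" where
  "stops M \<tau>s T \<tau>s' \<longleftrightarrow>
     (\<exists>n\<le>T. \<exists>q. reaches M (0, \<tau>s) n (q, \<tau>s') \<and> delta M (q, scanned \<tau>s') = None)"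

lemma stops_mono: "stops M \<tau>s T \<tau>s' \<Longrightarrow> T \<le> T' \<Longrightarrow> stops M \<tau>s T' \<tau>s'"
  unfolding stops_def by (meson le_trans)

text \<open>A written symbol is from \<open>G\<close> or was scanned in the same step. So a machine
  may copy arbitrary symbols, yet no run introduces new ones outside \<open>G\<close>.\<close>

definition table_within :: "nat \<Rightarrow> nat set \<Rightarrow> symbol set \<Rightarrow> tm \<Rightarrow> bool" where
  "table_within W Q G M \<longleftrightarrow> (\<forall>q ss q' as. delta M (q, ss) = Some (q', as) \<longrightarrow>
     length ss = W \<and> length as = W \<and> q' \<in> Q \<and> fst ` set as \<subseteq> set ss \<union> G)"

text \<open>Unlike \<^const>\<open>wf_tm\<close>, this allows transitions for all symbols, so that combinators need no
  side conditions on alphabets. Restricting the table at the very end yields a well-formed machine.\<close>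

definition good :: "nat \<Rightarrow> tm \<Rightarrow> bool" where
  "good W M \<longleftrightarrow> tapes M = W \<and> (\<exists>Q G. finite Q \<and> finite G \<and> table_within W Q G M)"

lemma table_withinD:
  "table_within W Q G M \<Longrightarrow> delta M (q, ss) = Some (q', as) \<Longrightarrow>
     length ss = W \<and> length as = W \<and> q' \<in> Q \<and> fst ` set as \<subseteq> set ss \<union> G"
  unfolding table_within_def by blast

lemma goodI:
  assumes "tapes M = W" "finite Q" "finite G"
    and "\<And>q ss q' as. delta M (q, ss) = Some (q', as) \<Longrightarrow>
        length ss = W \<and> length as = W \<and> q' \<in> Q \<and> fst ` set as \<subseteq> set ss \<union> G"
  shows "good W M"
  using assms unfolding good_def table_within_def by blast

lemma goodE:
  assumes "good W M"
  obtains Q G where "tapes M = W" "finite Q" "finite G" "table_within W Q G M"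
  using assms unfolding good_def by blast

lemma good_tapes: "good W M \<Longrightarrow> tapes M = W"
  by (simp add: good_def)

lemma good_length:
  "good W M \<Longrightarrow> delta M (q, ss) = Some (q', as) \<Longrightarrow> length ss = W \<and> length as = W"
  unfolding good_def table_within_def by blast

lemma wf_tm_good: assumes "wf_tm M" shows "good (tapes M) M"
proof (rule goodI[where Q = "(\<lambda>x. fst (the (delta M x))) ` dom (delta M)"
      and G = "\<Union>x\<in>dom (delta M). fst ` set (snd (the (delta M x)))"])
  have fin: "finite (dom (delta M))" using assms by (simp add: wf_tm_def)
  then show "finite ((\<lambda>x. fst (the (delta M x))) ` dom (delta M))"
    "finite (\<Union>x\<in>dom (delta M). fst ` set (snd (the (delta M x))))" by auto
  fix q ss q' as
  assume a: "delta M (q, ss) = Some (q', as)"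
  then have d: "(q, ss) \<in> dom (delta M)" by auto
  have "q' \<in> (\<lambda>x. fst (the (delta M x))) ` dom (delta M)"
    using d a by (intro image_eqI[OF _ d]) simp
  moreover have "fst ` set as \<subseteq> (\<Union>x\<in>dom (delta M). fst ` set (snd (the (delta M x))))"
    using UN_upper[OF d, of "\<lambda>x. fst ` set (snd (the (delta M x)))"] a by simp
  ultimately show "length ss = tapes M \<and> length as = tapes M
    \<and> q' \<in> (\<lambda>x. fst (the (delta M x))) ` dom (delta M)
    \<and> fst ` set as \<subseteq> set ss \<union> (\<Union>x\<in>dom (delta M). fst ` set (snd (the (delta M x))))"
    using a assms unfolding wf_tm_def by blast
qed simp

lemma reaches_length:
  "reaches M c n c' \<Longrightarrow> good W M \<Longrightarrow> length (snd c) = W \<Longrightarrow> length (snd c') = W"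
  by (induction rule: reaches.induct) (auto dest: good_length)

lemma stops_length:
  "stops M \<tau>s T \<tau>s' \<Longrightarrow> good W M \<Longrightarrow> length \<tau>s = W \<Longrightarrow> length \<tau>s' = W"
  unfolding stops_def using reaches_length by fastforce

text \<open>Every combinator contains its components as copies with states renamed by some
  \<open>e\<close>; this carries their runs over step by step.\<close>

lemma reaches_embed:
  assumes "reaches M (q, \<tau>s) n (q', \<tau>s')" "good W M" "length \<tau>s = W"
    and e: "\<And>q ss q' as. length ss = W \<Longrightarrow> delta M (q, ss) = Some (q', as) \<Longrightarrow>
              delta M' (e q, ss) = Some (e q', as)"
  shows "reaches M' (e q, \<tau>s) n (e q', \<tau>s')"
  using assms(1,3)
proof (induction "(q, \<tau>s)" n "(q', \<tau>s')" arbitrary: q \<tau>s rule: reaches.induct)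
  case (reaches_step q \<tau>s q1 as n)
  then have "length (map2 act as \<tau>s) = W"
    using good_length[OF assms(2)] by fastforce
  with reaches_step e show ?case by (intro reaches.reaches_step) auto
qed (rule reaches.intros)

section \<open>Sequencing, loops and branching\<close>

definition stay :: "symbol list \<Rightarrow> (symbol \<times> direction) list" where
  "stay ss = map (\<lambda>s. (s, Stay)) ss"

lemma map2_act_stay [simp]: "map2 act (stay (scanned \<tau>s)) \<tau>s = \<tau>s"
  by (rule nth_equalityI) (auto simp: stay_def scanned_def)

lemma length_stay [simp]: "length (stay ss) = length ss"
  by (simp add: stay_def)

lemma fst_set_stay [simp]: "fst ` set (stay ss) = set ss"
  by (simp add: stay_def image_image)

text \<open>Even states run \<open>M1\<close> and odd ones \<open>M2\<close>, with 0 and 1 as their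
  initial states; where \<open>M1\<close> would halt, one idle step hands over. \<open>loop\<close>
  and \<open>branch\<close> reserve state 0 for the test and shift the states of their
  parts.\<close>

definition seq :: "tm \<Rightarrow> tm \<Rightarrow> tm" where
  "seq M1 M2 = TM (tapes M1) (\<lambda>(q, ss).
     if length ss \<noteq> tapes M1 then None
     else if even q then
       (case delta M1 (q div 2, ss) of None \<Rightarrow> Some (1, stay ss) | Some (q', as) \<Rightarrow> Some (2 * q', as))
     else
       (case delta M2 (q div 2, ss) of None \<Rightarrow> None | Some (q', as) \<Rightarrow> Some (2 * q' + 1, as)))"

definition loop :: "(symbol list \<Rightarrow> bool) \<Rightarrow> tm \<Rightarrow> tm" where
  "loop P M = TM (tapes M) (\<lambda>(q, ss).
     if length ss \<noteq> tapes M then None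
     else case q of
       0 \<Rightarrow> if P ss then Some (1, stay ss) else None
     | Suc q \<Rightarrow>
       (case delta M (q, ss) of None \<Rightarrow> Some (0, stay ss) | Some (q', as) \<Rightarrow> Some (Suc q', as)))"

definition branch :: "(symbol list \<Rightarrow> bool) \<Rightarrow> tm \<Rightarrow> tm \<Rightarrow> tm" where
  "branch P M1 M2 = TM (tapes M1) (\<lambda>(q, ss).
     if length ss \<noteq> tapes M1 then None
     else case q of
       0 \<Rightarrow> Some (if P ss then 1 else 2, stay ss)
     | Suc q \<Rightarrow>
       if even q then
         (case delta M1 (q div 2, ss) of None \<Rightarrow> None | Some (q', as) \<Rightarrow> Some (2 * q' + 1, as))
       else
         (case delta M2 (q div 2, ss) of None \<Rightarrow> None | Some (q', as) \<Rightarrow> Some (2 * q' + 2, as)))"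

lemma good_seq:
  assumes "good W M1" "good W M2" shows "good W (seq M1 M2)"
proof -
  obtain Q1 G1 where 1: "tapes M1 = W" "finite Q1" "finite G1" "table_within W Q1 G1 M1"
    using assms(1) by (rule goodE)
  obtain Q2 G2 where 2: "tapes M2 = W" "finite Q2" "finite G2" "table_within W Q2 G2 M2"
    using assms(2) by (rule goodE)
  show ?thesis
  proof (rule goodI[where Q = "{0, 1, 2} \<union> ((\<lambda>q. 2 * q) ` Q1 \<union> (\<lambda>q. 2 * q + 1) ` Q2)" and G = "G1 \<union> G2"])
    fix q ss q' as
    assume "delta (seq M1 M2) (q, ss) = Some (q', as)"
    then consider "length ss = W" "as = stay ss" "q' \<in> {0, 1, 2}"
      | q0 q1 where "delta M1 (q0, ss) = Some (q1, as)" "q' = 2 * q1"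
      | q0 q1 where "delta M2 (q0, ss) = Some (q1, as)" "q' = 2 * q1 + 1"
      using 1(1) 2(1) by (auto simp: seq_def split: if_splits option.splits nat.splits)
    then show "length ss = W \<and> length as = W \<and> q' \<in> {0, 1, 2} \<union> ((\<lambda>q. 2 * q) ` Q1 \<union> (\<lambda>q. 2 * q + 1) ` Q2)
        \<and> fst ` set as \<subseteq> set ss \<union> (G1 \<union> G2)"
      by cases (auto dest: table_withinD[OF 1(4)] table_withinD[OF 2(4)])
  qed (use 1(1-3) 2(1-3) in \<open>auto simp: seq_def\<close>)
qed

lemma good_loop:
  assumes "good W M" shows "good W (loop P M)"
proof -
  obtain Q1 G1 where 1: "tapes M = W" "finite Q1" "finite G1" "table_within W Q1 G1 M"
    using assms(1) by (rule goodE)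
  show ?thesis
  proof (rule goodI[where Q = "{0, 1, 2} \<union> Suc ` Q1" and G = "G1"])
    fix q ss q' as
    assume "delta (loop P M) (q, ss) = Some (q', as)"
    then consider "length ss = W" "as = stay ss" "q' \<in> {0, 1, 2}"
      | q0 q1 where "delta M (q0, ss) = Some (q1, as)" "q' = Suc q1"
      using 1(1) by (auto simp: loop_def split: if_splits option.splits nat.splits)
    then show "length ss = W \<and> length as = W \<and> q' \<in> {0, 1, 2} \<union> Suc ` Q1
        \<and> fst ` set as \<subseteq> set ss \<union> (G1)"
      by cases (auto dest: table_withinD[OF 1(4)])
  qed (use 1(1-3) in \<open>auto simp: loop_def\<close>)
qed

lemma good_branch:
  assumes "good W M1" "good W M2" shows "good W (branch P M1 M2)"
proof -
  obtain Q1 G1 where 1: "tapes M1 = W" "finite Q1" "finite G1" "table_within W Q1 G1 M1"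
    using assms(1) by (rule goodE)
  obtain Q2 G2 where 2: "tapes M2 = W" "finite Q2" "finite G2" "table_within W Q2 G2 M2"
    using assms(2) by (rule goodE)
  show ?thesis
  proof (rule goodI[where Q = "{0, 1, 2} \<union> ((\<lambda>q. 2 * q + 1) ` Q1 \<union> (\<lambda>q. 2 * q + 2) ` Q2)" and G = "G1 \<union> G2"])
    fix q ss q' as
    assume "delta (branch P M1 M2) (q, ss) = Some (q', as)"
    then consider "length ss = W" "as = stay ss" "q' \<in> {0, 1, 2}"
      | q0 q1 where "delta M1 (q0, ss) = Some (q1, as)" "q' = 2 * q1 + 1"
      | q0 q1 where "delta M2 (q0, ss) = Some (q1, as)" "q' = 2 * q1 + 2"
      using 1(1) 2(1) by (auto simp: branch_def split: if_splits option.splits nat.splits)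
    then show "length ss = W \<and> length as = W \<and> q' \<in> {0, 1, 2} \<union> ((\<lambda>q. 2 * q + 1) ` Q1 \<union> (\<lambda>q. 2 * q + 2) ` Q2)
        \<and> fst ` set as \<subseteq> set ss \<union> (G1 \<union> G2)"
      by cases (auto dest: table_withinD[OF 1(4)] table_withinD[OF 2(4)])
  qed (use 1(1-3) 2(1-3) in \<open>auto simp: branch_def\<close>)
qed

lemma stops_seq:
  assumes "good W M1" "good W M2" "length \<tau>s = W"
    and "stops M1 \<tau>s T1 \<tau>s'" "stops M2 \<tau>s' T2 \<tau>s''"
  shows "stops (seq M1 M2) \<tau>s (T1 + T2 + 1) \<tau>s''"
proof -
  obtain n1 q1 where 1: "n1 \<le> T1" "reaches M1 (0, \<tau>s) n1 (q1, \<tau>s')" "delta M1 (q1, scanned \<tau>s') = None"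
    using assms(4) by (auto simp: stops_def)
  obtain n2 q2 where 2: "n2 \<le> T2" "reaches M2 (0, \<tau>s') n2 (q2, \<tau>s'')" "delta M2 (q2, scanned \<tau>s'') = None"
    using assms(5) by (auto simp: stops_def)
  have l: "length \<tau>s' = W" "length \<tau>s'' = W"
    using stops_length assms by blast+
  note t = good_tapes[OF assms(1)]
  have r1: "reaches (seq M1 M2) (0, \<tau>s) n1 (2 * q1, \<tau>s')"
    using reaches_embed[OF 1(2) assms(1,3), where M' = "seq M1 M2" and e = "\<lambda>q. 2 * q"] t
    by (simp add: seq_def)
  have r2: "reaches (seq M1 M2) (Suc 0, \<tau>s') n2 (2 * q2 + 1, \<tau>s'')"
    using reaches_embed[OF 2(2) assms(2) l(1), where M' = "seq M1 M2" and e = "\<lambda>q. 2 * q + 1"] t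
    by (simp add: seq_def)
  have "reaches (seq M1 M2) (2 * q1, \<tau>s') (Suc n2) (2 * q2 + 1, \<tau>s'')"
    by (rule reaches_step[where q' = 1 and as = "stay (scanned \<tau>s')"])
      (use 1(3) t l r2 in \<open>simp_all add: seq_def\<close>)
  from reaches_trans[OF r1 this] have "reaches (seq M1 M2) (0, \<tau>s) (n1 + Suc n2) (2 * q2 + 1, \<tau>s'')" .
  moreover have "delta (seq M1 M2) (2 * q2 + 1, scanned \<tau>s'') = None"
    using 2(3) by (simp add: seq_def)
  moreover have "n1 + Suc n2 \<le> T1 + T2 + 1" using 1(1) 2(1) by simp
  ultimately show ?thesis unfolding stops_def by blast
qed

lemma stops_branch:
  assumes "good W M1" "good W M2" "length \<tau>s = W"
    and "stops (if P (scanned \<tau>s) then M1 else M2) \<tau>s T \<tau>s'"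
  shows "stops (branch P M1 M2) \<tau>s (T + 1) \<tau>s'"
proof -
  let ?M = "if P (scanned \<tau>s) then M1 else M2"
  let ?e = "\<lambda>q. Suc (2 * q + (if P (scanned \<tau>s) then 0 else 1))"
  obtain n q where 1: "n \<le> T" "reaches ?M (0, \<tau>s) n (q, \<tau>s')" "delta ?M (q, scanned \<tau>s') = None"
    using assms(4) unfolding stops_def by blast
  have g: "good W ?M" using assms(1,2) by simp
  note t = good_tapes[OF assms(1)]
  have "reaches (branch P M1 M2) (?e 0, \<tau>s) n (?e q, \<tau>s')"
    by (rule reaches_embed[OF 1(2) g assms(3), where e = ?e]) (use t in \<open>simp add: branch_def split: if_splits\<close>)
  then have "reaches (branch P M1 M2) (0, \<tau>s) (Suc n) (?e q, \<tau>s')"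
    by (intro reaches_step[where q' = "?e 0" and as = "stay (scanned \<tau>s)"])
      (use t assms(3) in \<open>simp_all add: branch_def\<close>)
  moreover have "delta (branch P M1 M2) (?e q, scanned \<tau>s') = None"
    using 1(3) by (simp add: branch_def split: if_splits)
  moreover have "Suc n \<le> T + 1" using 1(1) by simp
  ultimately show ?thesis unfolding stops_def by blast
qed

lemma stops_loop_exit: "\<not> P (scanned \<tau>s) \<Longrightarrow> stops (loop P M) \<tau>s T \<tau>s"
  unfolding stops_def by (intro exI[of _ 0] conjI) (auto simp: loop_def intro: reaches_refl)

lemma stops_loop_step:
  assumes "good W M" "length \<tau>s = W" "P (scanned \<tau>s)"
    and "stops M \<tau>s T1 \<tau>s'" "stops (loop P M) \<tau>s' T2 \<tau>s''"
  shows "stops (loop P M) \<tau>s (T1 + T2 + 2) \<tau>s''"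
proof -
  obtain n1 q1 where 1: "n1 \<le> T1" "reaches M (0, \<tau>s) n1 (q1, \<tau>s')" "delta M (q1, scanned \<tau>s') = None"
    using assms(4) by (auto simp: stops_def)
  obtain n2 q2 where 2: "n2 \<le> T2" "reaches (loop P M) (0, \<tau>s') n2 (q2, \<tau>s'')"
    "delta (loop P M) (q2, scanned \<tau>s'') = None"
    using assms(5) by (auto simp: stops_def)
  have l: "length \<tau>s' = W" using stops_length assms by blast
  note t = good_tapes[OF assms(1)]
  have "reaches (loop P M) (Suc 0, \<tau>s) n1 (Suc q1, \<tau>s')"
    using reaches_embed[OF 1(2) assms(1,2), where M' = "loop P M" and e = Suc] t
    by (simp add: loop_def)
  then have r1: "reaches (loop P M) (0, \<tau>s) (Suc n1) (Suc q1, \<tau>s')"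
    by (intro reaches_step[where q' = 1 and as = "stay (scanned \<tau>s)"])
      (use assms t in \<open>simp_all add: loop_def\<close>)
  have r2: "reaches (loop P M) (Suc q1, \<tau>s') (Suc n2) (q2, \<tau>s'')"
    by (rule reaches_step[where q' = 0 and as = "stay (scanned \<tau>s')"])
      (use 1(3) 2 t l in \<open>simp_all add: loop_def\<close>)
  have "reaches (loop P M) (0, \<tau>s) (Suc n1 + Suc n2) (q2, \<tau>s'')"
    by (rule reaches_trans[OF r1 r2])
  moreover have "Suc n1 + Suc n2 \<le> T1 + T2 + 2" using 1 2 by simp
  ultimately show ?thesis unfolding stops_def using 2(3) by blast
qed

section \<open>Single steps, and runs on selected tapes\<close>

definition opm :: "nat \<Rightarrow> (symbol list \<Rightarrow> nat \<Rightarrow> symbol \<times> direction) \<Rightarrow> tm" where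
  "opm W a = TM W (\<lambda>(q, ss). if q = 0 \<and> length ss = W then Some (1, map (a ss) [0..<W]) else None)"

abbreviation bits_and_blank :: "symbol set" where
  "bits_and_blank \<equiv> {Blank, Bit True, Bit False}"

lemma good_opm:
  assumes "\<And>ss j. length ss = W \<Longrightarrow> j < W \<Longrightarrow> fst (a ss j) \<in> set ss \<union> bits_and_blank"
  shows "good W (opm W a)"
proof (rule goodI[where Q = "{1}" and G = bits_and_blank])
  fix q ss q' as
  assume "delta (opm W a) (q, ss) = Some (q', as)"
  then have "length ss = W" "q' = 1" "as = map (a ss) [0..<W]"
    by (auto simp: opm_def split: if_splits)
  moreover have "fst ` set (map (a ss) [0..<W]) \<subseteq> set ss \<union> bits_and_blank"
    using assms[OF \<open>length ss = W\<close>] by (auto simp: image_subset_iff)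
  ultimately show "length ss = W \<and> length as = W \<and> q' \<in> {1}
      \<and> fst ` set as \<subseteq> set ss \<union> bits_and_blank"
    by simp
qed (simp_all add: opm_def)

lemma stops_opm:
  "stops (opm W a) (tv W t) 1 (tv W (\<lambda>j. act (a (scanned (tv W t)) j) (t j)))"
proof -
  have "map2 act (map (a (scanned (tv W t))) [0..<W]) (tv W t)
      = tv W (\<lambda>j. act (a (scanned (tv W t)) j) (t j))"
    by (rule nth_equalityI) auto
  then have "reaches (opm W a) (0, tv W t) (Suc 0) (1, tv W (\<lambda>j. act (a (scanned (tv W t)) j) (t j)))"
    by (intro reaches_step[where q' = 1 and as = "map (a (scanned (tv W t))) [0..<W]"])
      (auto simp: opm_def intro: reaches_refl)
  then show ?thesis unfolding stops_def by (intro exI[of _ "Suc 0"]) (auto simp: opm_def)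
qed

text \<open>Lets a machine with \<open>k\<close> tapes work on the tapes \<open>ix 0\<close>, ...,
  \<open>ix (k - 1)\<close> among \<open>W\<close>. \<open>inv_into\<close> finds which tape of
  \<open>M\<close> a given tape stands for; all others idle.\<close>

definition lift :: "nat \<Rightarrow> nat \<Rightarrow> (nat \<Rightarrow> nat) \<Rightarrow> tm \<Rightarrow> tm" where
  "lift W k ix M = TM W (\<lambda>(q, ss).
     if length ss \<noteq> W then None
     else case delta M (q, map (\<lambda>i. ss ! ix i) [0..<k]) of
       None \<Rightarrow> None
     | Some (q', as) \<Rightarrow> Some (q', map (\<lambda>j. if j \<in> ix ` {..<k}
         then as ! inv_into {..<k} ix j else (ss ! j, Stay)) [0..<W]))"

lemma good_lift:
  assumes "good k M" "inj_on ix {..<k}" "\<And>i. i < k \<Longrightarrow> ix i < W"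
  shows "good W (lift W k ix M)"
proof -
  obtain Q G where 1: "tapes M = k" "finite Q" "finite G" "table_within k Q G M"
    using assms(1) by (rule goodE)
  show ?thesis
  proof (rule goodI[where Q = Q and G = G])
    fix q ss q' as
    assume a: "delta (lift W k ix M) (q, ss) = Some (q', as)"
    then obtain as' where d: "delta M (q, map (\<lambda>i. ss ! ix i) [0..<k]) = Some (q', as')"
      and as: "as = map (\<lambda>j. if j \<in> ix ` {..<k}
         then as' ! inv_into {..<k} ix j else (ss ! j, Stay)) [0..<W]" and l: "length ss = W"
      by (auto simp: lift_def split: if_splits option.splits)
    note * = table_withinD[OF 1(4) d]
    have "fst (as ! j) \<in> set ss \<union> G" if j: "j < W" for j
    proof (cases "j \<in> ix ` {..<k}")
      case True
      then obtain i where i: "i < k" "j = ix i" by auto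
      then have "inv_into {..<k} ix j = i" using assms(2) by (simp add: inv_into_f_f)
      then have "fst (as ! j) = fst (as' ! i)" using as j True by simp
      moreover have "fst (as' ! i) \<in> set (map (\<lambda>i. ss ! ix i) [0..<k]) \<union> G"
      proof -
        have "fst (as' ! i) \<in> fst ` set as'" using * i by simp
        then show ?thesis using * by blast
      qed
      moreover have "set (map (\<lambda>i. ss ! ix i) [0..<k]) \<subseteq> set ss" using assms(3) l by auto
      ultimately show ?thesis by auto
    qed (use as j l in auto)
    moreover have "length as = W" using as by simp
    ultimately have "fst ` set as \<subseteq> set ss \<union> G" by (metis image_subsetI in_set_conv_nth)
    then show "length ss = W \<and> length as = W \<and> q' \<in> Q \<and> fst ` set as \<subseteq> set ss \<union> G"
      using * as l by auto
  qed (use 1 in \<open>auto simp: lift_def\<close>)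
qed

lemma reaches_lift:
  assumes "reaches M (q, tv k (\<lambda>i. t (ix i))) n (q', tv k u)"
    and g: "good k M" "inj_on ix {..<k}" "\<And>i. i < k \<Longrightarrow> ix i < W"
  shows "reaches (lift W k ix M) (q, tv W t) n
     (q', tv W (\<lambda>j. if j \<in> ix ` {..<k} then u (inv_into {..<k} ix j) else t j))"
  using assms(1)
proof (induction "(q, tv k (\<lambda>i. t (ix i)))" n "(q', tv k u)" arbitrary: q t rule: reaches.induct)
  case reaches_refl
  have "tv W (\<lambda>j. if j \<in> ix ` {..<k} then u (inv_into {..<k} ix j) else t j) = tv W t"
    using reaches_refl g by (intro tv_cong) (auto simp: inv_into_f_f tv_eq_iff)
  then show ?case using reaches_refl by (simp add: reaches.reaches_refl)
next
  case (reaches_step q q1 as n)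
  let ?t = "\<lambda>j. if j \<in> ix ` {..<k} then act (as ! inv_into {..<k} ix j) (t j) else t j"
  have las: "length as = k" using good_length[OF g(1) reaches_step(1)] by simp
  have "map2 act as (tv k (\<lambda>i. t (ix i))) = tv k (\<lambda>i. ?t (ix i))"
    using g las by (intro nth_equalityI) (auto simp: inv_into_f_f)
  note IH = reaches_step(3)[OF this]
  have eq: "tv W (\<lambda>j. if j \<in> ix ` {..<k} then u (inv_into {..<k} ix j) else ?t j)
     = tv W (\<lambda>j. if j \<in> ix ` {..<k} then u (inv_into {..<k} ix j) else t j)"
    by (rule tv_cong) simp
  have sc: "map (\<lambda>i. scanned (tv W t) ! ix i) [0..<k] = scanned (tv k (\<lambda>i. t (ix i)))"
    using g(3) by (intro nth_equalityI) auto
  show ?case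
  proof (rule reaches.reaches_step)
    show "delta (lift W k ix M) (q, scanned (tv W t)) = Some (q1, map (\<lambda>j. if j \<in> ix ` {..<k}
         then as ! inv_into {..<k} ix j else (scanned (tv W t) ! j, Stay)) [0..<W])"
      using reaches_step(1) by (simp add: lift_def sc)
    have "map2 act (map (\<lambda>j. if j \<in> ix ` {..<k} then as ! inv_into {..<k} ix j
        else (scanned (tv W t) ! j, Stay)) [0..<W]) (tv W t) = tv W ?t"
      by (rule nth_equalityI) auto
    then show "reaches (lift W k ix M) (q1, map2 act (map (\<lambda>j. if j \<in> ix ` {..<k}
         then as ! inv_into {..<k} ix j else (scanned (tv W t) ! j, Stay)) [0..<W]) (tv W t)) n
       (q', tv W (\<lambda>j. if j \<in> ix ` {..<k} then u (inv_into {..<k} ix j) else t j))"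
      using IH by (simp only: eq)
  qed
qed

lemma stops_lift:
  assumes "stops M (tv k (\<lambda>i. t (ix i))) T (tv k u)"
    and g: "good k M" "inj_on ix {..<k}" "\<And>i. i < k \<Longrightarrow> ix i < W"
  shows "stops (lift W k ix M) (tv W t) T
     (tv W (\<lambda>j. if j \<in> ix ` {..<k} then u (inv_into {..<k} ix j) else t j))"
proof -
  obtain n q where 1: "n \<le> T" "reaches M (0, tv k (\<lambda>i. t (ix i))) n (q, tv k u)"
    "delta M (q, scanned (tv k u)) = None"
    using assms(1) by (auto simp: stops_def)
  let ?u = "\<lambda>j. if j \<in> ix ` {..<k} then u (inv_into {..<k} ix j) else t j"
  have "map (\<lambda>i. scanned (tv W ?u) ! ix i) [0..<k] = scanned (tv k u)"
    using g by (intro nth_equalityI) (auto simp: inv_into_f_f)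
  then have "delta (lift W k ix M) (q, scanned (tv W ?u)) = None"
    using 1(3) by (simp add: lift_def)
  then show ?thesis unfolding stops_def using reaches_lift[OF 1(2) g] 1(1) by blast
qed

section \<open>Space used by a run\<close>

definition confined :: "nat \<Rightarrow> tape \<Rightarrow> bool" where
  "confined b \<tau> \<longleftrightarrow> (\<forall>i. \<tau> i \<noteq> Blank \<longrightarrow> \<bar>i\<bar> \<le> int b)"

text \<open>Positions are relative to the head, so a step shifts the content as well as writing to
  it; together this enlarges the nonblank region by at most one cell.\<close>

lemma confined_act: "confined b \<tau> \<Longrightarrow> confined (Suc b) (act a \<tau>)"
proof -
  assume w: "confined b \<tau>"
  obtain s d where a: "a = (s, d)" by (cases a)
  have "\<bar>i\<bar> \<le> int (Suc b)" if "act a \<tau> i \<noteq> Blank" for i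
  proof (cases "i + offset d = 0")
    case True
    then show ?thesis by (cases d) auto
  next
    case False
    then have "\<tau> (i + offset d) \<noteq> Blank" using that a by simp
    then have "\<bar>i + offset d\<bar> \<le> int b" using w by (simp add: confined_def)
    then show ?thesis by (cases d) auto
  qed
  then show ?thesis by (simp add: confined_def)
qed

lemma confined_mono: "confined b \<tau> \<Longrightarrow> b \<le> b' \<Longrightarrow> confined b' \<tau>"
  unfolding confined_def by force

lemma confined_input_tape: "confined (length x) (input_tape x)"
  by (auto simp: confined_def input_tape_def)

lemma confined_reaches:
  "reaches M c n c' \<Longrightarrow> good W M \<Longrightarrow> \<forall>\<tau>\<in>set (snd c). confined b \<tau> \<Longrightarrow>
     \<forall>\<tau>\<in>set (snd c'). confined (b + n) \<tau>"
proof (induction arbitrary: b rule: reaches.induct)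
  case (reaches_step q \<tau>s q' as n c)
  have "\<forall>\<tau>\<in>set (map2 act as \<tau>s). confined (Suc b) \<tau>"
    using reaches_step(5) by (auto simp: in_set_zip intro!: confined_act)
  then show ?case using reaches_step.IH[of "Suc b"] reaches_step(4) by simp
qed simp

lemma confined_input_tapeD: "confined b (input_tape x) \<Longrightarrow> length x \<le> Suc b"
proof (rule ccontr)
  assume "confined b (input_tape x)" "\<not> length x \<le> Suc b"
  then show False unfolding confined_def input_tape_def
    by (auto dest!: spec[of _ "int (Suc b)"])
qed

section \<open>Restriction to a finite table\<close>

definition restrict_table :: "symbol set \<Rightarrow> nat set \<Rightarrow> tm \<Rightarrow> tm" where
  "restrict_table G Q M = TM (tapes M) (delta M |` (Q \<times> {ss. length ss = tapes M \<and> set ss \<subseteq> G}))"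

text \<open>On tapes with bits and blanks only, a run meets finitely many states and symbols.
  Cutting the table down to these makes it finite without changing the run.\<close>

lemma good_imp_wf_tm:
  assumes "good W M" "W \<ge> 1"
  obtains M' where "wf_tm M'" "tapes M' = W"
    and "\<And>\<tau>s T \<tau>s'. stops M \<tau>s T \<tau>s' \<Longrightarrow> length \<tau>s = W \<Longrightarrow>
           (\<And>\<tau>. \<tau> \<in> set \<tau>s \<Longrightarrow> range \<tau> \<subseteq> bits_and_blank) \<Longrightarrow> stops M' \<tau>s T \<tau>s'"
proof -
  obtain Q G where 1: "tapes M = W" "finite Q" "finite G" "table_within W Q G M"
    using assms(1) by (rule goodE)
  define G' where "G' = G \<union> bits_and_blank"
  define M' where "M' = restrict_table G' (insert 0 Q) M"
  have t: "tapes M' = W" by (simp add: M'_def restrict_table_def 1)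
  have "finite G'" by (simp add: G'_def 1)
  then have "finite {ss. set ss \<subseteq> G' \<and> length ss = W}" by (rule finite_lists_length_eq)
  then have "finite (insert 0 Q \<times> {ss. length ss = W \<and> set ss \<subseteq> G'})"
    using 1 by (simp add: conj_commute)
  then have "finite (dom (delta M'))"
    by (rule rev_finite_subset) (use 1 in \<open>auto simp: M'_def restrict_table_def restrict_map_def split: if_splits\<close>)
  then have wf: "wf_tm M'"
  proof -
    have "length ss = W \<and> length as = W" if "delta M' (q, ss) = Some (q', as)" for q ss q' as
      using that table_withinD[OF 1(4), of q ss q' as] by (simp add: M'_def restrict_table_def restrict_map_def split: if_splits)
    then show ?thesis using \<open>finite (dom (delta M'))\<close> assms(2) t unfolding wf_tm_def by blast
  qed
  have sc: "set (scanned \<tau>s) \<subseteq> G'" if "\<forall>\<tau>\<in>set \<tau>s. range \<tau> \<subseteq> G'" for \<tau>s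
    using that by (auto simp: scanned_def)
  have eq: "delta M' (q, scanned \<tau>s) = delta M (q, scanned \<tau>s)"
    if "q \<in> insert 0 Q" "\<forall>\<tau>\<in>set \<tau>s. range \<tau> \<subseteq> G'" "length \<tau>s = W" for q \<tau>s
    using that sc[OF that(2)] 1 by (simp add: M'_def restrict_table_def)
  \<comment> \<open>Invariant: states stay in \<open>insert 0 Q\<close> and symbols in
    \<open>G'\<close>, where both tables agree. The initial state 0 is inserted because
    \<open>Q\<close> covers only the targets of transitions.\<close>
  have key: "reaches M' (q, \<tau>s) n (q', \<tau>s') \<and> q' \<in> insert 0 Q \<and> (\<forall>\<tau>\<in>set \<tau>s'. range \<tau> \<subseteq> G') \<and> length \<tau>s' = W"
    if "reaches M (q, \<tau>s) n (q', \<tau>s')" "q \<in> insert 0 Q" "\<forall>\<tau>\<in>set \<tau>s. range \<tau> \<subseteq> G'" "length \<tau>s = W"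
    for q \<tau>s n q' \<tau>s'
    using that
  proof (induction "(q, \<tau>s)" n "(q', \<tau>s')" arbitrary: q \<tau>s rule: reaches.induct)
    case reaches_refl
    then show ?case by (auto intro: reaches.reaches_refl)
  next
    case (reaches_step q \<tau>s q1 as n)
    have sub: "fst ` set as \<subseteq> G'" using table_withinD[OF 1(4) reaches_step(1)] sc[OF reaches_step(5)] G'_def by blast
    have "\<forall>\<tau>\<in>set (map2 act as \<tau>s). range \<tau> \<subseteq> G'"
    proof
      fix \<tau> assume "\<tau> \<in> set (map2 act as \<tau>s)"
      then obtain a \<tau>0 where a: "(a, \<tau>0) \<in> set (zip as \<tau>s)" "\<tau> = act a \<tau>0"
        by (auto simp only: set_map)
      then have "fst a \<in> G'" "range \<tau>0 \<subseteq> G'"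
        using sub reaches_step(5) set_zip_leftD[OF a(1)] set_zip_rightD[OF a(1)] by blast+
      then show "range \<tau> \<subseteq> G'" using a(2) by (cases a) auto
    qed
    moreover have "length (map2 act as \<tau>s) = W" using table_withinD[OF 1(4) reaches_step(1)] reaches_step(6) by simp
    ultimately have "reaches M' (q1, map2 act as \<tau>s) n (q', \<tau>s')
        \<and> q' \<in> insert 0 Q \<and> (\<forall>\<tau>\<in>set \<tau>s'. range \<tau> \<subseteq> G') \<and> length \<tau>s' = W"
      using reaches_step(3) table_withinD[OF 1(4) reaches_step(1)] by blast
    moreover have "delta M' (q, scanned \<tau>s) = Some (q1, as)"
      using eq[OF reaches_step(4-6)] reaches_step(1) by simp
    ultimately show ?case by (blast intro: reaches.reaches_step)
  qed
  have "stops M' \<tau>s T \<tau>s'" if st: "stops M \<tau>s T \<tau>s'" "length \<tau>s = W"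
    "\<And>\<tau>. \<tau> \<in> set \<tau>s \<Longrightarrow> range \<tau> \<subseteq> bits_and_blank" for \<tau>s T \<tau>s'
  proof -
    have "\<forall>\<tau>\<in>set \<tau>s. range \<tau> \<subseteq> G'" using that(3) G'_def by blast
    moreover obtain n q where n: "n \<le> T" "reaches M (0, \<tau>s) n (q, \<tau>s')" "delta M (q, scanned \<tau>s') = None"
      using st by (auto simp: stops_def)
    ultimately have k: "reaches M' (0, \<tau>s) n (q, \<tau>s')" "q \<in> insert 0 Q" "\<forall>\<tau>\<in>set \<tau>s'. range \<tau> \<subseteq> G'" "length \<tau>s' = W"
      using key[OF n(2) _ _ that(2)] by auto
    have "delta M' (q, scanned \<tau>s') = None" using eq[OF k(2-4)] n(3) by simp
    then show ?thesis unfolding stops_def using n(1) k(1) by blast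
  qed
  with wf t show thesis by (rule that)
qed

section \<open>Tapes as stacks\<close>

declare scanned_nth [simp del]

lemma scanned_tv_nth [simp]: "i < W \<Longrightarrow> scanned (tv W t) ! i = t i 0"
  by (simp add: scanned_nth)

lemma stops_cong:
  "stops M \<tau>s T \<tau>s' \<Longrightarrow> \<tau>s = \<sigma>s \<Longrightarrow> T \<le> T' \<Longrightarrow> \<tau>s' = \<sigma>s' \<Longrightarrow> stops M \<sigma>s T' \<sigma>s'"
  by (blast intro: stops_mono)

lemma poly_mono_nat: "x \<le> y \<Longrightarrow> poly p x \<le> poly p y" for p :: "nat poly"
  by (induction p) (auto intro!: add_mono mult_mono)

type_synonym stacks = "nat \<Rightarrow> bool list"

definition tp :: "nat \<Rightarrow> stacks \<Rightarrow> tape list" where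
  "tp W s = tv W (\<lambda>i. input_tape (s i))"

definition vol :: "nat \<Rightarrow> stacks \<Rightarrow> nat" where
  "vol W s = (\<Sum>i<W. length (s i))"

lemma length_tp [simp]: "length (tp W s) = W"
  by (simp add: tp_def)

lemma tp_cong: "(\<And>i. i < W \<Longrightarrow> s i = s' i) \<Longrightarrow> tp W s = tp W s'"
  unfolding tp_def by (rule tv_cong) simp

lemma length_le_vol: "i < W \<Longrightarrow> length (s i) \<le> vol W s"
  unfolding vol_def by (rule member_le_sum) auto

lemma input_tape_0: "input_tape x 0 = (case x of [] \<Rightarrow> Blank | b # _ \<Rightarrow> Bit b)"
  by (auto simp: input_tape_def split: list.split)

lemma input_tape_0_eq_Blank [simp]: "input_tape x 0 = Blank \<longleftrightarrow> x = []"
  by (simp add: input_tape_0 split: list.split)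

lemma scanned_tp_nth [simp]: "i < W \<Longrightarrow> scanned (tp W s) ! i = input_tape (s i) 0"
  by (simp add: tp_def)

definition push :: "symbol \<Rightarrow> tape \<Rightarrow> tape" where
  "push c \<tau> = (\<lambda>k. \<tau> (k - 1))(0 := c)"

lemma push_input_tape [simp]: "push (Bit b) (input_tape x) = input_tape (b # x)"
  by (rule ext) (auto simp: push_def input_tape_def nth_Cons' nat_diff_distrib)

lemma act_Blank_Right_input_tape: "act (Blank, Right) (input_tape x) = input_tape (tl x)"
  by (rule ext) (cases x; auto simp: input_tape_def nth_Cons' nat_add_distrib)

lemma act_Stay [simp]: "act (\<tau> 0, Stay) \<tau> = \<tau>"
  by simp

text \<open>First the heads on \<open>js\<close> step left to the free cell before their strings;
  then the symbol under head \<open>i\<close> is written there and erased from tape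
  \<open>i\<close>. The parameter \<open>x\<close> is what the remaining tapes do in the second
  step, which makes tape \<open>i\<close> a loop counter for them.\<close>

definition mv :: "nat \<Rightarrow> nat \<Rightarrow> nat set \<Rightarrow> (nat \<Rightarrow> symbol \<Rightarrow> symbol \<times> direction) \<Rightarrow> tm" where
  "mv W i js x = seq
     (opm W (\<lambda>ss j. if j \<in> js then (ss ! j, Left) else (ss ! j, Stay)))
     (opm W (\<lambda>ss j. if j \<in> js then (ss ! i, Stay) else if j = i then (Blank, Right) else x j (ss ! j)))"

lemma good_mv:
  assumes "i < W" "\<And>j c. fst (x j c) \<in> {c, Blank}"
  shows "good W (mv W i js x)"
  unfolding mv_def using assms(1)
  by (intro good_seq good_opm) (auto split: if_splits, metis assms(2) empty_iff insert_iff nth_mem)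

lemma stops_mv:
  assumes "i < W" "i \<notin> js" "\<And>j c. fst (x j c) \<in> {c, Blank}"
  shows "stops (mv W i js x) (tv W t) 3
     (tv W (\<lambda>j. if j \<in> js then push (t i 0) (t j) else if j = i then act (Blank, Right) (t i)
        else act (x j (t j 0)) (t j)))"
proof -
  let ?t1 = "\<lambda>j. if j \<in> js then act (t j 0, Left) (t j) else t j"
  let ?t2 = "\<lambda>j. if j \<in> js then push (t i 0) (t j) else if j = i then act (Blank, Right) (t i)
        else act (x j (t j 0)) (t j)"
  let ?o1 = "opm W (\<lambda>ss j. if j \<in> js then (ss ! j, Left) else (ss ! j, Stay))"
  let ?o2 = "opm W (\<lambda>ss j. if j \<in> js then (ss ! i, Stay) else if j = i then (Blank, Right) else x j (ss ! j))"
  have g1: "good W ?o1" by (rule good_opm) auto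
  have g2: "good W ?o2" using assms
    by (intro good_opm) (auto split: if_splits, metis assms(3) empty_iff insert_iff nth_mem)
  have "stops ?o1 (tv W t) 1 (tv W ?t1)"
    using stops_opm[of W "\<lambda>ss j. if j \<in> js then (ss ! j, Left) else (ss ! j, Stay)" t]
    by (elim stops_cong) (auto intro!: tv_cong simp del: act.simps)
  moreover have "stops ?o2 (tv W ?t1) 1 (tv W ?t2)"
  proof -
    have "act (t i 0, Stay) (act (t j 0, Left) (t j)) = push (t i 0) (t j)" for j
      by (rule ext) (auto simp: push_def)
    then have "tv W (\<lambda>j. act (if j \<in> js then (scanned (tv W ?t1) ! i, Stay) else if j = i then (Blank, Right)
          else x j (scanned (tv W ?t1) ! j)) (?t1 j)) = tv W ?t2"
      using assms(1,2) by (intro tv_cong) (simp del: act.simps)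
    then show ?thesis
      using stops_opm[of W "\<lambda>ss j. if j \<in> js then (ss ! i, Stay) else if j = i then (Blank, Right)
        else x j (ss ! j)" ?t1] by simp
  qed
  ultimately have "stops (mv W i js x) (tv W t) (1 + 1 + 1) (tv W ?t2)"
    unfolding mv_def by (intro stops_seq[OF g1 g2]) auto
  then show ?thesis by (simp add: numeral_3_eq_3)
qed

section \<open>Polynomial-time transformations of stacks\<close>

text \<open>\<open>P\<close> is a precondition such as blank scratch tapes. Time is measured against
  the content of all \<open>W\<close> tapes together.\<close>

definition ptr :: "nat \<Rightarrow> (stacks \<Rightarrow> bool) \<Rightarrow> (stacks \<Rightarrow> stacks) \<Rightarrow> bool" where
  "ptr W P F \<longleftrightarrow> (\<exists>M (T :: nat poly). good W M \<and>
     (\<forall>s. P s \<longrightarrow> stops M (tp W s) (poly T (vol W s)) (tp W (F s))))"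

lemma ptrI:
  "good W M \<Longrightarrow> (\<And>s. P s \<Longrightarrow> stops M (tp W s) (poly T (vol W s)) (tp W (F s))) \<Longrightarrow> ptr W P F"
  unfolding ptr_def by blast

lemma ptrE:
  assumes "ptr W P F"
  obtains M T where "good W M" "\<And>s. P s \<Longrightarrow> stops M (tp W s) (poly T (vol W s)) (tp W (F s))"
  using assms unfolding ptr_def by blast

text \<open>The nonblank region grows by at most one cell per step, so a time bound also bounds the
  output. This is why composition stays polynomial.\<close>

lemma vol_stops:
  assumes "stops M (tp W s) n (tp W s')" "good W M"
  shows "vol W s' \<le> W * (vol W s + n + 1)"
proof -
  have "\<forall>\<tau>\<in>set (tp W s). confined (vol W s) \<tau>"
    using confined_mono[OF confined_input_tape length_le_vol] by (auto simp: tp_def tv_def)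
  moreover obtain m q where "m \<le> n" "reaches M (0, tp W s) m (q, tp W s')"
    using assms(1) by (auto simp: stops_def)
  ultimately have "\<forall>\<tau>\<in>set (tp W s'). confined (vol W s + m) \<tau>"
    using confined_reaches[OF _ assms(2), of "(0, tp W s)" m "(q, tp W s')"] by simp
  then have "length (s' i) \<le> vol W s + n + 1" if "i < W" for i
    using that \<open>m \<le> n\<close> confined_input_tapeD[of "vol W s + m" "s' i"]
    by (auto simp: tp_def tv_def)
  then have "vol W s' \<le> of_nat (card {..<W}) * (vol W s + n + 1)"
    unfolding vol_def by (intro sum_bounded_above) (auto simp: vol_def)
  then show ?thesis by simp
qed

lemma ptr_pre: "ptr W P F \<Longrightarrow> (\<And>s. P' s \<Longrightarrow> P s) \<Longrightarrow> ptr W P' F"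
  unfolding ptr_def by blast

lemma ptr_cong:
  assumes "ptr W P F" "\<And>s i. P s \<Longrightarrow> i < W \<Longrightarrow> F s i = F' s i"
  shows "ptr W P F'"
proof -
  obtain M T where "good W M" "\<And>s. P s \<Longrightarrow> stops M (tp W s) (poly T (vol W s)) (tp W (F s))"
    using assms(1) by (rule ptrE) blast
  then show ?thesis using tp_cong[of W "F s" "F' s" for s] assms(2) by (intro ptrI) auto
qed

lemma ptr_id: "ptr W P (\<lambda>s. s)"
proof (rule ptrI)
  show "good W (TM W (\<lambda>_. None))" by (rule goodI[of _ _ "{}" "{}"]) auto
  show "stops (TM W (\<lambda>_. None)) (tp W s) (poly 0 (vol W s)) (tp W s)" for s
    unfolding stops_def by (auto intro: reaches_refl)
qed

lemma ptr_bound: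
  assumes "good W M" and "\<And>s. P s \<Longrightarrow> stops M (tp W s) (f s) (tp W (F s))"
    and "\<And>s. P s \<Longrightarrow> f s \<le> poly T (vol W s)"
  shows "ptr W P F"
  using assms(1) by (rule ptrI[where T = T]) (blast intro: stops_mono assms(2,3))

lemma ptr_seq:
  assumes "ptr W P F" "ptr W P' G" "\<And>s. P s \<Longrightarrow> P' (F s)"
  shows "ptr W P (\<lambda>s. G (F s))"
proof -
  obtain M1 T1 where 1: "good W M1" "\<And>s. P s \<Longrightarrow> stops M1 (tp W s) (poly T1 (vol W s)) (tp W (F s))"
    using assms(1) by (rule ptrE) blast
  obtain M2 T2 where 2: "good W M2" "\<And>s. P' s \<Longrightarrow> stops M2 (tp W s) (poly T2 (vol W s)) (tp W (G s))"
    using assms(2) by (rule ptrE) blast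
  define S where "S = smult W ([:0, 1:] + T1 + 1)"
  show ?thesis
  proof (rule ptr_bound)
    show "good W (seq M1 M2)" by (rule good_seq) fact+
    fix s assume s: "P s"
    show "stops (seq M1 M2) (tp W s) (poly T1 (vol W s) + poly T2 (vol W (F s)) + 1) (tp W (G (F s)))"
      by (rule stops_seq[OF 1(1) 2(1) _ 1(2)[OF s] 2(2)[OF assms(3)[OF s]]]) simp
    have "vol W (F s) \<le> poly S (vol W s)"
      using vol_stops[OF 1(2)[OF s] 1(1)] by (simp add: S_def)
    then have "poly T2 (vol W (F s)) \<le> poly T2 (poly S (vol W s))" by (rule poly_mono_nat)
    then show "poly T1 (vol W s) + poly T2 (vol W (F s)) + 1 \<le> poly (T1 + pcompose T2 S + 1) (vol W s)"
      by (simp add: poly_pcompose)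
  qed
qed

lemma ptr_branch:
  assumes "ptr W (\<lambda>s. P s \<and> C s) F" "ptr W (\<lambda>s. P s \<and> \<not> C s) G"
    and "\<And>s. P s \<Longrightarrow> c (scanned (tp W s)) = C s"
  shows "ptr W P (\<lambda>s. if C s then F s else G s)"
proof -
  obtain M1 T1 where 1: "good W M1"
    "\<And>s. P s \<and> C s \<Longrightarrow> stops M1 (tp W s) (poly T1 (vol W s)) (tp W (F s))"
    using assms(1) by (rule ptrE) blast
  obtain M2 T2 where 2: "good W M2"
    "\<And>s. P s \<and> \<not> C s \<Longrightarrow> stops M2 (tp W s) (poly T2 (vol W s)) (tp W (G s))"
    using assms(2) by (rule ptrE) blast
  show ?thesis
  proof (rule ptr_bound)
    show "good W (branch c M1 M2)" by (rule good_branch) fact+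
    fix s assume s: "P s"
    show "stops (branch c M1 M2) (tp W s) (poly T1 (vol W s) + poly T2 (vol W s) + 1)
        (tp W (if C s then F s else G s))"
      by (rule stops_branch[OF 1(1) 2(1)]) (use s assms(3)[OF s] in \<open>auto intro: stops_mono[OF 1(2)] stops_mono[OF 2(2)]\<close>)
    show "poly T1 (vol W s) + poly T2 (vol W s) + 1 \<le> poly (T1 + T2 + 1) (vol W s)" by simp
  qed
qed

text \<open>The potential \<open>V\<close> keeps all intermediate states polynomially bounded.\<close>

lemma ptr_loop:
  assumes i: "i < W"
    and body: "ptr W (\<lambda>s. P s \<and> s i \<noteq> []) F"
    and inv: "\<And>s. P s \<Longrightarrow> s i \<noteq> [] \<Longrightarrow> P (F s) \<and> length (F s i) < length (s i) \<and> V (F s) \<le> V s"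
    and V: "\<And>s. P s \<Longrightarrow> vol W s \<le> V s" "\<And>s. P s \<Longrightarrow> V s \<le> poly B (vol W s)"
    and R: "\<And>s. P s \<Longrightarrow> s i = [] \<Longrightarrow> R s = s" "\<And>s. P s \<Longrightarrow> s i \<noteq> [] \<Longrightarrow> R s = R (F s)"
  shows "ptr W P R"
proof -
  obtain M T where 1: "good W M"
    "\<And>s. P s \<and> s i \<noteq> [] \<Longrightarrow> stops M (tp W s) (poly T (vol W s)) (tp W (F s))"
    using body by (rule ptrE) blast
  let ?c = "\<lambda>ss. ss ! i \<noteq> Blank"
  have main: "stops (loop ?c M) (tp W s) (length (s i) * (poly T (V s) + 2)) (tp W (R s))" if "P s" for s
    using that
  proof (induction "length (s i)" arbitrary: s rule: less_induct)
    case less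
    show ?case
    proof (cases "s i = []")
      case True
      then show ?thesis using R(1)[OF less(2) True] i by (simp add: stops_loop_exit)
    next
      case False
      note f = inv[OF less(2) False]
      have a: "stops M (tp W s) (poly T (V s)) (tp W (F s))"
        using 1(2) less(2) False V(1) by (blast intro: stops_mono poly_mono_nat)
      have b: "stops (loop ?c M) (tp W (F s)) (length (F s i) * (poly T (V (F s)) + 2)) (tp W (R (F s)))"
        using less(1) f by blast
      have "length (F s i) * (poly T (V (F s)) + 2) \<le> (length (s i) - 1) * (poly T (V s) + 2)"
        using f poly_mono_nat[of "V (F s)" "V s" T] by (intro mult_mono) auto
      then have "poly T (V s) + length (F s i) * (poly T (V (F s)) + 2) + 2
          \<le> (length (s i) - 1) * (poly T (V s) + 2) + (poly T (V s) + 2)" by simp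
      also have "\<dots> = length (s i) * (poly T (V s) + 2)"
        using False by (cases "s i") auto
      finally show ?thesis
        using stops_mono[OF stops_loop_step[OF 1(1) _ _ a b]] False i R(2)[OF less(2) False] by simp
    qed
  qed
  show ?thesis
  proof (rule ptr_bound)
    show "good W (loop ?c M)" by (rule good_loop) fact
    fix s assume s: "P s"
    show "stops (loop ?c M) (tp W s) (length (s i) * (poly T (V s) + 2)) (tp W (R s))" by (rule main) fact
    have "poly T (V s) \<le> poly T (poly B (vol W s))" using V(2)[OF s] by (rule poly_mono_nat)
    moreover have "length (s i) \<le> vol W s" using i by (rule length_le_vol)
    ultimately have "length (s i) * (poly T (V s) + 2) \<le> vol W s * (poly T (poly B (vol W s)) + 2)"
      by (intro mult_mono) auto
    then show "length (s i) * (poly T (V s) + 2) \<le> poly ([:0,1:] * (pcompose T B + [:2:])) (vol W s)"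
      by (simp add: poly_pcompose)
  qed
qed

lemma ptr_push: "i < W \<Longrightarrow> ptr W P (\<lambda>s. s(i := b # s i))"
proof -
  assume i: "i < W"
  let ?a1 = "\<lambda>ss j. if j = i then (ss ! j, Left) else (ss ! j, Stay)"
  let ?a2 = "\<lambda>ss j. if j = i then (Bit b, Stay) else (ss ! j, Stay)"
  have g: "good W (opm W ?a1)" "good W (opm W ?a2)" by (intro good_opm; auto)+
  show ?thesis
  proof (rule ptr_bound[where T = "[:3:]"])
    show "good W (seq (opm W ?a1) (opm W ?a2))" by (rule good_seq) fact+
    fix s :: stacks
    let ?t = "\<lambda>j. input_tape (s j)"
    let ?t1 = "\<lambda>j. if j = i then act (?t j 0, Left) (?t j) else ?t j"
    have "stops (opm W ?a1) (tp W s) 1 (tv W ?t1)"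
      using stops_opm[of W ?a1 ?t] unfolding tp_def
      by (elim stops_cong) (auto intro!: tv_cong simp del: act.simps)
    moreover have "act (Bit b, Stay) (act (?t i 0, Left) (?t i)) = input_tape (b # s i)"
      unfolding push_input_tape[symmetric] by (rule ext) (auto simp: push_def)
    then have "stops (opm W ?a2) (tv W ?t1) 1 (tp W (s(i := b # s i)))"
      using stops_opm[of W ?a2 ?t1] unfolding tp_def
      by (elim stops_cong) (auto intro!: tv_cong simp del: act.simps)
    ultimately show "stops (seq (opm W ?a1) (opm W ?a2)) (tp W s) (1 + 1 + 1) (tp W (s(i := b # s i)))"
      by (intro stops_seq[OF g]) auto
  qed simp
qed

lemma ptr_mv:
  assumes "i < W" "i \<notin> js"
  shows "ptr W (\<lambda>s. P s \<and> s i \<noteq> [])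
    (\<lambda>s j. if j \<in> js then hd (s i) # s j else if j = i then tl (s i) else s j)"
proof (rule ptrI[where M = "mv W i js (\<lambda>j c. (c, Stay))" and T = "[:3:]"])
  show "good W (mv W i js (\<lambda>j c. (c, Stay)))" using assms by (intro good_mv) auto
  fix s assume s: "P s \<and> s i \<noteq> []"
  then have "input_tape (s i) 0 = Bit (hd (s i))" by (cases "s i") (auto simp: input_tape_0)
  then show "stops (mv W i js (\<lambda>j c. (c, Stay))) (tp W s) (poly [:3:] (vol W s))
       (tp W (\<lambda>j. if j \<in> js then hd (s i) # s j else if j = i then tl (s i) else s j))"
    unfolding tp_def
    by (intro stops_cong[OF stops_mv[OF assms, where x = "\<lambda>j c. (c, Stay)"]]) (auto intro!: tv_cong simp: act_Blank_Right_input_tape simp del: act.simps)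
qed

lemma ptr_revmove:
  assumes "i < W" "i \<notin> js"
  shows "ptr W P (\<lambda>s j. if j \<in> js then rev (s i) @ s j else if j = i then [] else s j)"
proof (rule ptr_pre[where P = "\<lambda>_. True"], rule ptr_loop[where i = i])
  let ?F = "\<lambda>s j. if j \<in> js then hd (s i) # s j else if j = i then tl (s i) else s j"
  show "ptr W (\<lambda>s. True \<and> s i \<noteq> []) ?F" using assms by (rule ptr_mv)
  \<comment> \<open>One round adds at most one bit to each of the \<open>W\<close> tapes while tape
    \<open>i\<close> loses one; the second summand pays for this.\<close>
  let ?V = "\<lambda>s. vol W s + W * length (s i)"
  fix s :: stacks
  show "?V s \<le> poly [:0, Suc W:] (vol W s)" using length_le_vol[OF assms(1), of s] by simp
  show "(\<lambda>j. if j \<in> js then rev (s i) @ s j else if j = i then [] else s j) = s" if "s i = []"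
    using that by auto
  assume ne: "s i \<noteq> []"
  then show "(\<lambda>j. if j \<in> js then rev (s i) @ s j else if j = i then [] else s j)
     = (\<lambda>j. if j \<in> js then rev (?F s i) @ ?F s j else if j = i then [] else ?F s j)"
    using assms by (cases "s i") auto
  have "vol W (?F s) \<le> (\<Sum>j<W. length (s j) + 1)"
    unfolding vol_def by (rule sum_mono) auto
  also have "\<dots> = vol W s + W" by (simp add: sum_Suc vol_def)
  finally have "vol W (?F s) \<le> vol W s + W" .
  moreover have "length (?F s i) = length (s i) - 1" using assms by simp
  moreover have "W * (length (s i) - 1) + W = W * length (s i)" using ne by (cases "s i") auto
  ultimately show "True \<and> length (?F s i) < length (s i) \<and> ?V (?F s) \<le> ?V s" using ne by simp
qed (use assms in auto)

lemma ptr_clear: "i < W \<Longrightarrow> ptr W P (\<lambda>s. s(i := []))"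
  by (rule ptr_cong[OF ptr_revmove[of i W "{}"]]) auto

text \<open>Each pass reverses the string, so two passes via the scratch tape \<open>t\<close>
  restore its order. In \<open>ptr_copy\<close> the second pass writes to both tapes.\<close>

lemma ptr_move:
  assumes "i < W" "j < W" "t < W" "i \<noteq> j" "i \<noteq> t" "j \<noteq> t" "\<And>s. P s \<Longrightarrow> s t = []"
  shows "ptr W P (\<lambda>s. s(i := [], j := s i @ s j))"
proof -
  have "ptr W P (\<lambda>s. (\<lambda>u j'. if j' \<in> {j} then rev (u t) @ u j' else if j' = t then [] else u j')
      ((\<lambda>s j'. if j' \<in> {t} then rev (s i) @ s j' else if j' = i then [] else s j') s))"
    using assms by (intro ptr_seq[OF ptr_revmove ptr_revmove, of _ _ _ _ _ _ "\<lambda>_. True"]) auto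
  then show ?thesis by (rule ptr_cong) (use assms(1-6) in \<open>auto simp: assms(7)\<close>)
qed

lemma ptr_copy:
  assumes "i < W" "j < W" "t < W" "i \<noteq> j" "i \<noteq> t" "j \<noteq> t" "\<And>s. P s \<Longrightarrow> s t = []"
  shows "ptr W P (\<lambda>s. s(j := s i @ s j))"
proof -
  have "ptr W P (\<lambda>s. (\<lambda>u j'. if j' \<in> {i, j} then rev (u t) @ u j' else if j' = t then [] else u j')
      ((\<lambda>s j'. if j' \<in> {t} then rev (s i) @ s j' else if j' = i then [] else s j') s))"
    using assms by (intro ptr_seq[OF ptr_revmove ptr_revmove, of _ _ _ _ _ _ "\<lambda>_. True"]) auto
  then show ?thesis by (rule ptr_cong) (use assms(1-6) in \<open>auto simp: assms(7)\<close>)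
qed

lemma ptr_lift:
  assumes "ptr k P F" "inj_on ix {..<k}" "\<And>i. i < k \<Longrightarrow> ix i < W"
  shows "ptr W (\<lambda>s. P (\<lambda>i. if i < k then s (ix i) else []))
    (\<lambda>s j. if j \<in> ix ` {..<k} then F (\<lambda>i. if i < k then s (ix i) else []) (inv_into {..<k} ix j) else s j)"
proof -
  obtain M T where 1: "good k M" "\<And>s. P s \<Longrightarrow> stops M (tp k s) (poly T (vol k s)) (tp k (F s))"
    using assms(1) by (rule ptrE) blast
  show ?thesis
  proof (rule ptrI[where M = "lift W k ix M" and T = T])
    show "good W (lift W k ix M)" using 1(1) assms(2,3) by (rule good_lift)
    fix s :: stacks
    let ?s = "\<lambda>i. if i < k then s (ix i) else []"
    assume "P ?s"
    from 1(2)[OF this] have "stops M (tv k (\<lambda>i. input_tape (s (ix i)))) (poly T (vol k ?s))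
        (tv k (\<lambda>i. input_tape (F ?s i)))"
      by (elim stops_cong) (auto simp: tp_def intro!: tv_cong)
    then
    have "stops (lift W k ix M) (tp W s) (poly T (vol k ?s)) (tp W (\<lambda>j. if j \<in> ix ` {..<k}
        then F ?s (inv_into {..<k} ix j) else s j))"
      unfolding tp_def
      by (intro stops_cong[OF stops_lift[OF _ 1(1) assms(2,3)]]) (auto intro!: tv_cong)
    moreover have "vol k ?s = (\<Sum>j\<in>ix ` {..<k}. length (s j))"
      using assms(2) by (simp add: vol_def sum.reindex)
    then have "vol k ?s \<le> vol W s" unfolding vol_def
      using assms(3) by (auto intro!: sum_mono2)
    ultimately show "stops (lift W k ix M) (tp W s) (poly T (vol W s)) (tp W (\<lambda>j. if j \<in> ix ` {..<k}
        then F ?s (inv_into {..<k} ix j) else s j))"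
      by (blast intro: stops_mono poly_mono_nat)
  qed
qed

section \<open>Polynomial-time functions of several strings\<close>

text \<open>The \<open>k\<close> arguments of \<open>g\<close> are \<open>e 0, \<dots>, e (k - 1)\<close>; its values at \<open>e\<close> with \<open>e i \<noteq> []\<close> for some \<open>i \<ge> k\<close>
  are irrelevant. Since the arguments are kept and the scratch tapes are left blank, such machines can be
  composed on shared tapes.\<close>

definition fp :: "nat \<Rightarrow> (stacks \<Rightarrow> bool list) \<Rightarrow> bool" where
  "fp k g \<longleftrightarrow> (\<exists>W>k. ptr W (\<lambda>s. \<forall>i\<ge>k. s i = []) (\<lambda>s. s(k := g s)))"

text \<open>Arguments and result may sit on arbitrary tapes below \<open>b\<close>, while scratch
  space lies above. The claim covers all large \<open>W\<close>, so that several functions can share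
  one number of tapes.\<close>

lemma fp_at:
  assumes "fp k g" "inj_on p {..<k}" "\<And>i. i < k \<Longrightarrow> p i < b" "\<And>i. i < k \<Longrightarrow> p i \<noteq> q" "q < b"
  shows "\<exists>W0. \<forall>W\<ge>W0.
    ptr W (\<lambda>s. s q = [] \<and> (\<forall>i\<ge>b. s i = [])) (\<lambda>s. s(q := g (\<lambda>i. if i < k then s (p i) else [])))"
proof -
  obtain W1 where W1: "W1 > k" "ptr W1 (\<lambda>s. \<forall>i\<ge>k. s i = []) (\<lambda>s. s(k := g s))"
    using assms(1) by (auto simp: fp_def)
  define ix where "ix = (\<lambda>i. if i < k then p i else if i = k then q else b + i)"
  have inj: "inj_on ix {..<W1}"
  proof (rule inj_onI)
    fix i j assume "ix i = ix j"
    then show "i = j"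
      using assms(3)[of i] assms(3)[of j] assms(4)[of i] assms(4)[of j] assms(5) inj_onD[OF assms(2), of i j]
      by (auto simp: ix_def split: if_splits)
  qed
  have *: "ptr W (\<lambda>s. s q = [] \<and> (\<forall>i\<ge>b. s i = [])) (\<lambda>s. s(q := g (\<lambda>i. if i < k then s (p i) else [])))"
    if W: "W \<ge> b + W1" for W
  proof -
    have lt: "ix i < W" if "i < W1" for i
      using that W assms(3)[of i] assms(5) by (auto simp: ix_def)
    let ?s = "\<lambda>s i. if i < W1 then s (ix i) else []"
    have "ptr W (\<lambda>s. s q = [] \<and> (\<forall>i\<ge>b. s i = [])) (\<lambda>s j. if j \<in> ix ` {..<W1}
       then ((?s s)(k := g (?s s))) (inv_into {..<W1} ix j) else s j)"
      by (rule ptr_pre[OF ptr_lift[OF W1(2) inj lt]]) (auto simp: ix_def)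
    then show ?thesis
    proof (rule ptr_cong)
      fix s :: stacks and j
      assume s: "s q = [] \<and> (\<forall>i\<ge>b. s i = [])"
      have eq: "?s s = (\<lambda>i. if i < k then s (p i) else [])"
        using s W1(1) by (auto simp: ix_def fun_eq_iff)
      show "(if j \<in> ix ` {..<W1} then ((?s s)(k := g (?s s))) (inv_into {..<W1} ix j) else s j)
          = (s(q := g (\<lambda>i. if i < k then s (p i) else []))) j"
      proof (cases "j \<in> ix ` {..<W1}")
        case True
        then obtain i where i: "i < W1" "j = ix i" by auto
        have inv: "inv_into {..<W1} ix j = i" using i inj by (simp add: inv_into_f_f)
        have "q = ix k" by (simp add: ix_def)
        then have "j = q \<longleftrightarrow> i = k" using inj_onD[OF inj, of i k] i W1(1) by auto
        then show ?thesis unfolding eq[symmetric] using True inv i by auto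
      next
        case False
        have "q = ix k" by (simp add: ix_def)
        then have "j \<noteq> q" using False W1(1) by auto
        then show ?thesis using False by simp
      qed
    qed
  qed
  show ?thesis by (intro exI allI impI) (rule *)
qed

lemma ptr_clears: "A \<subseteq> {..<W} \<Longrightarrow> ptr W P (\<lambda>s j. if j \<in> A then [] else s j)"
proof -
  assume A: "A \<subseteq> {..<W}"
  then have "finite A" by (rule finite_subset) simp
  then show ?thesis using A
  proof (induction A)
    case empty
    then show ?case using ptr_id by simp
  next
    case (insert a A)
    have "ptr W P (\<lambda>s. (\<lambda>s. s(a := [])) (\<lambda>j. if j \<in> A then [] else s j))"
      using insert by (intro ptr_seq[OF insert.IH ptr_clear, where P' = "\<lambda>_. True"]) auto
    then show ?case by (rule ptr_cong) auto
  qed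
qed

lemma fp_cong: "fp k g \<Longrightarrow> (\<And>e. (\<forall>i\<ge>k. e i = []) \<Longrightarrow> g e = g' e) \<Longrightarrow> fp k g'"
  unfolding fp_def by (elim exE conjE, intro exI conjI, assumption, erule ptr_cong) auto

lemma fp_nil: "fp k (\<lambda>_. [])"
  unfolding fp_def by (intro exI[of _ "Suc k"] conjI ptr_cong[OF ptr_id]) auto

lemma fp_proj: assumes "i < k" shows "fp k (\<lambda>e. e i)"
proof -
  have "ptr (k + 2) (\<lambda>s. \<forall>i\<ge>k. s i = []) (\<lambda>s. s(k := s i @ s k))"
    using assms by (intro ptr_copy[where t = "k + 1"]) auto
  then have "ptr (k + 2) (\<lambda>s. \<forall>i\<ge>k. s i = []) (\<lambda>s. s(k := s i))"
    by (rule ptr_cong) auto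
  then show ?thesis unfolding fp_def by (intro exI[of _ "k + 2"]) auto
qed

lemma fp_push: "fp 1 (\<lambda>e. b # e 0)"
proof -
  have "ptr 3 (\<lambda>s. \<forall>i\<ge>1. s i = []) (\<lambda>s. (\<lambda>s. s(1 := b # s 1)) (s(1 := s 0 @ s 1)))"
    by (rule ptr_seq[OF ptr_copy[where t = 2] ptr_push, where P' = "\<lambda>_. True"]) auto
  then have "ptr 3 (\<lambda>s. \<forall>i\<ge>1. s i = []) (\<lambda>s. s(1 := b # s 0))"
    by (rule ptr_cong) auto
  then show ?thesis unfolding fp_def by (intro exI[of _ 3]) auto
qed

text \<open>All values can be computed from the same arguments because \<open>fp\<close> leaves its
  inputs and scratch tapes as they were.\<close>

lemma fp_args:
  assumes h: "\<And>i. i < m \<Longrightarrow> fp k (h i)"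
  shows "\<exists>W0. \<forall>W\<ge>W0. ptr W (\<lambda>s. \<forall>i\<ge>k. s i = [])
    (\<lambda>s j. if k < j \<and> j \<le> k + m then h (j - Suc k) s else s j)"
proof -
  let ?P = "\<lambda>s :: stacks. \<forall>i\<ge>k. s i = []"
  let ?H = "\<lambda>m' s j. if k < j \<and> j \<le> k + m' then h (j - Suc k) s else s j"
  have "\<exists>W0. \<forall>W\<ge>W0. ptr W ?P (?H m')" if "m' \<le> m" for m'
    using that
  proof (induction m')
    case 0
    show ?case by (intro exI[of _ 0] allI impI ptr_cong[OF ptr_id]) auto
  next
    case (Suc m')
    then obtain W1 where W1: "\<And>W. W \<ge> W1 \<Longrightarrow> ptr W ?P (?H m')" by auto
    let ?Q = "\<lambda>s. s (Suc (k + m')) = [] \<and> (\<forall>i\<ge>k + m + 2. s i = [])"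
    have "fp k (h m')" using Suc h by simp
    from fp_at[OF this inj_on_id2[of "{..<k}"], of "k + m + 2" "Suc (k + m')"] Suc(2)
    obtain W2 where W2: "\<And>W. W \<ge> W2 \<Longrightarrow> ptr W ?Q (\<lambda>s. s(Suc (k + m') := h m' (\<lambda>i. if i < k then s i else [])))"
      by auto
    have "ptr W ?P (?H (Suc m'))" if "W \<ge> max W1 W2" for W
    proof -
      have "ptr W ?P (\<lambda>s. (\<lambda>s. s(Suc (k + m') := h m' (\<lambda>i. if i < k then s i else []))) (?H m' s))"
        using that Suc(2) by (intro ptr_seq[OF W1 W2]) auto
      then show ?thesis
      proof (rule ptr_cong)
        fix s :: stacks and i
        assume "?P s"
        then have "(\<lambda>i. if i < k then ?H m' s i else []) = s" by (auto simp: fun_eq_iff)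
        then show "((?H m' s)(Suc (k + m') := h m' (\<lambda>i. if i < k then ?H m' s i else []))) i = ?H (Suc m') s i"
          by (auto simp: not_le)
      qed
    qed
    then show ?case by blast
  qed
  then show ?thesis by blast
qed

text \<open>In contrast to \<open>fp\<close>, the transformation \<open>F\<close> may destroy its
  arguments and leave debris: it runs on freshly computed arguments, its result is moved to tape
  \<open>k\<close>, and the tapes used are cleared. Clocked calls of machines enter in this
  way.\<close>

lemma fp_via:
  assumes h: "\<And>i. i < m \<Longrightarrow> fp k (h i)" and F: "ptr W P F" and "m \<le> W" and q: "q < W"
    and P: "\<And>e. \<forall>i\<ge>k. e i = [] \<Longrightarrow> P (\<lambda>i. if i < m then h i e else [])"
  shows "fp k (\<lambda>e. F (\<lambda>i. if i < m then h i e else []) q)"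
proof -
  let ?P = "\<lambda>s :: stacks. \<forall>i\<ge>k. s i = []"
  let ?H = "\<lambda>s j. if k < j \<and> j \<le> k + m then h (j - Suc k) s else s j"
  obtain W1 where W1: "\<And>W. W \<ge> W1 \<Longrightarrow> ptr W ?P ?H" using fp_args[of m k h] h by auto
  define V where "V = max W1 (k + W + 2)"
  let ?ix = "\<lambda>i. Suc (k + i)"
  let ?in = "\<lambda>s i. if i < W then s (?ix i) else []"
  have inj: "inj_on ?ix {..<W}" by (simp add: inj_on_def)
  have img: "j \<in> ?ix ` {..<W} \<longleftrightarrow> k < j \<and> j \<le> k + W" for j
  proof
    assume "k < j \<and> j \<le> k + W"
    then show "j \<in> ?ix ` {..<W}" by (intro image_eqI[of _ _ "j - Suc k"]) auto
  qed auto
  have inv: "inv_into {..<W} ?ix (?ix i) = i" if "i < W" for i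
    using inv_into_f_f[OF inj] that by auto
  let ?L = "\<lambda>s j. if j \<in> ?ix ` {..<W} then F (?in s) (inv_into {..<W} ?ix j) else s j"
  let ?m = "\<lambda>s. s(?ix q := [], k := s (?ix q) @ s k)"
  let ?c = "\<lambda>s j. if j \<in> {k<..k + W} then [] else s j"
  have in_H: "?in (?H s) = (\<lambda>i. if i < m then h i s else [])" if "?P s" for s
    using that \<open>m \<le> W\<close> by (auto simp: fun_eq_iff)
  have a: "ptr V ?P (\<lambda>s. ?L (?H s))"
    by (rule ptr_seq[OF W1 ptr_lift[OF F inj]]) (use in_H P in \<open>auto simp: V_def\<close>)
  have b: "ptr V (\<lambda>s. s (k + W + 1) = []) (\<lambda>s. ?c (?m s))"
    by (rule ptr_seq[OF ptr_move[where t = "k + W + 1"] ptr_clears, where P' = "\<lambda>_. True"])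
      (use q in \<open>auto simp: V_def\<close>)
  have "ptr V ?P (\<lambda>s. ?c (?m (?L (?H s))))"
    by (rule ptr_seq[OF a b]) (use \<open>m \<le> W\<close> in \<open>auto simp: img\<close>)
  then have "ptr V ?P (\<lambda>s. s(k := F (\<lambda>i. if i < m then h i s else []) q))"
  proof (rule ptr_cong)
    fix s :: stacks and j
    assume s: "?P s"
    have "?L (?H s) (?ix q) = F (\<lambda>i. if i < m then h i s else []) q"
      unfolding in_H[OF s] using inv[OF q] q by simp
    moreover have "?L (?H s) k = []" using s by (simp add: img)
    moreover have "?L (?H s) j = s j" if "j < k \<or> k + W < j" for j
      using that \<open>m \<le> W\<close> by (auto simp: img)
    ultimately have "?c (?m u) j = (s(k := F (\<lambda>i. if i < m then h i s else []) q)) j"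
      if "u = ?L (?H s)" for u
      using that[symmetric] q s by (cases "j < k \<or> k + W < j") (simp_all del: image_iff, auto)
    then show "?c (?m (?L (?H s))) j = (s(k := F (\<lambda>i. if i < m then h i s else []) q)) j"
      by blast
  qed
  then show ?thesis unfolding fp_def by (intro exI[of _ V]) (auto simp: V_def)
qed

lemma fp_comp:
  assumes g: "fp m g" and h: "\<And>i. i < m \<Longrightarrow> fp k (h i)"
  shows "fp k (\<lambda>e. g (\<lambda>i. if i < m then h i e else []))"
proof -
  obtain W where W: "W > m" "ptr W (\<lambda>s. \<forall>i\<ge>m. s i = []) (\<lambda>s. s(m := g s))"
    using g by (auto simp: fp_def)
  show ?thesis using fp_via[OF _ W(2), of m k h m] h W(1) by simp
qed

lemma fp_length:
  assumes "fp k g"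
  obtains T :: "nat poly" where "\<And>e. (\<forall>i\<ge>k. e i = []) \<Longrightarrow> length (g e) \<le> poly T (vol k e)"
proof -
  obtain W where W: "W > k" "ptr W (\<lambda>s. \<forall>i\<ge>k. s i = []) (\<lambda>s. s(k := g s))"
    using assms by (auto simp: fp_def)
  obtain M T where M: "good W M"
    "\<And>s. \<forall>i\<ge>k. s i = [] \<Longrightarrow> stops M (tp W s) (poly T (vol W s)) (tp W (s(k := g s)))"
    using W(2) by (rule ptrE) blast
  show thesis
  proof (rule that)
    fix e :: stacks
    assume e: "\<forall>i\<ge>k. e i = []"
    have "vol W e = vol k e"
      unfolding vol_def using W(1) e by (intro sum.mono_neutral_right) auto
    moreover have "length (g e) \<le> vol W (e(k := g e))"
      using length_le_vol[OF W(1), of "e(k := g e)"] by simp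
    moreover have "vol W (e(k := g e)) \<le> W * (vol W e + poly T (vol W e) + 1)"
      by (rule vol_stops[OF M(2)[OF e] M(1)])
    ultimately show "length (g e) \<le> poly (smult W ([:0, 1:] + T + 1)) (vol k e)" by simp
  qed
qed

text \<open>Cobham's bounded recursion on notation. Tape 0 holds the suffix treated so far, tape
  \<open>k + 1\<close> the value there, tape \<open>k + 2\<close> the remaining bits in reverse.
  Without \<open>bound\<close>, a step that doubles its value would lead to exponential
  length.\<close>

lemma fp_rec:
  assumes G: "fp k G" and BT: "fp (k + 2) BT" and BF: "fp (k + 2) BF"
    and F0: "\<And>e. F [] e = G e"
    and FT: "\<And>w e. F (True # w) e = BT (\<lambda>i. if i = 0 then w else if i = 1 then F w e else e (i - 2))"
    and FF: "\<And>w e. F (False # w) e = BF (\<lambda>i. if i = 0 then w else if i = 1 then F w e else e (i - 2))"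
    and bound: "\<And>x e. (\<forall>i\<ge>k. e i = []) \<Longrightarrow> length (F x e) \<le> poly T (length x + vol k e)"
  shows "fp (k + 1) (\<lambda>e. F (e 0) (\<lambda>i. e (i + 1)))"
proof -
  define par :: "stacks \<Rightarrow> nat \<Rightarrow> bool list" where "par = (\<lambda>s i. if i < k then s (i + 1) else [])"
  let ?B = "\<lambda>b. if b then BT else BF"
  \<comment> \<open>A step function sees the suffix on tape 0, the recursive value on tape
    \<open>k + 1\<close> and the parameters on tapes 1 to \<open>k\<close>.\<close>
  let ?p = "\<lambda>i. if i = 0 then 0 else if i = 1 then k + 1 else i - 1 :: nat"
  let ?arg = "\<lambda>s i. if i < k + 2 then s (?p i) else []"
  let ?Q = "\<lambda>q s. s q = [] \<and> (\<forall>i\<ge>k + 5. s i = [])"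
  have B: "fp (k + 2) (?B b)" for b using BT BF by simp
  have F: "F (b # w) e = ?B b (\<lambda>i. if i = 0 then w else if i = 1 then F w e else e (i - 2))" for b w e
    by (cases b) (simp_all only: FT FF if_True if_False)
  have inj: "inj_on ?p {..<k + 2}" by (rule inj_onI) (simp split: if_splits)
  have ex: "\<exists>W0. \<forall>W\<ge>W0. ptr W (?Q (k + 3)) (\<lambda>s. s(k + 3 := ?B b (?arg s)))" for b
    by (rule fp_at[OF B[of b] inj]) auto
  obtain WT where WT: "\<forall>W\<ge>WT. ptr W (?Q (k + 3)) (\<lambda>s. s(k + 3 := ?B True (?arg s)))" using ex[of True] by (rule exE)
  obtain WF where WF: "\<forall>W\<ge>WF. ptr W (?Q (k + 3)) (\<lambda>s. s(k + 3 := ?B False (?arg s)))" using ex[of False] by (rule exE)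
  define W0 where "W0 = max WT WF"
  have W0: "ptr W (?Q (k + 3)) (\<lambda>s. s(k + 3 := ?B b (?arg s)))" if "W \<ge> W0" for b W
    using WT[rule_format, of W] WF[rule_format, of W] that by (cases b) (simp_all only: W0_def max.bounded_iff)
  have "\<exists>W1. \<forall>W\<ge>W1. ptr W (?Q (k + 1)) (\<lambda>s. s(k + 1 := G (par s)))"
    unfolding par_def by (rule fp_at[OF G]) (auto intro: inj_onI)
  then obtain W1 where "\<forall>W\<ge>W1. ptr W (?Q (k + 1)) (\<lambda>s. s(k + 1 := G (par s)))" by (rule exE)
  note W1 = this[rule_format]
  define W where "W = max (max W0 W1) (k + 5)"
  have W: "W \<ge> W0" "W \<ge> W1" "W \<ge> k + 5" by (simp_all add: W_def)
  let ?E = "\<lambda>s :: stacks. \<forall>i\<ge>k + 3. s i = []"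
  let ?body = "\<lambda>b s. s(k + 2 := tl (s (k + 2)), k + 1 := ?B b (?arg s), 0 := b # s 0)"
  have body: "ptr W (\<lambda>s. ?E s \<and> s (k + 2) \<noteq> []) (?body b)" for b
  proof -
    let ?f0 = "\<lambda>s j. if j \<in> {} then hd (s (k + 2)) # s j else if j = k + 2 then tl (s (k + 2)) else s j"
    let ?f1 = "\<lambda>s. s(k + 3 := ?B b (?arg s))"
    let ?f2 = "\<lambda>s. s(k + 1 := [])"
    let ?f3 = "\<lambda>s. s(k + 3 := [], k + 1 := s (k + 3) @ s (k + 1))"
    let ?f4 = "\<lambda>s. s(0 := b # s 0)"
    have a: "ptr W (\<lambda>s. ?E s \<and> s (k + 2) \<noteq> []) (\<lambda>s. ?f1 (?f0 s))"
      by (rule ptr_seq[OF ptr_mv W0[of W b]]) (use W in auto)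
    have b: "ptr W (\<lambda>s. s (k + 4) = []) (\<lambda>s. ?f4 (?f3 (?f2 s)))"
      by (rule ptr_seq[OF ptr_seq[OF ptr_clear ptr_move[where t = "k + 4" and P = "\<lambda>s. s (k + 4) = []"]]
          ptr_push, where P' = "\<lambda>_. True"]) (use W(3) in auto)
    have "ptr W (\<lambda>s. ?E s \<and> s (k + 2) \<noteq> []) (\<lambda>s. ?f4 (?f3 (?f2 (?f1 (?f0 s)))))"
      by (rule ptr_seq[OF a b]) auto
    then show ?thesis
    proof (rule ptr_cong)
      fix s :: stacks and i
      assume s: "?E s \<and> s (k + 2) \<noteq> []"
      have "?arg (?f0 s) = ?arg s" by (auto simp: fun_eq_iff)
      then have "?f1 (?f0 s) = (?f0 s)(k + 3 := ?B b (?arg s))" by simp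
      then show "?f4 (?f3 (?f2 (?f1 (?f0 s)))) i = ?body b s i" using s by simp
    qed
  qed
  let ?P = "\<lambda>s. ?E s \<and> s (k + 1) = F (s 0) (par s)"
  let ?F = "\<lambda>s. if hd (s (k + 2)) then ?body True s else ?body False s"
  \<comment> \<open>The outcome from any intermediate state: the bits on tape \<open>k + 2\<close>
    are still to be put in front of tape 0.\<close>
  let ?R = "\<lambda>s. s(k + 2 := [], 0 := rev (s (k + 2)) @ s 0, k + 1 := F (rev (s (k + 2)) @ s 0) (par s))"
  have F': "?F s = ?body (hd (s (k + 2))) s" for s by simp
  have nxt: "?B b (?arg s) = F (b # s 0) (par s)" if "?P s" for b s
  proof -
    have "?arg s = (\<lambda>i. if i = 0 then s 0 else if i = 1 then F (s 0) (par s) else par s (i - 2))"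
    proof (rule ext)
      fix i
      consider "i = 0" | "i = 1" | j where "i = Suc (Suc j)" by (metis One_nat_def not0_implies_Suc)
      then show "?arg s i = (if i = 0 then s 0 else if i = 1 then F (s 0) (par s) else par s (i - 2))"
        by cases (use that in \<open>auto simp: par_def\<close>)
    qed
    then show ?thesis by (simp only: F)
  qed
  have par: "par (s(k + 2 := x, k + 1 := y, 0 := z)) = par s" for s x y z
    by (auto simp: par_def fun_eq_iff)
  have vol: "vol W s = length (s 0) + vol k (par s) + length (s (k + 1)) + length (s (k + 2))" if "?E s" for s
  proof -
    have "vol W s = vol (Suc (Suc (Suc k))) s"
      unfolding vol_def using W(3) that by (intro sum.mono_neutral_right) auto
    also have "\<dots> = vol (Suc k) s + length (s (k + 1)) + length (s (k + 2))" by (simp add: vol_def)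
    also have "vol (Suc k) s = length (s 0) + vol k (par s)"
      unfolding vol_def par_def by (subst sum.lessThan_Suc_shift) simp
    finally show ?thesis by simp
  qed
  \<comment> \<open>The body moves one bit from tape \<open>k + 2\<close> to tape 0, so
    \<open>?L\<close> is constant; by \<open>bound\<close> it controls the values on tape
    \<open>k + 1\<close> throughout.\<close>
  let ?L = "\<lambda>s. length (s 0) + length (s (k + 2)) + vol k (par s)"
  let ?V = "\<lambda>s. ?L s + poly T (?L s)"
  have loop: "ptr W ?P ?R"
  proof (rule ptr_loop[where i = "k + 2" and F = ?F and V = ?V and B = "[:0,1:] + T"])
    show "k + 2 < W" using W(3) by simp
    show "ptr W (\<lambda>s. ?P s \<and> s (k + 2) \<noteq> []) ?F"
    proof (rule ptr_branch[where c = "\<lambda>ss. ss ! (k + 2) = Bit True"])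
      fix s assume "?P s \<and> s (k + 2) \<noteq> []"
      then show "(scanned (tp W s) ! (k + 2) = Bit True) = hd (s (k + 2))"
        using W(3) by (cases "s (k + 2)") (auto simp: input_tape_0)
    qed (rule ptr_pre[OF body], simp)+
    fix s assume P: "?P s"
    show "?R s = s" if "s (k + 2) = []" using that P by (auto simp: fun_eq_iff)
    show "vol W s \<le> ?V s"
    proof -
      have "length (s (k + 1)) \<le> poly T (length (s 0) + vol k (par s))"
        using P bound[of "par s" "s 0"] by (simp add: par_def)
      also have "\<dots> \<le> poly T (?L s)" by (rule poly_mono_nat) simp
      finally show ?thesis using vol P by simp
    qed
    have "?L s \<le> vol W s" using vol P by simp
    then show "?V s \<le> poly ([:0,1:] + T) (vol W s)"
      using poly_mono_nat[of "?L s" "vol W s" T] by simp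
    assume ne: "s (k + 2) \<noteq> []"
    then obtain b x where x: "s (k + 2) = b # x" by (cases "s (k + 2)") auto
    have F1: "?F s = s(k + 2 := x, k + 1 := F (b # s 0) (par s), 0 := b # s 0)"
      unfolding F' using nxt[OF P, of b] x by simp
    show "?P (?F s) \<and> length (?F s (k + 2)) < length (s (k + 2)) \<and> ?V (?F s) \<le> ?V s"
      unfolding F1 par using P x by simp
    show "?R s = ?R (?F s)"
      unfolding F1 par using x by (simp add: fun_eq_iff)
  qed
  let ?I = "\<lambda>s :: stacks. \<forall>i\<ge>k + 1. s i = []"
  let ?g0 = "\<lambda>s j. if j \<in> {k + 2} then rev (s 0) @ s j else if j = 0 then [] else s j"
  let ?g1 = "\<lambda>s. s(k + 1 := G (par s))"
  have "ptr W ?I (\<lambda>s. ?R (?g1 (?g0 s)))"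
  proof (rule ptr_seq[OF ptr_seq[OF ptr_revmove W1] loop])
    fix s assume s: "?I s"
    have 1: "par (?g0 s) = par s" "par (?g1 (?g0 s)) = par s"
      by (auto simp: par_def fun_eq_iff)
    have "?g1 (?g0 s) 0 = []" "?g1 (?g0 s) (k + 1) = G (par (?g0 s))" by auto
    then show "?P (?g1 (?g0 s))" using s F0 1 by simp
  qed (use W in auto)
  then have "ptr W ?I (\<lambda>s. s(k + 1 := F (s 0) (\<lambda>i. s (i + 1))))"
  proof (rule ptr_cong)
    fix s :: stacks and i
    assume s: "?I s"
    then have "par (?g1 (?g0 s)) = (\<lambda>i. s (i + 1))" by (auto simp: par_def fun_eq_iff)
    then show "?R (?g1 (?g0 s)) i = (s(k + 1 := F (s 0) (\<lambda>i. s (i + 1)))) i"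
      using s by auto
  qed
  then show ?thesis unfolding fp_def using W(3) by (intro exI[of _ W]) auto
qed

section \<open>Basic functions of strings\<close>

lemma fp_comp1: "fp 1 (\<lambda>e. f (e 0)) \<Longrightarrow> fp k a \<Longrightarrow> fp k (\<lambda>e. f (a e))"
  using fp_comp[of 1 "\<lambda>e. f (e 0)" k "\<lambda>_. a"] by simp

lemma fp_comp2:
  assumes "fp 2 (\<lambda>e. f (e 0) (e 1))" "fp k a" "fp k b"
  shows "fp k (\<lambda>e. f (a e) (b e))"
proof -
  have "fp k (if i = 0 then a else b)" for i :: nat using assms by simp
  from fp_comp[OF assms(1), of k "\<lambda>i. if i = 0 then a else b", OF this] show ?thesis by simp
qed

lemma fp_comp3:
  assumes "fp 3 (\<lambda>e. f (e 0) (e 1) (e 2))" "fp k a" "fp k b" "fp k c"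
  shows "fp k (\<lambda>e. f (a e) (b e) (c e))"
proof -
  have "fp k (if i = 0 then a else if i = 1 then b else c)" for i :: nat using assms by simp
  from fp_comp[OF assms(1), of k "\<lambda>i. if i = 0 then a else if i = 1 then b else c", OF this]
  show ?thesis by simp
qed

lemma fp_Cons: "fp k a \<Longrightarrow> fp k (\<lambda>e. b # a e)"
  by (rule fp_comp1[OF fp_push])

lemma fp_const: "fp k (\<lambda>_. x)"
  by (induction x) (auto intro: fp_nil fp_Cons)

lemma vol_1 [simp]: "vol 1 e = length (e 0)" "vol (Suc 0) e = length (e 0)"
  by (simp_all add: vol_def)

lemma vol_2 [simp]: "vol 2 e = length (e 0) + length (e 1)"
  by (simp add: vol_def numeral_2_eq_2)

lemma fp_append: assumes "fp k a" "fp k b" shows "fp k (\<lambda>e. a e @ b e)"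
proof -
  have "fp (1 + 1) (\<lambda>e. (\<lambda>x e. x @ e 0) (e 0) (\<lambda>i. e (i + 1)))"
    by (rule fp_rec[where k = 1 and F = "\<lambda>x e. x @ e 0" and G = "\<lambda>e. e 0" and BT = "\<lambda>e. True # e 1" and BF = "\<lambda>e. False # e 1"
          and T = "[:0, 1:]"]; (intro fp_proj fp_Cons)?; simp)
  then show ?thesis by - (rule fp_comp2[where f = "(@)"], use assms in \<open>simp_all add: numeral_2_eq_2 numeral_3_eq_3 cong: if_cong\<close>)
qed

lemma fp_tl: assumes "fp k a" shows "fp k (\<lambda>e. tl (a e))"
proof -
  have "fp (0 + 1) (\<lambda>e. (\<lambda>x e. tl x) (e 0) (\<lambda>i. e (i + 1)))"
    by (rule fp_rec[where k = 0 and F = "\<lambda>x e. tl x" and G = "\<lambda>e. []" and BT = "\<lambda>e. e 0" and BF = "\<lambda>e. e 0"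
          and T = "[:0, 1:]"]; (intro fp_proj fp_nil)?; simp)
  then show ?thesis by - (rule fp_comp1[where f = tl], use assms in \<open>simp_all\<close>)
qed

definition starts_True :: "bool list \<Rightarrow> bool" where
  "starts_True x \<longleftrightarrow> x \<noteq> [] \<and> hd x"

lemma fp_if_starts_True:
  assumes "fp k x" "fp k a" "fp k b"
  shows "fp k (\<lambda>e. if starts_True (x e) then a e else b e)"
proof -
  have "fp (2 + 1) (\<lambda>e. (\<lambda>x e. if starts_True x then e 0 else e 1) (e 0) (\<lambda>i. e (i + 1)))"
    by (rule fp_rec[where k = 2 and F = "\<lambda>x e. if starts_True x then e 0 else e 1" and G = "\<lambda>e. e 1" and BT = "\<lambda>e. e 2" and BF = "\<lambda>e. e 3"
          and T = "[:0, 1:]"]; (intro fp_proj)?; simp add: starts_True_def)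
  then show ?thesis by - (rule fp_comp3[where f = "\<lambda>x a b. if starts_True x then a else b"], use assms in \<open>simp_all add: numeral_2_eq_2 numeral_3_eq_3 cong: if_cong\<close>)
qed

lemma fp_if_Nil:
  assumes "fp k x" "fp k a" "fp k b"
  shows "fp k (\<lambda>e. if x e = [] then a e else b e)"
proof -
  have "fp (2 + 1) (\<lambda>e. (\<lambda>x e. if x = [] then e 0 else e 1) (e 0) (\<lambda>i. e (i + 1)))"
    by (rule fp_rec[where k = 2 and F = "\<lambda>x e. if x = [] then e 0 else e 1" and G = "\<lambda>e. e 0" and BT = "\<lambda>e. e 3" and BF = "\<lambda>e. e 3"
          and T = "[:0, 1:]"]; (intro fp_proj)?; simp)
  then show ?thesis
    by - (rule fp_comp3[where f = "\<lambda>x a b. if x = [] then a else b"],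
        use assms in \<open>simp_all add: numeral_2_eq_2 numeral_3_eq_3 cong: if_cong\<close>)
qed

lemma fp_rev: assumes "fp k a" shows "fp k (\<lambda>e. rev (a e))"
proof -
  have "fp (0 + 1) (\<lambda>e. (\<lambda>x e. rev x) (e 0) (\<lambda>i. e (i + 1)))"
    by (rule fp_rec[where k = 0 and F = "\<lambda>x e. rev x" and G = "\<lambda>e. []" and BT = "\<lambda>e. e 1 @ [True]" and BF = "\<lambda>e. e 1 @ [False]"
          and T = "[:0, 1:]"]; (intro fp_proj fp_nil fp_append fp_const)?; simp)
  then show ?thesis by - (rule fp_comp1[where f = rev], use assms in \<open>simp_all\<close>)
qed

section \<open>Unary arithmetic and predicates\<close>

definition fpn :: "nat \<Rightarrow> (stacks \<Rightarrow> nat) \<Rightarrow> bool" where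
  "fpn k n \<longleftrightarrow> fp k (\<lambda>e. unary (n e))"

definition fpb :: "nat \<Rightarrow> (stacks \<Rightarrow> bool) \<Rightarrow> bool" where
  "fpb k P \<longleftrightarrow> fp k (\<lambda>e. if P e then [True] else [])"

lemma fp_unary: "fpn k n \<Longrightarrow> fp k (\<lambda>e. unary (n e))"
  by (simp add: fpn_def)

lemma fpn_length: assumes "fp k a" shows "fpn k (\<lambda>e. length (a e))"
proof -
  have "fp (0 + 1) (\<lambda>e. (\<lambda>x e. unary (length x)) (e 0) (\<lambda>i. e (i + 1)))"
    by (rule fp_rec[where k = 0 and F = "\<lambda>x e. unary (length x)" and G = "\<lambda>e. []" and BT = "\<lambda>e. True # e 1" and BF = "\<lambda>e. True # e 1"
          and T = "[:0, 1:]"]; (intro fp_proj fp_nil fp_Cons)?; simp)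
  then show ?thesis unfolding fpn_def
    by - (rule fp_comp1[where f = "\<lambda>x. unary (length x)"], use assms in simp_all)
qed

lemma fp_drop: assumes "fpn k n" "fp k a" shows "fp k (\<lambda>e. drop (n e) (a e))"
proof -
  have "fp (1 + 1) (\<lambda>e. (\<lambda>x e. drop (length x) (e 0)) (e 0) (\<lambda>i. e (i + 1)))"
    by (rule fp_rec[where k = 1 and F = "\<lambda>x e. drop (length x) (e 0)" and G = "\<lambda>e. e 0" and BT = "\<lambda>e. tl (e 1)" and BF = "\<lambda>e. tl (e 1)"
          and T = "[:0, 1:]"]; (intro fp_proj fp_tl)?; simp add: drop_Suc tl_drop)
  then have "fp 2 (\<lambda>e. drop (length (e 0)) (e 1))" by (simp add: numeral_2_eq_2)
  from fp_comp2[OF this assms(1)[unfolded fpn_def] assms(2)] show ?thesis by simp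
qed

lemma fp_take: assumes "fpn k n" "fp k a" shows "fp k (\<lambda>e. take (n e) (a e))"
proof -
  \<comment> \<open>Taking n bits of x is dropping |x| - n bits from the reversed string and
    reversing back.\<close>
  have "fp k (\<lambda>e. rev (drop (length (drop (n e) (a e))) (rev (a e))))"
    by (intro fp_rev fp_drop fpn_length assms)
  moreover have "rev (drop (length (drop n x)) (rev x)) = take n x" for n and x :: "bool list"
    by (cases "n \<le> length x") (simp_all add: rev_drop)
  ultimately show ?thesis by simp
qed

lemma fpn_const: "fpn k (\<lambda>_. c)"
  by (simp add: fpn_def fp_const)

lemma fpn_add: "fpn k m \<Longrightarrow> fpn k n \<Longrightarrow> fpn k (\<lambda>e. m e + n e)"
  unfolding fpn_def by (simp add: replicate_add fp_append)

lemma fpn_diff: "fpn k m \<Longrightarrow> fpn k n \<Longrightarrow> fpn k (\<lambda>e. m e - n e)"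
  using fp_drop[of k n "\<lambda>e. unary (m e)"] unfolding fpn_def by simp

lemma fpn_mult: assumes "fpn k m" "fpn k n" shows "fpn k (\<lambda>e. m e * n e)"
proof -
  have "fp (1 + 1) (\<lambda>e. (\<lambda>x e. unary (length x * length (e 0))) (e 0) (\<lambda>i. e (i + 1)))"
  proof (rule fp_rec[where k = 1 and F = "\<lambda>x e. unary (length x * length (e 0))" and G = "\<lambda>e. []" and BT = "\<lambda>e. unary (length (e 2)) @ e 1"
          and BF = "\<lambda>e. unary (length (e 2)) @ e 1" and T = "[:0, 0, 1:]"])
    fix x :: "bool list" and e :: stacks
    show "length (unary (length x * length (e 0))) \<le> poly [:0, 0, 1:] (length x + vol 1 e)"
      by (simp add: algebra_simps)
  qed (((intro fp_proj fp_nil fp_append fp_unary fpn_length)?; simp add: replicate_add)+)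
  then have "fp 2 (\<lambda>e. unary (length (e 0) * length (e 1)))" by (simp add: numeral_2_eq_2)
  from fp_comp2[OF this assms[unfolded fpn_def]] show ?thesis by (simp add: fpn_def)
qed

lemma fpn_poly: assumes "fpn k n" shows "fpn k (\<lambda>e. poly p (n e))"
proof (induction p)
  case 0
  show ?case by (simp add: fpn_const)
next
  case (pCons a p)
  then show ?case by (simp only: poly_pCons, intro fpn_add fpn_mult fpn_const assms)
qed

lemma fp_if: assumes "fpb k P" "fp k a" "fp k b" shows "fp k (\<lambda>e. if P e then a e else b e)"
  using fp_if_Nil[OF assms(1)[unfolded fpb_def] assms(3,2)]
  by (rule fp_cong) simp

lemma fpb_cong: "fpb k P \<Longrightarrow> (\<And>e. P e = Q e) \<Longrightarrow> fpb k Q"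
  by (simp add: fpb_def)

lemma fpb_not: "fpb k P \<Longrightarrow> fpb k (\<lambda>e. \<not> P e)"
  using fp_if[OF _ fp_const fp_const, of k P "[]" "[True]"] unfolding fpb_def
  by (rule fp_cong) auto

lemma fpb_and: "fpb k P \<Longrightarrow> fpb k Q \<Longrightarrow> fpb k (\<lambda>e. P e \<and> Q e)"
  using fp_if[OF _ _ fp_const, of k P "\<lambda>e. if Q e then [True] else []" "[]"]
  unfolding fpb_def by (rule fp_cong) auto

lemma fpb_iff: "fpb k P \<Longrightarrow> fpb k Q \<Longrightarrow> fpb k (\<lambda>e. P e = Q e)"
  by (rule fp_cong[OF fp_if[of k P "\<lambda>e. if Q e then [True] else []" "\<lambda>e. if \<not> Q e then [True] else []"],
        of "\<lambda>e. if P e = Q e then [True] else []", folded fpb_def]) (auto intro: fpb_not)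

lemma fpb_Nil: "fp k x \<Longrightarrow> fpb k (\<lambda>e. x e = [])"
  unfolding fpb_def by (intro fp_if_Nil fp_const)

lemma fpb_starts_True: "fp k x \<Longrightarrow> fpb k (\<lambda>e. starts_True (x e))"
  unfolding fpb_def by (intro fp_if_starts_True fp_const)

lemma fpb_le: "fpn k m \<Longrightarrow> fpn k n \<Longrightarrow> fpb k (\<lambda>e. m e \<le> n e)"
  by (rule fpb_cong[OF fpb_Nil[OF fp_unary[OF fpn_diff[of k m n]]]]) auto

lemma fpb_eq_nat: "fpn k m \<Longrightarrow> fpn k n \<Longrightarrow> fpb k (\<lambda>e. m e = n e)"
  by (rule fpb_cong[OF fpb_and[OF fpb_le[of k m n] fpb_le[of k n m]]]) auto

section \<open>Iteration with a counter\<close>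

primrec iter :: "(nat \<Rightarrow> 'a \<Rightarrow> 'a) \<Rightarrow> 'a \<Rightarrow> nat \<Rightarrow> 'a" where
  "iter g z 0 = z"
| "iter g z (Suc n) = g n (iter g z n)"

text \<open>This is recursion on the unary form of \<open>n e\<close>: the suffix treated so far is
  the current value of the counter.\<close>

lemma fp_iter:
  assumes h: "fp (k + 2) h" and z: "fp k z" and n: "fpn k n"
    and bound: "\<And>e m. (\<forall>i\<ge>k. e i = []) \<Longrightarrow>
      length (iter (\<lambda>i a. h (e(k := unary i, Suc k := a))) (z e) m) \<le> poly T (m + vol k e)"
  shows "fp k (\<lambda>e. iter (\<lambda>i a. h (e(k := unary i, Suc k := a))) (z e) (n e))"
proof -
  \<comment> \<open>On arguments with blank tail \<open>env i a e\<close> is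
    \<open>e(k := unary i, Suc k := a)\<close>. For every other \<open>e\<close> it is still blank
    from \<open>k + 2\<close> on, as the arguments supplied by \<open>fp_comp\<close> are.\<close>
  define env :: "nat \<Rightarrow> bool list \<Rightarrow> stacks \<Rightarrow> nat \<Rightarrow> bool list" where
    "env = (\<lambda>i a e j. if j < k then e j else if j = k then unary i else if j = Suc k then a else [])"
  have env: "env i a e = e(k := unary i, Suc k := a)" if "\<forall>i\<ge>k. e i = []" for i a e
    using that by (auto simp: env_def fun_eq_iff)
  define F where "F = (\<lambda>(x :: bool list) e. iter (\<lambda>i a. h (env i a e)) (z e) (length x))"
  define B where "B = (\<lambda>e. h (env (length (e 0)) (e 1) (\<lambda>i. e (i + 2))))"
  have "fp (k + 2) (if i < k then (\<lambda>e. e (i + 2)) else if i = k then (\<lambda>e. unary (length (e 0))) else (\<lambda>e. e 1))" for i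
  proof -
    have "fp (k + 2) (\<lambda>e. unary (length (e 0)))" by (intro fp_unary fpn_length fp_proj) simp
    then show ?thesis by (auto intro: fp_proj)
  qed
  from fp_comp[OF h, of "k + 2" "\<lambda>i. if i < k then (\<lambda>e. e (i + 2)) else if i = k
    then (\<lambda>e. unary (length (e 0))) else (\<lambda>e. e 1)", OF this]
  have "fp (k + 2) (\<lambda>e. h (\<lambda>i. if i < k + 2 then (if i < k then (\<lambda>e. e (i + 2)) else if i = k
    then (\<lambda>e. unary (length (e 0))) else (\<lambda>e. e 1)) e else []))" .
  moreover have "(\<lambda>i. if i < k + 2 then (if i < k then (\<lambda>e. e (i + 2)) else if i = k
      then (\<lambda>e. unary (length (e 0))) else (\<lambda>e. e 1)) e else [])
      = env (length (e 0)) (e 1) (\<lambda>i. e (i + 2))" for e :: stacks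
    by (auto simp: env_def fun_eq_iff)
  ultimately have B: "fp (k + 2) B" by (simp add: B_def)
  have "fp (k + 1) (\<lambda>e. F (e 0) (\<lambda>i. e (i + 1)))"
  proof (rule fp_rec[OF z B B, where T = T])
    show "length (F x e) \<le> poly T (length x + vol k e)" if "\<forall>i\<ge>k. e i = []" for x e
      using bound[OF that, of "length x"] by (simp add: F_def env[OF that])
  qed (auto simp: F_def B_def)
  moreover have "fp k (case i of 0 \<Rightarrow> (\<lambda>e. unary (n e)) | Suc j \<Rightarrow> (\<lambda>e. e j))" if "i < k + 1" for i
    using that fp_unary[OF n] by (auto split: nat.splits intro: fp_proj)
  ultimately have "fp k (\<lambda>e. F (unary (n e)) (\<lambda>i. if i < k then e i else []))"
    using fp_comp[of "k + 1" "\<lambda>e :: stacks. F (e 0) (\<lambda>i. e (i + 1))" k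
        "\<lambda>i. case i of 0 \<Rightarrow> (\<lambda>e. unary (n e)) | Suc j \<Rightarrow> (\<lambda>e. e j)"] by (simp cong: if_cong)
  then show ?thesis
  proof (rule fp_cong)
    fix e :: stacks
    assume e: "\<forall>i\<ge>k. e i = []"
    then have "(\<lambda>i. if i < k then e i else []) = e" by auto
    then show "F (unary (n e)) (\<lambda>i. if i < k then e i else [])
        = iter (\<lambda>i a. h (e(k := unary i, Suc k := a))) (z e) (n e)"
      by (simp add: F_def env[OF e])
  qed
qed

lemma fp_iter_small:
  assumes h: "fp (k + 2) h" and z: "fp k z" and n: "fpn k n"
    and bound: "\<And>e. (\<forall>j\<ge>k + 2. e j = []) \<Longrightarrow> length (h e) \<le> length (e (Suc k)) + c"
  shows "fp k (\<lambda>e. iter (\<lambda>i a. h (e(k := unary i, Suc k := a))) (z e) (n e))"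
proof -
  obtain T where T: "\<And>e. (\<forall>i\<ge>k. e i = []) \<Longrightarrow> length (z e) \<le> poly T (vol k e)"
    by (rule fp_length[OF z]) auto
  show ?thesis
  proof (rule fp_iter[OF h z n])
    fix e :: stacks and m
    assume e: "\<forall>i\<ge>k. e i = []"
    have "length (iter (\<lambda>i a. h (e(k := unary i, Suc k := a))) (z e) m) \<le> length (z e) + m * c"
    proof (induction m)
      case (Suc m)
      have "length (h (e(k := unary m, Suc k := x))) \<le> length x + c" for x
        using bound[of "e(k := unary m, Suc k := x)"] e by simp
      from this[of "iter (\<lambda>i a. h (e(k := unary i, Suc k := a))) (z e) m"] Suc
      show ?case by (simp only: iter.simps mult_Suc)
    qed simp
    also have "\<dots> \<le> poly T (m + vol k e) + (m + vol k e) * c"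
      using T[OF e] poly_mono_nat[of "vol k e" "m + vol k e" T] by (intro add_mono mult_right_mono) auto
    finally show "length (iter (\<lambda>i a. h (e(k := unary i, Suc k := a))) (z e) m)
        \<le> poly (T + [:0, c:]) (m + vol k e)" by simp
  qed
qed

section \<open>Calling a machine with a clock\<close>

text \<open>Every step of \<open>M\<close> costs one bit of the clock on tape \<open>m\<close>; the
  flag on tape \<open>Suc m\<close> reports that \<open>M\<close> has halted. The table of
  \<open>M\<close> is consulted before the clock, so halting after exactly as many steps as the
  clock has bits still counts.\<close>

definition timed :: "nat \<Rightarrow> nat \<Rightarrow> tm \<Rightarrow> tm" where
  "timed m W M = TM W (\<lambda>(q, ss).
     if length ss \<noteq> W \<or> odd q then None
     else case delta M (q div 2, take m ss) of
       None \<Rightarrow> Some (1, map (\<lambda>j. if j = Suc m then (Bit True, Stay) else (ss ! j, Stay)) [0..<W])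
     | Some (q', as) \<Rightarrow> if ss ! m = Blank then None
         else Some (2 * q', map (\<lambda>j. if j < m then as ! j else if j = m then (Blank, Right)
           else (ss ! j, Stay)) [0..<W]))"

lemma good_timed:
  assumes "good m M" "Suc m < W" shows "good W (timed m W M)"
proof -
  obtain Q G where 1: "tapes M = m" "finite Q" "finite G" "table_within m Q G M"
    using assms(1) by (rule goodE)
  show ?thesis
  proof (rule goodI[where Q = "insert 1 ((\<lambda>q. 2 * q) ` Q)" and G = "G \<union> bits_and_blank"])
    fix q ss q' as
    assume a: "delta (timed m W M) (q, ss) = Some (q', as)"
    then have l: "length ss = W" by (auto simp: timed_def split: if_splits)
    consider "q' = 1" "as = map (\<lambda>j. if j = Suc m then (Bit True, Stay) else (ss ! j, Stay)) [0..<W]"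
      | q1 as1 where "delta M (q div 2, take m ss) = Some (q1, as1)" "q' = 2 * q1"
        "as = map (\<lambda>j. if j < m then as1 ! j else if j = m then (Blank, Right) else (ss ! j, Stay)) [0..<W]"
      using a by (auto simp: timed_def split: if_splits option.splits)
    then show "length ss = W \<and> length as = W \<and> q' \<in> insert 1 ((\<lambda>q. 2 * q) ` Q)
        \<and> fst ` set as \<subseteq> set ss \<union> (G \<union> bits_and_blank)"
    proof cases
      case 2
      note * = table_withinD[OF 1(4) 2(1)]
      have "fst (as1 ! j) \<in> set ss \<union> G" if "j < m" for j
      proof -
        have "fst (as1 ! j) \<in> fst ` set as1" using that * by simp
        then show ?thesis using * set_take_subset[of m ss] by blast
      qed
      then have le: "fst (if j < m then as1 ! j else if j = m then (Blank, Right) else (ss ! j, Stay))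
          \<in> set ss \<union> (G \<union> bits_and_blank)" if "j < W" for j
        using that l by auto
      have gen: "fst ` set (map f [0..<W]) \<subseteq> S" if "\<And>j. j < W \<Longrightarrow> fst (f j) \<in> S"
        for f :: "nat \<Rightarrow> symbol \<times> direction" and S using that by auto
      have "fst ` set as \<subseteq> set ss \<union> (G \<union> bits_and_blank)" unfolding 2(3) by (rule gen) (rule le)
      moreover have "length as = W" "q' \<in> insert 1 ((\<lambda>q. 2 * q) ` Q)" using 2(2,3) * by auto
      ultimately show ?thesis using l by blast
    qed (use l in auto)
  qed (use 1 in \<open>auto simp: timed_def\<close>)
qed

lemma funpow_step_halted: "halted M c \<Longrightarrow> (step M ^^ n) c = c"
  by (induction n) (auto simp: halted_def step_def split: prod.splits)

lemma take_scanned_tv: "m \<le> W \<Longrightarrow> take m (scanned (tv W t)) = scanned (tv m t)"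
  by (auto simp: list_eq_iff_nth_eq)

lemma delta_timed_1: "delta (timed m W M) (Suc 0, ss) = None"
  by (simp add: timed_def)

text \<open>Stated through \<open>step\<close>, which stutters after halting, so that an early halt
  and an exhausted clock have a common form. The extra step in \<open>length c + 1\<close> sets the
  flag.\<close>

definition timed_outcome :: "nat \<Rightarrow> nat \<Rightarrow> tm \<Rightarrow> nat \<Rightarrow> (nat \<Rightarrow> tape) \<Rightarrow> bool list \<Rightarrow> bool" where
  "timed_outcome m W M q t c \<longleftrightarrow> (\<exists>n t' p. n \<le> length c + 1 \<and> reaches (timed m W M) (2 * q, tv W t) n (p, tv W t')
      \<and> delta (timed m W M) (p, scanned (tv W t')) = None
      \<and> tv m t' = snd ((step M ^^ length c) (q, tv m t))
      \<and> t' (Suc m) = input_tape (if halted M ((step M ^^ length c) (q, tv m t)) then [True] else [])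
      \<and> (\<exists>c'. length c' \<le> length c \<and> t' m = input_tape c') \<and> (\<forall>j>Suc m. t' j = t j))"

lemma timed_outcome_halted:
  assumes g: "good m M" "Suc m < W" and t: "t m = input_tape c" "t (Suc m) = input_tape []"
    and None: "delta M (q, scanned (tv m t)) = None"
  shows "timed_outcome m W M q t c"
proof -
  let ?as = "map (\<lambda>j. if j = Suc m then (Bit True, Stay) else (scanned (tv W t) ! j, Stay)) [0..<W]"
  let ?t = "t(Suc m := input_tape [True])"
  have "reaches (timed m W M) (2 * q, tv W t) (Suc 0) (1, tv W ?t)"
  proof (rule reaches_step)
    show "delta (timed m W M) (2 * q, scanned (tv W t)) = Some (1, ?as)"
      using None g by (simp add: timed_def take_scanned_tv)
    have "act (Bit True, Stay) (input_tape []) = input_tape [True]"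
      by (auto simp: input_tape_def)
    then have "map2 act ?as (tv W t) = tv W ?t"
      using t(2) g(2) by (auto simp: list_eq_iff_nth_eq simp del: act.simps)
    then show "reaches (timed m W M) (1, map2 act ?as (tv W t)) 0 (1, tv W ?t)"
      by (simp add: reaches_refl)
  qed
  moreover have "halted M (q, tv m t)" using None by (simp add: halted_def)
  moreover have "tv m ?t = tv m t" by (rule tv_cong) auto
  moreover have "\<exists>c'. length c' \<le> length c \<and> t m = input_tape c'" using t(1) by blast
  ultimately show ?thesis unfolding timed_outcome_def using funpow_step_halted[of M "(q, tv m t)"]
    by (intro exI[of _ "Suc 0"] exI[of _ ?t] exI[of _ "Suc 0"] conjI)
      (simp_all add: delta_timed_1 fun_upd_def del: funpow.simps)
qed

lemma reaches_timed:
  assumes g: "good m M" "Suc m < W"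
  shows "t m = input_tape c \<Longrightarrow> t (Suc m) = input_tape [] \<Longrightarrow> timed_outcome m W M q t c"
proof (induction c arbitrary: q t)
  case (Cons b c)
  show ?case
  proof (cases "delta M (q, scanned (tv m t))")
    case None
    then show ?thesis using Cons.prems by (intro timed_outcome_halted[OF g]) simp_all
  next
    case (Some r)
    then obtain q1 as where d: "delta M (q, scanned (tv m t)) = Some (q1, as)" by (cases r) auto
    let ?t = "\<lambda>j. if j < m then act (as ! j) (t j) else if j = m then input_tape c else t j"
    have la: "length as = m" using good_length[OF g(1) d] by simp
    have 0: "t m 0 \<noteq> Blank" using Cons.prems by simp
    have m2: "map2 act (map (\<lambda>j. if j < m then as ! j else if j = m then (Blank, Right)
        else (scanned (tv W t) ! j, Stay)) [0..<W]) (tv W t) = tv W ?t"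
      using Cons.prems act_Blank_Right_input_tape[of "b # c"]
      by (auto simp: list_eq_iff_nth_eq simp del: act.simps)
    have r1: "reaches (timed m W M) (2 * q, tv W t) n c'" if "reaches (timed m W M) (2 * q1, tv W ?t) k c'" "n = Suc k" for k n c'
      unfolding that(2)
      by (rule reaches_step[OF _ that(1)[folded m2]]) (use d g 0 in \<open>simp add: timed_def take_scanned_tv\<close>)
    have st: "step M (q, tv m t) = (q1, tv m ?t)"
      using d la by (auto simp: step_def list_eq_iff_nth_eq)
    have fp: "(step M ^^ length (b # c)) (q, tv m t) = (step M ^^ length c) (q1, tv m ?t)"
      by (simp only: length_Cons funpow_Suc_right o_apply st)
    obtain n t' p where IH: "n \<le> length c + 1" "reaches (timed m W M) (2 * q1, tv W ?t) n (p, tv W t')"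
      "delta (timed m W M) (p, scanned (tv W t')) = None"
      "tv m t' = snd ((step M ^^ length c) (q1, tv m ?t))"
      "t' (Suc m) = input_tape (if halted M ((step M ^^ length c) (q1, tv m ?t)) then [True] else [])"
      "\<exists>c'. length c' \<le> length c \<and> t' m = input_tape c'" "\<forall>j>Suc m. t' j = ?t j"
      using Cons.IH[of ?t q1] Cons.prems unfolding timed_outcome_def by auto
    show ?thesis unfolding timed_outcome_def fp
      using r1[OF IH(2) refl] IH
      by (intro exI[of _ "Suc n"] exI[of _ t'] exI[of _ p]) (auto intro: le_SucI)
  qed
next
  case Nil
  show ?case
  proof (cases "delta M (q, scanned (tv m t))")
    case None
    then show ?thesis using Nil.prems by (intro timed_outcome_halted[OF g]) simp_all
  next
    case (Some r)
    have "\<not> halted M (q, tv m t)" using Some by (simp add: halted_def)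
    then show ?thesis using Nil Some g(2) unfolding timed_outcome_def
      by (intro exI[of _ 0] exI[of _ t] exI[of _ "2 * q"]) (auto simp: timed_def take_scanned_tv intro: reaches_refl)
  qed
qed

text \<open>A for loop: while \<open>z\<close> is moved to the tapes \<open>js\<close>, each other
  tape undergoes its action exactly \<open>length z\<close> times.\<close>

lemma stops_mvloop:
  assumes i: "i < W" "i \<notin> js" and x: "\<And>j c. fst (x j c) \<in> {c, Blank}"
  shows "t i = input_tape z \<Longrightarrow> (\<And>j. j \<in> js \<Longrightarrow> t j = input_tape (y j)) \<Longrightarrow>
    stops (loop (\<lambda>ss. ss ! i \<noteq> Blank) (mv W i js x)) (tv W t) (5 * length z)
      (tv W (\<lambda>j. if j \<in> js then input_tape (rev z @ y j) else if j = i then input_tape []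
         else ((\<lambda>\<tau>. act (x j (\<tau> 0)) \<tau>) ^^ length z) (t j)))"
proof (induction z arbitrary: t y)
  case Nil
  have "tv W (\<lambda>j. if j \<in> js then input_tape (rev [] @ y j) else if j = i then input_tape []
         else ((\<lambda>\<tau>. act (x j (\<tau> 0)) \<tau>) ^^ length ([] :: bool list)) (t j)) = tv W t"
    using Nil by (intro tv_cong) auto
  then show ?case using Nil i by (simp add: stops_loop_exit)
next
  case (Cons b z)
  let ?t = "\<lambda>j. if j \<in> js then push (t i 0) (t j) else if j = i then act (Blank, Right) (t i)
        else act (x j (t j 0)) (t j)"
  have ti: "t i 0 = Bit b" using Cons.prems by (simp add: input_tape_0)
  have a: "stops (mv W i js x) (tv W t) 3 (tv W ?t)" by (rule stops_mv[OF i x])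
  have "?t i = input_tape z" using i Cons.prems by (simp add: act_Blank_Right_input_tape del: act.simps)
  moreover have "?t j = input_tape (b # y j)" if "j \<in> js" for j using that ti Cons.prems by simp
  ultimately have b: "stops (loop (\<lambda>ss. ss ! i \<noteq> Blank) (mv W i js x)) (tv W ?t) (5 * length z)
      (tv W (\<lambda>j. if j \<in> js then input_tape (rev z @ (b # y j)) else if j = i then input_tape []
         else ((\<lambda>\<tau>. act (x j (\<tau> 0)) \<tau>) ^^ length z) (?t j)))"
    by (rule Cons.IH[where y = "\<lambda>j. b # y j"])
  have "stops (loop (\<lambda>ss. ss ! i \<noteq> Blank) (mv W i js x)) (tv W t) (3 + 5 * length z + 2)
      (tv W (\<lambda>j. if j \<in> js then input_tape (rev z @ (b # y j)) else if j = i then input_tape []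
         else ((\<lambda>\<tau>. act (x j (\<tau> 0)) \<tau>) ^^ length z) (?t j)))"
    by (rule stops_loop_step[OF good_mv[OF i(1) x] _ _ a b]) (use i ti in auto)
  moreover have "tv W (\<lambda>j. if j \<in> js then input_tape (rev z @ (b # y j)) else if j = i then input_tape []
         else ((\<lambda>\<tau>. act (x j (\<tau> 0)) \<tau>) ^^ length z) (?t j))
      = tv W (\<lambda>j. if j \<in> js then input_tape (rev (b # z) @ y j) else if j = i then input_tape []
         else ((\<lambda>\<tau>. act (x j (\<tau> 0)) \<tau>) ^^ length (b # z)) (t j))"
    by (rule tv_cong) (simp add: funpow_Suc_right del: funpow.simps act.simps)
  ultimately show ?case by (simp add: algebra_simps)
qed

section \<open>Reading off the output\<close>

lemma holds_string_unique: "holds_string \<tau> x \<Longrightarrow> holds_string \<tau> y \<Longrightarrow> x = y"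
proof (induction x arbitrary: \<tau> y)
  case Nil
  then show ?case by (cases y) (force simp: holds_string_def)+
next
  case (Cons b x)
  have t: "\<tau> 0 = Bit b" using Cons.prems(1) by (force simp: holds_string_def)
  obtain c y' where y: "y = c # y'"
    using Cons.prems t by (cases y) (auto simp: holds_string_def)
  have "c = b" using Cons.prems(2) t y by (force simp: holds_string_def)
  have shift: "holds_string (\<lambda>i. \<tau> (i + 1)) z" if "holds_string \<tau> (d # z)" for d z
    using that unfolding holds_string_def by (force simp: add.commute)
  have "x = y'"
    by (rule Cons.IH[OF shift[OF Cons.prems(1)] shift[OF Cons.prems(2)[unfolded y]]])
  then show ?case using y \<open>c = b\<close> by simp
qed

lemma tape_output_eq_Some: "tape_output \<tau> = Some y \<longleftrightarrow> holds_string \<tau> y"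
  unfolding tape_output_def using holds_string_unique by (auto intro: the_equality[symmetric] theI)

lemma tape_output_eq_None: "tape_output \<tau> = None \<longleftrightarrow> (\<nexists>y. holds_string \<tau> y)"
  unfolding tape_output_def by auto

lemma holds_string_input_tape: "holds_string (input_tape x) x"
  by (auto simp: holds_string_def input_tape_def)

text \<open>The maximal run of bits from the head on, whatever ends it. It exists on every confined
  tape, even if the tape has no output, so bits can be extracted first and the symbol after them
  tested later.\<close>

definition bit_prefix :: "tape \<Rightarrow> bool list \<Rightarrow> bool" where
  "bit_prefix \<tau> y \<longleftrightarrow> (\<forall>i < length y. \<tau> (int i) = Bit (y ! i)) \<and> (\<forall>b. \<tau> (int (length y)) \<noteq> Bit b)"

lemma bit_prefix_exists:
  assumes "confined b \<tau>"
  obtains y where "bit_prefix \<tau> y" "length y \<le> Suc b"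
proof -
  let ?P = "\<lambda>n. \<forall>b. \<tau> (int n) \<noteq> Bit b"
  have P: "?P (Suc b)" using assms by (auto simp: confined_def dest!: spec[of _ "int (Suc b)"])
  define n where "n = (LEAST n. ?P n)"
  have n: "?P n" "n \<le> Suc b" unfolding n_def using LeastI[of ?P, OF P] Least_le[of ?P, OF P] by auto
  have "\<exists>c. \<tau> (int i) = Bit c" if "i < n" for i using not_less_Least[of i ?P] that n_def by auto
  then have "\<tau> (int i) = Bit (map (\<lambda>i. SOME c. \<tau> (int i) = Bit c) [0..<n] ! i)" if "i < n" for i
    using that by (auto intro: someI_ex)
  then have "bit_prefix \<tau> (map (\<lambda>i. SOME c. \<tau> (int i) = Bit c) [0..<n])"
    using n by (auto simp: bit_prefix_def)
  then show thesis by (rule that) (use n in auto)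
qed

lemma bit_prefix_holds: "bit_prefix \<tau> y \<Longrightarrow> holds_string \<tau> z \<longleftrightarrow> z = y \<and> \<tau> (int (length y)) = Blank"
proof
  assume y: "bit_prefix \<tau> y" and z: "holds_string \<tau> z"
  have "length z = length y"
  proof (rule ccontr)
    assume "length z \<noteq> length y"
    then consider "length z < length y" | "length y < length z" by linarith
    then show False
      by cases (use y z in \<open>auto simp: bit_prefix_def holds_string_def\<close>)
  qed
  then show "z = y \<and> \<tau> (int (length y)) = Blank"
    using y z by (auto simp: bit_prefix_def holds_string_def list_eq_iff_nth_eq)
qed (auto simp: bit_prefix_def holds_string_def)

lemma confined_funpow:
  "confined b \<tau> \<Longrightarrow> confined (b + n) (((\<lambda>\<tau>. act (f (\<tau> 0)) \<tau>) ^^ n) \<tau>)"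
  by (induction n) (auto intro: confined_act simp del: act.simps)

lemma stops_extract:
  assumes W: "0 < m" "Suc (Suc m) < W"
  shows "t (Suc m) = input_tape [True] \<Longrightarrow> t (Suc (Suc m)) = input_tape z \<Longrightarrow> bit_prefix (t 0) y \<Longrightarrow>
    stops (loop (\<lambda>ss. ss ! Suc m \<noteq> Blank \<and> (\<exists>b. ss ! 0 = Bit b)) (mv W 0 {Suc (Suc m)} (\<lambda>j c. (c, Stay))))
      (tv W t) (5 * length y)
      (tv W (t(0 := ((\<lambda>\<tau>. act (Blank, Right) \<tau>) ^^ length y) (t 0), Suc (Suc m) := input_tape (rev y @ z))))"
proof (induction y arbitrary: t z)
  case Nil
  have "\<not> (\<exists>b. t 0 0 = Bit b)" using Nil.prems by (simp add: bit_prefix_def)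
  then have "\<not> (scanned (tv W t) ! Suc m \<noteq> Blank \<and> (\<exists>b. scanned (tv W t) ! 0 = Bit b))" using W by simp
  moreover have "t(0 := ((\<lambda>\<tau>. act (Blank, Right) \<tau>) ^^ length ([] :: bool list)) (t 0),
      Suc (Suc m) := input_tape (rev [] @ z)) = t"
    using Nil.prems by (auto simp: fun_eq_iff)
  ultimately show ?case by (simp only: stops_loop_exit not_False_eq_True)
next
  case (Cons b y)
  let ?L = "loop (\<lambda>ss. ss ! Suc m \<noteq> Blank \<and> (\<exists>b. ss ! 0 = Bit b)) (mv W 0 {Suc (Suc m)} (\<lambda>j c. (c, Stay)))"
  let ?t = "t(0 := act (Blank, Right) (t 0), Suc (Suc m) := input_tape (b # z))"
  have t0: "t 0 0 = Bit b" using Cons.prems(3) by (force simp: bit_prefix_def)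
  have "stops (mv W 0 {Suc (Suc m)} (\<lambda>j c. (c, Stay))) (tv W t) 3 (tv W (\<lambda>j. if j \<in> {Suc (Suc m)}
      then push (t 0 0) (t j) else if j = 0 then act (Blank, Right) (t 0) else act (t j 0, Stay) (t j)))"
    by (rule stops_mv) (use W in auto)
  moreover have "tv W (\<lambda>j. if j \<in> {Suc (Suc m)}
      then push (t 0 0) (t j) else if j = 0 then act (Blank, Right) (t 0) else act (t j 0, Stay) (t j)) = tv W ?t"
    using Cons.prems t0 by (intro tv_cong) (auto simp del: act.simps)
  ultimately have a: "stops (mv W 0 {Suc (Suc m)} (\<lambda>j c. (c, Stay))) (tv W t) 3 (tv W ?t)" by simp
  have "bit_prefix (\<lambda>i. \<tau> (i + 1)) y" if "bit_prefix \<tau> (b # y)" for \<tau>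
    using that unfolding bit_prefix_def by (force simp: add.commute)
  moreover have "act (Blank, Right) \<tau> (int i) = \<tau> (int i + 1)" for \<tau> i by simp
  ultimately have "bit_prefix (?t 0) y" using Cons.prems(3) by (auto simp: bit_prefix_def simp del: act.simps)
  then have b: "stops ?L (tv W ?t) (5 * length y)
      (tv W (?t(0 := ((\<lambda>\<tau>. act (Blank, Right) \<tau>) ^^ length y) (?t 0), Suc (Suc m) := input_tape (rev y @ (b # z)))))"
    using Cons.prems by (intro Cons.IH) (simp_all del: act.simps)
  have "stops ?L (tv W t) (3 + 5 * length y + 2)
      (tv W (?t(0 := ((\<lambda>\<tau>. act (Blank, Right) \<tau>) ^^ length y) (?t 0), Suc (Suc m) := input_tape (rev y @ (b # z)))))"
    by (rule stops_loop_step[OF good_mv _ _ a b]) (use W t0 Cons.prems in auto)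
  moreover have "?t(0 := ((\<lambda>\<tau>. act (Blank, Right) \<tau>) ^^ length y) (?t 0), Suc (Suc m) := input_tape (rev y @ (b # z)))
     = t(0 := ((\<lambda>\<tau>. act (Blank, Right) \<tau>) ^^ length (b # y)) (t 0), Suc (Suc m) := input_tape (rev (b # y) @ z))"
    by (simp add: funpow_Suc_right del: funpow.simps act.simps)
  moreover have "3 + 5 * length y + 2 = 5 * length (b # y)" by simp
  ultimately show ?case by (simp only:)
qed

lemma nth_extract: "((\<lambda>\<tau>. act (Blank, Right) \<tau>) ^^ n) \<tau> 0 = \<tau> (int n)"
proof -
  have "((\<lambda>\<tau>. act (Blank, Right) \<tau>) ^^ n) \<tau> i = \<tau> (i + int n)" if "i \<ge> 0" for i
    using that by (induction n arbitrary: i) (auto simp: algebra_simps)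
  then show ?thesis by simp
qed

lemma confined_steps:
  assumes "good W M"
  shows "\<forall>\<tau>\<in>set (snd c). confined b \<tau> \<Longrightarrow> \<forall>\<tau>\<in>set (snd ((step M ^^ n) c)). confined (b + n) \<tau>"
proof (induction n)
  case (Suc n)
  obtain q \<tau>s where c: "(step M ^^ n) c = (q, \<tau>s)" by fastforce
  have IH: "\<forall>\<tau>\<in>set \<tau>s. confined (b + n) \<tau>" using Suc c by simp
  have "\<forall>\<tau>\<in>set (snd (step M (q, \<tau>s))). confined (Suc (b + n)) \<tau>"
  proof (cases "delta M (q, scanned \<tau>s)")
    case None
    then show ?thesis using IH by (auto simp: step_def intro: confined_mono)
  next
    case (Some r)
    then obtain q' as where "delta M (q, scanned \<tau>s) = Some (q', as)" by (cases r) auto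
    then show ?thesis using IH
      by (auto simp: step_def dest!: set_zip_rightD intro!: confined_act)
  qed
  then show ?case using c by simp
qed simp

section \<open>Erasing tapes\<close>

lemma funpow_Left: "((\<lambda>\<tau>. act (\<tau> 0, Left) \<tau>) ^^ n) \<tau> = (\<lambda>i. \<tau> (i - int n))"
  by (induction n) (auto simp: fun_eq_iff algebra_simps)

lemma funpow_erase:
  "((\<lambda>\<tau>. act (Blank, Right) \<tau>) ^^ n) \<tau> = (\<lambda>i. if - int n \<le> i \<and> i < 0 then Blank else \<tau> (i + int n))"
proof (induction n)
  case (Suc n)
  have "((\<lambda>\<tau>. act (Blank, Right) \<tau>) ^^ Suc n) \<tau>
      = act (Blank, Right) (\<lambda>i. if - int n \<le> i \<and> i < 0 then Blank else \<tau> (i + int n))"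
    using Suc by (simp del: act.simps)
  also have "\<dots> = (\<lambda>i. if - int (Suc n) \<le> i \<and> i < 0 then Blank else \<tau> (i + int (Suc n)))"
    by (auto simp: fun_eq_iff algebra_simps)
  finally show ?case .
qed (auto simp: fun_eq_iff)

text \<open>Starting n cells left of the head, erasing 2n cells covers the positions from -n to n -
  1. These contain everything nonblank because b < n.\<close>

lemma sweep_erases:
  assumes "confined b \<tau>" "b < n"
  shows "((\<lambda>\<tau>. act (Blank, Right) \<tau>) ^^ n) (((\<lambda>\<tau>. act (Blank, Right) \<tau>) ^^ n)
     (((\<lambda>\<tau>. act (\<tau> 0, Left) \<tau>) ^^ n) \<tau>)) = input_tape []"
proof -
  have "\<tau> i = Blank" if "\<bar>i\<bar> \<ge> int n" for i using assms that by (force simp: confined_def)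
  then show ?thesis unfolding funpow_Left funpow_erase
    by (auto simp: fun_eq_iff input_tape_def)
qed

lemma funpow_Stay: "((\<lambda>\<tau>. act (\<tau> 0, Stay) \<tau>) ^^ n) \<tau> = \<tau>"
  by (induction n) auto

definition sweep_left :: "nat \<Rightarrow> nat \<Rightarrow> symbol \<Rightarrow> symbol \<times> direction" where
  "sweep_left m j c = (if j < m then (c, Left) else (c, Stay))"

definition sweep_erase :: "nat \<Rightarrow> nat \<Rightarrow> symbol \<Rightarrow> symbol \<times> direction" where
  "sweep_erase m j c = (if j < m then (Blank, Right) else (c, Stay))"

text \<open>Tapes: \<open>0, \<dots>, m - 1\<close> belong to \<open>M\<close>, then clock, success flag, output, and two tapes for a
  unary number that bounds the region to be erased.\<close>

definition core :: "nat \<Rightarrow> tm \<Rightarrow> tm" where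
  "core m M = (let W = m + 5; mvl = (\<lambda>i js x. loop (\<lambda>ss. ss ! i \<noteq> Blank) (mv W i js x)) in
     seq (timed m W M)
    (seq (mvl m {} (\<lambda>j c. (c, Stay)))
    (seq (loop (\<lambda>ss. ss ! Suc m \<noteq> Blank \<and> (\<exists>b. ss ! 0 = Bit b)) (mv W 0 {Suc (Suc m)} (\<lambda>j c. (c, Stay))))
    (seq (opm W (\<lambda>ss j. if j = Suc m \<and> ss ! 0 \<noteq> Blank then (Blank, Stay) else (ss ! j, Stay)))
    (seq (mvl (m + 3) {m + 4} (sweep_left m))
    (seq (mvl (m + 4) {m + 3} (sweep_erase m))
         (mvl (m + 3) {m + 4} (sweep_erase m))))))))"

lemma good_core:
  assumes "good m M" "0 < m" shows "good (m + 5) (core m M)"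
  unfolding core_def Let_def
  by (intro good_seq good_timed good_loop good_mv good_opm)
    (use assms in \<open>auto simp: sweep_left_def sweep_erase_def\<close>)

text \<open>Let b be the volume of the tapes of \<open>M\<close> plus the length of the clock. Their
  contents stay within b cells of the heads, and reading off at most b + 1 bits shifts tape 0 by as
  much. So the region to be erased lies within 2b + 1, and a counter of length 2b + 2 exceeds
  it.\<close>

lemma stops_core:
  assumes g: "good m M" and m: "0 < m"
    and s: "s (Suc m) = []" "s (Suc (Suc m)) = []" "s (m + 4) = []"
    and w: "2 * (vol m s + length (s m)) + 2 \<le> length (s (m + 3))"
    and c': "c' = (step M ^^ length (s m)) (0, tp m s)"
  shows "\<exists>s'. stops (core m M) (tp (m + 5) s) (40 * vol (m + 5) s + 40) (tp (m + 5) s')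
    \<and> (\<forall>j\<le>m. s' j = []) \<and> s' (m + 3) = []
    \<and> (case if halted M c' then tape_output (hd (snd c')) else None of
         None \<Rightarrow> s' (Suc m) = []
       | Some y \<Rightarrow> s' (Suc m) = [True] \<and> s' (Suc (Suc m)) = rev y)"
proof -
  define W where "W = m + 5"
  define fl where "fl = (if halted M c' then [True] else [])"
  define b where "b = vol m s + length (s m)"
  let ?st = "\<lambda>(j :: nat) c. (c :: symbol, Stay)"
  let ?mvl = "\<lambda>i js x. loop (\<lambda>ss. ss ! i \<noteq> Blank) (mv W i js x)"
  let ?X = "loop (\<lambda>ss. ss ! Suc m \<noteq> Blank \<and> (\<exists>b. ss ! 0 = Bit b)) (mv W 0 {Suc (Suc m)} ?st)"
  let ?o = "\<lambda>ss j. if j = Suc m \<and> ss ! 0 \<noteq> Blank then (Blank, Stay) else (ss ! j, Stay)"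
  obtain n t1 p c1 where t1: "n \<le> length (s m) + 1"
    "reaches (timed m W M) (0, tp W s) n (p, tv W t1)"
    "delta (timed m W M) (p, scanned (tv W t1)) = None"
    "tv m t1 = snd c'" "t1 (Suc m) = input_tape fl"
    "length c1 \<le> length (s m)" "t1 m = input_tape c1" "\<And>j. j > Suc m \<Longrightarrow> t1 j = input_tape (s j)"
    using reaches_timed[OF g, of W "\<lambda>i. input_tape (s i)" "s m" 0] s(1)
    unfolding timed_outcome_def c' fl_def W_def tp_def by auto
  have S1: "stops (timed m W M) (tp W s) (length (s m) + 1) (tv W t1)"
    unfolding stops_def using t1(1-3) by blast
  have "\<forall>\<tau>\<in>set (snd (0 :: nat, tp m s)). confined (vol m s) \<tau>"
    using confined_mono[OF confined_input_tape length_le_vol] by (auto simp: tp_def tv_def)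
  from confined_steps[OF g this, of "length (s m)"]
  have "\<forall>\<tau>\<in>set (tv m t1). confined b \<tau>" unfolding c'[symmetric] t1(4) b_def .
  then have cb1: "confined b (t1 j)" if "j < m" for j using that by (auto simp: tv_def)
  define t2 where "t2 = t1(m := input_tape [])"
  have S2: "stops (?mvl m {} ?st) (tv W t1) (5 * length (s m)) (tv W t2)"
  proof -
    have "stops (?mvl m {} ?st) (tv W t1) (5 * length c1) (tv W (\<lambda>j. if j \<in> {} then input_tape (rev c1 @ [])
        else if j = m then input_tape [] else ((\<lambda>\<tau>. act (?st j (\<tau> 0)) \<tau>) ^^ length c1) (t1 j)))"
      by (rule stops_mvloop) (use t1(7) in \<open>auto simp: W_def\<close>)
    then show ?thesis
      by (rule stops_cong) (use t1(6) in \<open>auto intro!: tv_cong simp: t2_def funpow_Stay simp del: act.simps act_Stay\<close>)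
  qed
  have hd: "hd (snd c') = t2 0" unfolding t1(4)[symmetric] t2_def using m by (simp add: tv_def hd_map)
  obtain y where y: "bit_prefix (t2 0) y" "length y \<le> Suc b"
    by (rule bit_prefix_exists[of b "t2 0"]) (use cb1[of 0] m in \<open>auto simp: t2_def\<close>)
  \<comment> \<open>Without the flag the extraction loop exits at once and nothing is read.\<close>
  define z where "z = (if fl = [] then [] else y)"
  define t3 where "t3 = t2(0 := ((\<lambda>\<tau>. act (Blank, Right) \<tau>) ^^ length z) (t2 0), Suc (Suc m) := input_tape (rev z))"
  have S3: "stops ?X (tv W t2) (5 * Suc b) (tv W t3)"
  proof (cases "fl = []")
    case True
    then have "t3 = t2" using t1(8)[of "Suc (Suc m)"] s(2) m by (auto simp: t3_def z_def t2_def fun_eq_iff)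
    moreover have "stops ?X (tv W t2) (5 * Suc b) (tv W t2)"
      by (rule stops_loop_exit) (use True t1(5) in \<open>simp add: t2_def W_def\<close>)
    ultimately show ?thesis by simp
  next
    case False
    then have "fl = [True]" by (auto simp: fl_def split: if_splits)
    then have "stops ?X (tv W t2) (5 * length y) (tv W (t2(0 := ((\<lambda>\<tau>. act (Blank, Right) \<tau>) ^^ length y) (t2 0),
         Suc (Suc m) := input_tape (rev y @ []))))"
      by (intro stops_extract) (use m t1 s(2) y in \<open>simp_all add: t2_def W_def\<close>)
    then show ?thesis by (rule stops_cong) (use False y in \<open>simp_all add: t3_def z_def\<close>)
  qed
  have lz: "length z \<le> Suc b" using y(2) by (simp add: z_def)
  \<comment> \<open>Bits followed by anything but a blank are no output, so the flag is
    withdrawn.\<close>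
  define fl' where "fl' = (if t3 0 0 \<noteq> Blank then [] else fl)"
  define t4 where "t4 = t3(Suc m := input_tape fl')"
  have S4: "stops (opm W ?o) (tv W t3) 1 (tv W t4)"
  proof -
    have f: "t3 (Suc m) = input_tape fl" using t1(5) by (simp add: t3_def t2_def)
    have e: "act (Blank, Stay) (input_tape fl) = input_tape []"
      by (auto simp: fl_def input_tape_def fun_eq_iff)
    have "act (?o (scanned (tv W t3)) j) (t3 j) = t4 j" if "j < W" for j
    proof -
      have "0 < W" by (simp add: W_def)
      then show ?thesis using that f e by (auto simp: t4_def fl'_def simp del: act.simps act_Stay) (simp_all)
    qed
    then show ?thesis using stops_opm[of W ?o t3] by (elim stops_cong) (auto intro!: tv_cong simp del: act.simps)
  qed
  define u where "u = s (m + 3)"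
  have t4: "t4 (m + 3) = input_tape u" "t4 (m + 4) = input_tape []"
    using t1(8)[of "m + 3"] t1(8)[of "m + 4"] s(3) by (simp_all add: t4_def t3_def t2_def u_def)
  have cb4: "confined (b + length z) (t4 j)" if "j < m" for j
  proof (cases "j = 0")
    case True
    then show ?thesis using confined_funpow[OF cb1[of 0], where f = "\<lambda>_. (Blank, Right)" and n = "length z"] m
      by (simp add: t4_def t3_def t2_def del: act.simps)
  next
    case False
    then show ?thesis using confined_mono[OF cb1[OF that]] that by (simp add: t4_def t3_def t2_def)
  qed
  have lu: "b + length z < length u" using w lz by (simp add: u_def b_def)
  let ?L = "\<lambda>\<tau>. ((\<lambda>\<tau>. act (\<tau> 0, Left) \<tau>) ^^ length u) \<tau>"
  let ?E = "\<lambda>\<tau>. ((\<lambda>\<tau>. act (Blank, Right) \<tau>) ^^ length u) \<tau>"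
  define t5 where "t5 = (\<lambda>j. if j < m then ?L (t4 j) else if j = m + 3 then input_tape []
    else if j = m + 4 then input_tape (rev u) else t4 j)"
  define t6 where "t6 = (\<lambda>j. if j < m then ?E (t5 j) else if j = m + 3 then input_tape u
    else if j = m + 4 then input_tape [] else t5 j)"
  define t7 where "t7 = (\<lambda>j. if j < m then ?E (t6 j) else if j = m + 3 then input_tape []
    else if j = m + 4 then input_tape (rev u) else t6 j)"
  have S5: "stops (?mvl (m + 3) {m + 4} (sweep_left m)) (tv W t4) (5 * length u) (tv W t5)"
  proof -
    have "stops (?mvl (m + 3) {m + 4} (sweep_left m)) (tv W t4) (5 * length u) (tv W (\<lambda>j. if j \<in> {m + 4}
        then input_tape (rev u @ []) else if j = m + 3 then input_tape []
        else ((\<lambda>\<tau>. act (sweep_left m j (\<tau> 0)) \<tau>) ^^ length u) (t4 j)))"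
      by (rule stops_mvloop) (use t4 in \<open>auto simp: W_def sweep_left_def\<close>)
    then show ?thesis
      by (rule stops_cong)
        (auto intro!: tv_cong simp: t5_def sweep_left_def funpow_Stay simp del: act.simps act_Stay)
  qed
  have S6: "stops (?mvl (m + 4) {m + 3} (sweep_erase m)) (tv W t5) (5 * length u) (tv W t6)"
  proof -
    have "stops (?mvl (m + 4) {m + 3} (sweep_erase m)) (tv W t5) (5 * length (rev u)) (tv W (\<lambda>j. if j \<in> {m + 3}
        then input_tape (rev (rev u) @ []) else if j = m + 4 then input_tape []
        else ((\<lambda>\<tau>. act (sweep_erase m j (\<tau> 0)) \<tau>) ^^ length (rev u)) (t5 j)))"
      by (rule stops_mvloop) (auto simp: W_def sweep_erase_def t5_def)
    then show ?thesis
      by (rule stops_cong)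
        (auto intro!: tv_cong simp: t6_def sweep_erase_def funpow_Stay simp del: act.simps act_Stay)
  qed
  have S7: "stops (?mvl (m + 3) {m + 4} (sweep_erase m)) (tv W t6) (5 * length u) (tv W t7)"
  proof -
    have "stops (?mvl (m + 3) {m + 4} (sweep_erase m)) (tv W t6) (5 * length u) (tv W (\<lambda>j. if j \<in> {m + 4}
        then input_tape (rev u @ []) else if j = m + 3 then input_tape []
        else ((\<lambda>\<tau>. act (sweep_erase m j (\<tau> 0)) \<tau>) ^^ length u) (t6 j)))"
      by (rule stops_mvloop) (auto simp: W_def sweep_erase_def t6_def)
    then show ?thesis
      by (rule stops_cong)
        (auto intro!: tv_cong simp: t7_def sweep_erase_def funpow_Stay simp del: act.simps act_Stay)
  qed
  define s' where "s' = (\<lambda>j. if j = Suc m then fl' else if j = Suc (Suc m) then rev z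
    else if j = m + 4 then rev u else [])"
  have t7: "tv W t7 = tp W s'"
    unfolding tp_def
  proof (rule tv_cong)
    fix j assume "j < W"
    then consider "j < m" | "j = m" | "j = Suc m" | "j = Suc (Suc m)" | "j = m + 3" | "j = m + 4"
      unfolding W_def by linarith
    then show "t7 j = input_tape (s' j)"
    proof cases
      case 1
      then have "t7 j = ?E (?E (?L (t4 j)))" by (simp add: t7_def t6_def t5_def del: act.simps)
      also have "\<dots> = input_tape []" using cb4[OF 1] lu by (rule sweep_erases)
      finally show ?thesis using 1 by (simp add: s'_def)
    qed (use m in \<open>simp_all add: t7_def t6_def t5_def t4_def t3_def t2_def s'_def del: act.simps\<close>)
  qed
  have vol: "vol W s = b + length u"
    using s by (simp add: W_def b_def u_def vol_def eval_nat_numeral)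
  have gs: "good W (timed m W M)" "good W (?mvl i js ?st)" "good W ?X" "good W (opm W ?o)"
    "good W (?mvl i js (sweep_left m))" "good W (?mvl i js (sweep_erase m))" if "i < W" for i js
    using that g m by (intro good_timed good_loop good_mv good_opm;
      auto simp: W_def sweep_left_def sweep_erase_def)+
  have lt: "m < W" "m + 3 < W" "m + 4 < W" by (simp_all add: W_def)
  have "stops (core m M) (tp W s) (length (s m) + 1 + (5 * length (s m) + (5 * Suc b + (1 + (5 * length u
      + (5 * length u + 5 * length u + 1) + 1) + 1) + 1) + 1) + 1) (tp W s')"
    unfolding core_def Let_def W_def[symmetric] t7[symmetric]
    by (intro stops_seq[where W = W, OF _ _ _ S1] stops_seq[where W = W, OF _ _ _ S2] stops_seq[where W = W, OF _ _ _ S3] stops_seq[where W = W, OF _ _ _ S4]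
        stops_seq[where W = W, OF _ _ _ S5] stops_seq[where W = W, OF _ _ _ S6 S7] good_seq gs[OF lt(1)] gs[OF lt(2)] gs[OF lt(3)]) auto
  moreover have "length (s m) + 1 + (5 * length (s m) + (5 * Suc b + (1 + (5 * length u
      + (5 * length u + 5 * length u + 1) + 1) + 1) + 1) + 1) + 1 \<le> 40 * vol W s + 40"
    unfolding vol by (simp add: b_def)
  ultimately have "stops (core m M) (tp (m + 5) s) (40 * vol (m + 5) s + 40) (tp (m + 5) s')"
    unfolding W_def by (rule stops_mono)
  moreover have "case if halted M c' then tape_output (hd (snd c')) else None of
         None \<Rightarrow> s' (Suc m) = [] | Some y \<Rightarrow> s' (Suc m) = [True] \<and> s' (Suc (Suc m)) = rev y"
  proof (cases "halted M c'")
    case True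
    then have z: "z = y" "fl = [True]" by (simp_all add: z_def fl_def)
    have "t3 0 0 = t2 0 (int (length y))" unfolding t3_def z by (simp add: nth_extract del: act.simps)
    then show ?thesis using True z bit_prefix_holds[OF y(1)]
      by (auto simp: s'_def fl'_def hd tape_output_eq_Some tape_output_eq_None split: option.split)
  next
    case False
    then show ?thesis by (simp add: s'_def fl'_def fl_def)
  qed
  moreover have "(\<forall>j\<le>m. s' j = []) \<and> s' (m + 3) = []" by (simp add: s'_def)
  ultimately show ?thesis by blast
qed

section \<open>Clocked calls as functions of strings\<close>

lemma halts_within_run:
  "halts_within M xs k \<Longrightarrow> k \<le> n \<Longrightarrow> run M xs n = run M xs k"
  unfolding halts_within_def run_def
  using funpow_step_halted[of M "(step M ^^ k) (init M xs)" "n - k"]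
  by (metis comp_apply funpow_add le_add_diff_inverse2)

lemma halts_within_mono: "halts_within M xs k \<Longrightarrow> k \<le> n \<Longrightarrow> halts_within M xs n"
  using halts_within_run[of M xs k n] unfolding halts_within_def by simp

lemma result_eq_result_within:
  assumes "halts_within M xs k" shows "result M xs = result_within M xs k"
proof -
  let ?l = "LEAST k. halts_within M xs k"
  have "halts_within M xs ?l" "?l \<le> k" using assms by (auto intro: LeastI Least_le)
  then have "run M xs k = run M xs ?l" by (rule halts_within_run)
  then show ?thesis
    using assms \<open>halts_within M xs ?l\<close> by (auto simp: result_def result_within_def)
qed

text \<open>Options as strings: the empty string stands for no output, a leading \<open>True\<close>
  for an output, which may itself be empty. Of the clock only the length counts.\<close>

definition call :: "tm \<Rightarrow> bool list list \<Rightarrow> bool list \<Rightarrow> bool list" where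
  "call M xs c = (case result_within M xs (length c) of None \<Rightarrow> [] | Some y \<Rightarrow> True # y)"

lemma init_eq_tp:
  assumes "length xs = k" "k \<le> tapes M"
  shows "init M xs = (0, tp (tapes M) (\<lambda>i. if i < k then xs ! i else []))"
  unfolding init_def tp_def tv_def using assms by (auto simp: list_eq_iff_nth_eq nth_append)

lemma ptr_core:
  assumes "wf_tm M" "m = tapes M"
  obtains F where
    "ptr (m + 5) (\<lambda>s. s (Suc m) = [] \<and> s (Suc (Suc m)) = [] \<and> s (m + 4) = []
       \<and> 2 * (vol m s + length (s m)) + 2 \<le> length (s (m + 3))) F"
    "\<And>s. s (Suc m) = [] \<Longrightarrow> s (Suc (Suc m)) = [] \<Longrightarrow> s (m + 4) = [] \<Longrightarrow>
       2 * (vol m s + length (s m)) + 2 \<le> length (s (m + 3)) \<Longrightarrow>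
       F s 0 = (case if halted M ((step M ^^ length (s m)) (0, tp m s))
           then tape_output (hd (snd ((step M ^^ length (s m)) (0, tp m s)))) else None of
         None \<Rightarrow> [] | Some y \<Rightarrow> True # y)"
proof -
  have g: "good m M" using wf_tm_good[OF assms(1)] assms(2) by simp
  have m: "0 < m" using assms by (simp add: wf_tm_def)
  let ?P = "\<lambda>s. s (Suc m) = [] \<and> s (Suc (Suc m)) = [] \<and> s (m + 4) = []
       \<and> 2 * (vol m s + length (s m)) + 2 \<le> length (s (m + 3))"
  let ?out = "\<lambda>s. if halted M ((step M ^^ length (s m)) (0, tp m s))
           then tape_output (hd (snd ((step M ^^ length (s m)) (0, tp m s)))) else None"
  let ?R = "\<lambda>s s'. stops (core m M) (tp (m + 5) s) (40 * vol (m + 5) s + 40) (tp (m + 5) s')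
    \<and> (\<forall>j\<le>m. s' j = []) \<and> s' (m + 3) = []
    \<and> (case ?out s of None \<Rightarrow> s' (Suc m) = []
       | Some y \<Rightarrow> s' (Suc m) = [True] \<and> s' (Suc (Suc m)) = rev y)"
  \<comment> \<open>\<open>stops_core\<close> does not determine the contents of every tape, so the
    final stacks are chosen.\<close>
  define F where "F = (\<lambda>s. SOME s'. ?R s s')"
  have F: "?R s (F s)" if "?P s" for s
  proof -
    have "\<exists>s'. ?R s s'" by (rule stops_core[OF g m]) (use that in auto)
    then show ?thesis unfolding F_def by (rule someI_ex[where P = "?R s"])
  qed
  have pF: "ptr (m + 5) ?P F"
    by (rule ptrI[OF good_core[OF g m], where T = "[:40, 40:]"]) (use F in \<open>simp add: algebra_simps\<close>)
  \<comment> \<open>After a failure tape \<open>m + 2\<close> may hold debris and is cleared first.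
    Then the output, which lies there reversed, and after it the flag are moved to tape 0 and form
    \<open>True # y\<close>.\<close>
  let ?f1 = "\<lambda>s. if s (Suc m) = [] then s(Suc (Suc m) := []) else s"
  let ?f2 = "\<lambda>s j. if j \<in> {0} then rev (s (Suc (Suc m))) @ s j else if j = Suc (Suc m) then [] else s j"
  let ?f3 = "\<lambda>s j. if j \<in> {0} then rev (s (Suc m)) @ s j else if j = Suc m then [] else s j"
  have p1: "ptr (m + 5) (\<lambda>_. True) ?f1"
    by (rule ptr_branch[where c = "\<lambda>ss. ss ! Suc m = Blank"]) (auto intro: ptr_clear ptr_id)
  have p2: "ptr (m + 5) (\<lambda>_. True) ?f2" by (rule ptr_revmove) auto
  have p3: "ptr (m + 5) (\<lambda>_. True) ?f3" by (rule ptr_revmove) auto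
  have p: "ptr (m + 5) ?P (\<lambda>s. ?f3 (?f2 (?f1 (F s))))"
    by (rule ptr_seq[OF ptr_seq[OF ptr_seq[OF pF p1] p2] p3]) auto
  show thesis
  proof (rule that[OF p])
    fix s assume "s (Suc m) = []" "s (Suc (Suc m)) = []" "s (m + 4) = []"
       "2 * (vol m s + length (s m)) + 2 \<le> length (s (m + 3))"
    then have "?R s (F s)" using F[of s] by blast
    then have "F s 0 = []" "case ?out s of None \<Rightarrow> F s (Suc m) = []
       | Some y \<Rightarrow> F s (Suc m) = [True] \<and> F s (Suc (Suc m)) = rev y" using m by blast+
    then show "?f3 (?f2 (?f1 (F s))) 0 = (case ?out s of None \<Rightarrow> [] | Some y \<Rightarrow> True # y)"
      by (cases "?out s") auto
  qed
qed

lemma fpn_sum: "(\<And>i. i < n \<Longrightarrow> fpn k (f i)) \<Longrightarrow> fpn k (\<lambda>e. \<Sum>i<n. f i e)" for n :: nat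
  by (induction n) (auto intro: fpn_const fpn_add)

lemma fp_call:
  assumes M: "wf_tm M" "k \<le> tapes M"
  shows "fp (Suc k) (\<lambda>e. call M (map e [0..<k]) (e k))"
proof -
  define m where "m = tapes M"
  let ?c = "\<lambda>s. (step M ^^ length (s m)) (0, tp m s)"
  let ?out = "\<lambda>s. if halted M (?c s) then tape_output (hd (snd (?c s))) else None"
  let ?P = "\<lambda>s. s (Suc m) = [] \<and> s (Suc (Suc m)) = [] \<and> s (m + 4) = []
       \<and> 2 * (vol m s + length (s m)) + 2 \<le> length (s (m + 3))"
  obtain F where F: "ptr (m + 5) ?P F"
    "\<And>s. ?P s \<Longrightarrow> F s 0 = (case ?out s of None \<Rightarrow> [] | Some y \<Rightarrow> True # y)"
    by (rule ptr_core[OF M(1) m_def]) (rule that, assumption, blast)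
  \<comment> \<open>The counter length that \<open>stops_core\<close> asks for; the sum includes the
    clock \<open>e k\<close>.\<close>
  let ?n = "\<lambda>e. 2 * (\<Sum>i<Suc k. length (e i)) + 2"
  define h where "h = (\<lambda>i e. if i < k then e i else if i = m then e k else if i = m + 3 then unary (?n e) else [])"
  let ?arg = "\<lambda>e i. if i < m + 5 then h i e else []"
  have "fpn (Suc k) ?n" by (intro fpn_add fpn_mult fpn_const fpn_sum fpn_length fp_proj) auto
  then have "fp (Suc k) (\<lambda>e. unary (?n e))" by (rule fp_unary)
  moreover have "h i = (if i < k then (\<lambda>e. e i) else if i = m then (\<lambda>e. e k)
      else if i = m + 3 then (\<lambda>e. unary (?n e)) else (\<lambda>_. []))" for i
    by (auto simp: h_def fun_eq_iff)
  ultimately have fph: "fp (Suc k) (h i)" for i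
    using fp_proj[of i "Suc k"] fp_proj[of k "Suc k"] fp_nil[of "Suc k"] by (simp only: split: if_split) auto
  have volm: "vol m (?arg e) = (\<Sum>i<k. length (e i))" for e
  proof -
    have "vol m (?arg e) = vol k (?arg e)"
      unfolding vol_def using M(2) by (intro sum.mono_neutral_right) (auto simp: h_def m_def)
    also have "\<dots> = (\<Sum>i<k. length (e i))"
      unfolding vol_def using M(2) by (intro sum.cong) (auto simp: h_def m_def)
    finally show ?thesis .
  qed
  have argm: "?arg e m = e k" for e using M(2) by (simp add: h_def m_def)
  have P: "?P (?arg e)" for e
    unfolding volm argm using M(2) by (simp add: h_def m_def)
  have "fp (Suc k) (\<lambda>e. F (?arg e) 0)"
    by (rule fp_via[OF _ F(1)]) (use fph P in auto)
  moreover have "F (?arg e) 0 = call M (map e [0..<k]) (e k)" for e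
  proof -
    have "tp m (?arg e) = tp m (\<lambda>i. if i < k then map e [0..<k] ! i else [])"
      using M(2) by (intro tp_cong) (auto simp: h_def m_def)
    then have "?c (?arg e) = run M (map e [0..<k]) (length (e k))"
      unfolding run_def argm using init_eq_tp[of "map e [0..<k]" k M] M(2) by (simp add: m_def)
    then show ?thesis
      unfolding F(2)[OF P] by (simp add: call_def result_within_def halts_within_def)
  qed
  ultimately show ?thesis by simp
qed

section \<open>Back to Turing machines\<close>

lemma fp_computes:
  assumes "fp k g"
  obtains M T where "wf_tm M" "tapes M > k" "\<And>xs. length xs = k \<Longrightarrow>
    halts_within M xs (poly T (input_size xs)) \<and> result M xs = Some (g (\<lambda>i. if i < k then xs ! i else []))"
proof -
  obtain W0 where W0: "\<And>W. W \<ge> W0 \<Longrightarrow> ptr W (\<lambda>s. s k = [] \<and> (\<forall>i\<ge>Suc k. s i = []))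
      (\<lambda>s. s(k := g (\<lambda>i. if i < k then s i else [])))"
    using fp_at[OF assms inj_on_id2[of "{..<k}"], of "Suc k" k] by auto
  define W where "W = max W0 (k + 2)"
  let ?P = "\<lambda>s :: stacks. \<forall>i\<ge>k. s i = []"
  let ?g = "\<lambda>s. g (\<lambda>i. if i < k then s i else [])"
  have 0: "ptr W ?P (\<lambda>s. s(k := ?g s))"
    by (rule ptr_pre[OF W0]) (auto simp: W_def)
  \<comment> \<open>\<open>result\<close> reads the first tape, so the arguments are erased and the
    value is moved there.\<close>
  have "ptr W ?P (\<lambda>s. (\<lambda>s j. if j \<in> {..<k} then [] else s j) (s(k := ?g s)))"
    by (rule ptr_seq[OF 0 ptr_clears, where P' = "\<lambda>_. True"]) (auto simp: W_def)
  then have 1: "ptr W ?P (\<lambda>s j. if j = k then ?g s else [])"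
    by (rule ptr_cong) auto
  have "ptr W ?P (\<lambda>s j. if j = 0 then ?g s else [])"
  proof (cases "k = 0")
    case False
    have "ptr W ?P (\<lambda>s. (\<lambda>s. s(k := [], 0 := s k @ s 0)) (\<lambda>j. if j = k then ?g s else []))"
      by (rule ptr_seq[OF 1 ptr_move[where t = "k + 1" and P = "\<lambda>s. s (k + 1) = []"]])
        (use False in \<open>auto simp: W_def\<close>)
    then show ?thesis by (rule ptr_cong) (use False in auto)
  qed (use 1 in simp)
  then obtain M0 T where M0: "good W M0"
    "\<And>s. ?P s \<Longrightarrow> stops M0 (tp W s) (poly T (vol W s)) (tp W (\<lambda>j. if j = 0 then ?g s else []))"
    by (rule ptrE) blast
  obtain M where M: "wf_tm M" "tapes M = W" "\<And>\<tau>s T \<tau>s'. stops M0 \<tau>s T \<tau>s' \<Longrightarrow> length \<tau>s = W \<Longrightarrow>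
           (\<And>\<tau>. \<tau> \<in> set \<tau>s \<Longrightarrow> range \<tau> \<subseteq> bits_and_blank) \<Longrightarrow> stops M \<tau>s T \<tau>s'"
    by (rule good_imp_wf_tm[OF M0(1)]) (auto simp: W_def)
  show thesis
  proof (rule that)
    show "wf_tm M" "tapes M > k" using M by (simp_all add: W_def)
    fix xs :: "bool list list"
    assume xs: "length xs = k"
    define s where "s = (\<lambda>i. if i < k then xs ! i else [])"
    have i: "init M xs = (0, tp W s)" using init_eq_tp[OF xs, of M] M(2) by (simp add: s_def W_def)
    have "vol W s = vol k s"
      unfolding vol_def by (intro sum.mono_neutral_right) (auto simp: s_def W_def)
    also have "\<dots> = input_size xs"
      by (simp add: vol_def s_def input_size_def sum_list_sum_nth xs atLeast0LessThan)
    finally have v: "vol W s = input_size xs" .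
    have gs: "?g s = g s" by (rule arg_cong[of _ _ g]) (auto simp: s_def)
    have "range \<tau> \<subseteq> bits_and_blank" if "\<tau> \<in> set (tp W s)" for \<tau>
    proof -
      have "range (input_tape x) \<subseteq> bits_and_blank" for x
      proof -
        have "Bit b \<in> bits_and_blank" for b by (cases b) auto
        then show ?thesis by (auto simp: input_tape_def simp del: insert_iff)
      qed
      then show ?thesis using that by (auto simp only: tp_def tv_def set_map)
    qed
    moreover have "?P s" by (simp add: s_def)
    ultimately have "stops M (tp W s) (poly T (vol W s)) (tp W (\<lambda>j. if j = 0 then ?g s else []))"
      by (intro M(3) M0(2)) auto
    then obtain n q where n: "n \<le> poly T (input_size xs)"
      "reaches M (0, tp W s) n (q, tp W (\<lambda>j. if j = 0 then g s else []))"
      "delta M (q, scanned (tp W (\<lambda>j. if j = 0 then g s else []))) = None"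
      unfolding stops_def v gs by blast
    have r: "run M xs n = (q, tp W (\<lambda>j. if j = 0 then g s else []))"
      unfolding run_def i by (rule reaches_steps) (rule n)
    have h: "halts_within M xs n" using n(3) r by (simp add: halts_within_def halted_def)
    have "0 < W" by (simp add: W_def)
    then have "hd (snd (run M xs n)) = input_tape (g s)"
      unfolding r by (simp add: tp_def tv_def hd_map)
    then have "result M xs = Some (g s)"
      unfolding result_eq_result_within[OF h] result_within_def
      using h holds_string_input_tape by (simp add: tape_output_eq_Some)
    then show "halts_within M xs (poly T (input_size xs))
        \<and> result M xs = Some (g (\<lambda>i. if i < k then xs ! i else []))"
      using halts_within_mono[OF h n(1)] by (simp add: s_def)
  qed
qed

lemma fp_poly_time_computable: "fp 1 (\<lambda>e. f (e 0)) \<Longrightarrow> poly_time_computable f"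
proof -
  assume "fp 1 (\<lambda>e. f (e 0))"
  then obtain M T where M: "wf_tm M" "tapes M > 1" "\<And>xs. length xs = 1 \<Longrightarrow>
      halts_within M xs (poly T (input_size xs)) \<and> result M xs = Some (f (if 0 < (1::nat) then xs ! 0 else []))"
    by (rule fp_computes) (rule that)
  have "halts_within M [x] (poly T (length x)) \<and> result M [x] = Some (f x)" for x
    using M(3)[of "[x]"] by (simp add: input_size_def)
  then show ?thesis unfolding poly_time_computable_def using M(1) by blast
qed

text \<open>A machine enters the class through a call with its own time bound as the clock;
  \<open>tl\<close> removes the success mark.\<close>

lemma poly_time_computable_fp:
  assumes "poly_time_computable f" shows "fp 1 (\<lambda>e. f (e 0))"
proof -
  obtain M T where M: "wf_tm M" "\<And>x. halts_within M [x] (poly T (length x)) \<and> result M [x] = Some (f x)"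
    using assms unfolding poly_time_computable_def by blast
  have "fp 1 (\<lambda>e. tl (call M [e 0] (unary (poly T (length (e 0))))))"
  proof (rule fp_tl, rule fp_comp2[where f = "\<lambda>x c. call M [x] c"])
    show "fp 2 (\<lambda>e. call M [e 0] (e 1))"
      using fp_call[of M 1] M(1) by (simp add: wf_tm_def numeral_2_eq_2)
    show "fp 1 (\<lambda>e. e 0)" "fp 1 (\<lambda>e. unary (poly T (length (e 0))))"
      by (intro fp_unary fpn_poly fpn_length fp_proj; simp)+
  qed
  moreover have "tl (call M [x] (unary (poly T (length x)))) = f x" for x
  proof -
    have "result_within M [x] (poly T (length x)) = Some (f x)"
      using M(2)[of x] result_eq_result_within[of M "[x]" "poly T (length x)"] by simp
    then show ?thesis by (simp add: call_def)
  qed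
  ultimately show ?thesis by simp
qed

lemma fp_ppt:
  assumes "fp (Suc m) h"
  obtains A where "\<And>\<rho>. ppt m A \<rho>"
    "\<And>xs r. length xs = m \<Longrightarrow> result A (xs @ [r]) = Some (h (\<lambda>i. if i < Suc m then (xs @ [r]) ! i else []))"
proof -
  obtain M T where M: "wf_tm M" "tapes M > Suc m" "\<And>xs. length xs = Suc m \<Longrightarrow>
      halts_within M xs (poly T (input_size xs)) \<and> result M xs = Some (h (\<lambda>i. if i < Suc m then xs ! i else []))"
    using fp_computes[OF assms] by metis
  show thesis
  proof (rule that)
    fix \<rho> :: "nat poly"
    \<comment> \<open>The machine also reads \<open>r\<close>, so its bound is taken at the input
      size plus the length of \<open>r\<close>.\<close>
    have "halts_within M (xs @ [r]) (poly (pcompose T ([:0, 1:] + \<rho>)) (input_size xs))"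
      if "length xs = m" "length r = poly \<rho> (input_size xs)" for xs r
      using M(3)[of "xs @ [r]"] that by (simp add: poly_pcompose input_size_def)
    then show "ppt m M \<rho>" unfolding ppt_def using M(1,2) by auto
  qed (use M(3) in simp)
qed

section \<open>Further polynomial-time functions\<close>

lemma fp_weaken: "fp k g \<Longrightarrow> k \<le> l \<Longrightarrow> fp l (\<lambda>e. g (\<lambda>i. if i < k then e i else []))"
  by (rule fp_comp) (auto intro: fp_proj)

text \<open>Recursion on notation descends along one string only, so the strings are compared
  position by position, a nonempty accumulator recording a mismatch. Lengths are compared
  separately, since \<open>starts_True\<close> cannot tell a missing bit from
  \<open>False\<close>.\<close>

lemma fpb_eq: assumes "fp k x" "fp k y" shows "fpb k (\<lambda>e. x e = y e)"
proof -
  let ?d = "\<lambda>i x y. starts_True (drop i x) = starts_True (drop i y)"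
  define h where "h = (\<lambda>e :: stacks. if e 3 = [] \<and> ?d (length (e 2)) (e 0) (e 1) then [] else [True] :: bool list)"
  have "fp (2 + 2) h" unfolding h_def
    by (intro fp_if fpb_and fpb_Nil fpb_iff fpb_starts_True fp_drop fpn_length fp_const fp_proj) auto
  then have i: "fp 2 (\<lambda>e. iter (\<lambda>i a. h (e(2 := unary i, Suc 2 := a))) [] (length (e 0)))"
  proof (rule fp_iter_small[where c = 1])
    show "fpn 2 (\<lambda>e. length (e 0))" by (intro fpn_length fp_proj) simp
  qed (auto intro: fp_nil simp: h_def)
  have it: "iter (\<lambda>i a. h (e(2 := unary i, Suc 2 := a))) [] n = [] \<longleftrightarrow> (\<forall>i<n. ?d i (e 0) (e 1))" for e n
    by (induction n) (auto simp: h_def less_Suc_eq)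
  have "fpb 2 (\<lambda>e. length (e 0) = length (e 1) \<and> iter (\<lambda>i a. h (e(2 := unary i, Suc 2 := a))) [] (length (e 0)) = [])"
    by (intro fpb_and fpb_eq_nat fpn_length fpb_Nil i fp_proj) auto
  then have "fpb 2 (\<lambda>e. e 0 = e 1)"
  proof (rule fpb_cong)
    fix e :: stacks
    have "e 0 ! i = e 1 ! i" if "?d i (e 0) (e 1)" "i < length (e 0)" "length (e 0) = length (e 1)" for i
      using that by (auto simp: starts_True_def hd_drop_conv_nth)
    then show "(length (e 0) = length (e 1) \<and> iter (\<lambda>i a. h (e(2 := unary i, Suc 2 := a))) [] (length (e 0)) = [])
       = (e 0 = e 1)"
      unfolding it by (auto intro: nth_equalityI)
  qed
  then show ?thesis unfolding fpb_def
    by (rule fp_comp2[where f = "\<lambda>x y. if x = y then [True] else []"]) (use assms in auto)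
qed

text \<open>The empty string means no hit. Search functions therefore mark their hits by a leading
  \<open>True\<close>.\<close>

definition first_hit :: "(nat \<Rightarrow> 'a list) \<Rightarrow> nat \<Rightarrow> 'a list" where
  "first_hit g n = iter (\<lambda>i a. if a = [] then g i else a) [] n"

lemma first_hit_0 [simp]: "first_hit g 0 = []"
  and first_hit_Suc: "first_hit g (Suc n) = (if first_hit g n = [] then g n else first_hit g n)"
  by (simp_all add: first_hit_def)

lemma first_hit_eq_Nil: "first_hit g n = [] \<longleftrightarrow> (\<forall>i<n. g i = [])"
  by (induction n) (auto simp: first_hit_Suc less_Suc_eq)

lemma first_hit_eq: "i < n \<Longrightarrow> g i \<noteq> [] \<Longrightarrow> (\<And>j. j < i \<Longrightarrow> g j = []) \<Longrightarrow> first_hit g n = g i"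
proof (induction n)
  case (Suc n)
  show ?case
  proof (cases "i < n")
    case True
    then show ?thesis using Suc by (simp add: first_hit_Suc)
  next
    case False
    then have "i = n" using Suc by simp
    then show ?thesis using Suc by (auto simp: first_hit_Suc first_hit_eq_Nil)
  qed
qed simp

lemma first_hit_cases: "first_hit g n = [] \<or> (\<exists>i<n. first_hit g n = g i)"
  by (induction n) (auto simp: first_hit_Suc less_Suc_eq)

lemma vol_upd: "(\<forall>i\<ge>k. e i = []) \<Longrightarrow> vol (Suc k) (e(k := x)) = vol k e + length x"
  by (simp add: vol_def)

text \<open>The accumulator is empty or a single value of \<open>h\<close>, so a length bound for
  \<open>h\<close> bounds all stages of the iteration.\<close>

lemma fp_first_hit:
  assumes h: "fp (Suc k) h" and n: "fpn k n"
  shows "fp k (\<lambda>e. first_hit (\<lambda>i. h (e(k := unary i))) (n e))"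
proof -
  define h' where "h' = (\<lambda>e. if e (Suc k) = [] then h (\<lambda>i. if i < Suc k then e i else []) else e (Suc k))"
  have h': "h' (e(k := unary i, Suc k := a)) = (if a = [] then h (e(k := unary i)) else a)"
    if "\<forall>i\<ge>k. e i = []" for e i a
  proof -
    have "(\<lambda>j. if j < Suc k then (e(k := unary i, Suc k := a)) j else []) = e(k := unary i)"
      using that by (auto simp: fun_eq_iff)
    then show ?thesis unfolding h'_def by simp
  qed
  have "fp (k + 2) h'" unfolding h'_def
    by (intro fp_if_Nil fp_weaken[OF h] fp_proj) auto
  obtain T where T: "\<And>e. (\<forall>i\<ge>Suc k. e i = []) \<Longrightarrow> length (h e) \<le> poly T (vol (Suc k) e)"
    by (rule fp_length[OF h]) auto
  have "fp k (\<lambda>e. iter (\<lambda>i a. h' (e(k := unary i, Suc k := a))) [] (n e))"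
  proof (rule fp_iter[OF \<open>fp (k + 2) h'\<close> fp_nil n, where T = T])
    fix e :: stacks and m
    assume e: "\<forall>i\<ge>k. e i = []"
    have "length (h (e(k := unary i))) \<le> poly T (m + vol k e)" if "i < m" for i
      using T[of "e(k := unary i)"] e poly_mono_nat[of "vol k e + i" "m + vol k e" T] that
      by (simp add: vol_upd)
    then show "length (iter (\<lambda>i a. h' (e(k := unary i, Suc k := a))) [] m) \<le> poly T (m + vol k e)"
      unfolding h'[OF e] first_hit_def[symmetric]
      using first_hit_cases[of "\<lambda>i. h (e(k := unary i))" m] by auto
  qed
  then show ?thesis by (rule fp_cong) (simp add: h' first_hit_def)
qed

lemma iter_append: "iter (\<lambda>i a. a @ g i) [] n = concat (map g [0..<n])"
  by (induction n) auto

lemma fp_concat: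
  assumes h: "fp (Suc k) h" and n: "fpn k n"
  shows "fp k (\<lambda>e. concat (map (\<lambda>i. h (e(k := unary i))) [0..<n e]))"
proof -
  define h' where "h' = (\<lambda>e. e (Suc k) @ h (\<lambda>i. if i < Suc k then e i else []))"
  have h': "h' (e(k := unary i, Suc k := a)) = a @ h (e(k := unary i))"
    if "\<forall>i\<ge>k. e i = []" for e i a
  proof -
    have "(\<lambda>j. if j < Suc k then (e(k := unary i, Suc k := a)) j else []) = e(k := unary i)"
      using that by (auto simp: fun_eq_iff)
    then show ?thesis unfolding h'_def by simp
  qed
  have "fp (k + 2) h'" unfolding h'_def
    by (intro fp_append fp_weaken[OF h] fp_proj) auto
  obtain T where T: "\<And>e. (\<forall>i\<ge>Suc k. e i = []) \<Longrightarrow> length (h e) \<le> poly T (vol (Suc k) e)"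
    by (rule fp_length[OF h]) auto
  have "fp k (\<lambda>e. iter (\<lambda>i a. h' (e(k := unary i, Suc k := a))) [] (n e))"
  proof (rule fp_iter[OF \<open>fp (k + 2) h'\<close> fp_nil n, where T = "[:0, 1:] * T"])
    fix e :: stacks and m
    assume e: "\<forall>i\<ge>k. e i = []"
    have *: "length (h (e(k := unary i))) \<le> poly T (m + vol k e)" if "i < m" for i
      using T[of "e(k := unary i)"] e poly_mono_nat[of "vol k e + i" "m + vol k e" T] that
      by (simp add: vol_upd)
    have "length (concat (map (\<lambda>i. h (e(k := unary i))) [0..<m])) = (\<Sum>i<m. length (h (e(k := unary i))))"
      by (simp add: length_concat o_def interv_sum_list_conv_sum_set_nat atLeast0LessThan)
    also have "\<dots> \<le> of_nat (card {..<m}) * poly T (m + vol k e)"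
      by (rule sum_bounded_above) (use * in auto)
    also have "\<dots> \<le> poly ([:0, 1:] * T) (m + vol k e)" by (simp add: mult_right_mono)
    finally show "length (iter (\<lambda>i a. h' (e(k := unary i, Suc k := a))) [] m) \<le> poly ([:0, 1:] * T) (m + vol k e)"
      unfolding h'[OF e] iter_append .
  qed
  then show ?thesis by (rule fp_cong) (simp add: h' iter_append)
qed

lemma concat_unary: "concat (map (\<lambda>i. unary (f i)) [0..<n]) = unary (\<Sum>i<n. f i)"
  by (induction n) (auto simp: replicate_add[symmetric] add.commute)

lemma fpn_comp1: "fpn 1 (\<lambda>e. f (length (e 0))) \<Longrightarrow> fpn k n \<Longrightarrow> fpn k (\<lambda>e. f (n e))"
  unfolding fpn_def using fp_comp1[of "\<lambda>x. unary (f (length x))" k "\<lambda>e. unary (n e)"] by simp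

lemma fpn_sum_upto:
  assumes "fpn 1 (\<lambda>e. f (length (e 0)))" shows "fpn 1 (\<lambda>e. \<Sum>i<length (e 0). f i)"
proof -
  have "fp (Suc 1) (\<lambda>e. unary (f (length (e 1))))"
    by (intro fp_unary fpn_comp1[where f = f, OF assms] fpn_length fp_proj) simp
  from fp_concat[OF this, of "\<lambda>e. length (e 0)"]
  have "fp 1 (\<lambda>e. concat (map (\<lambda>i. unary (f i)) [0..<length (e 0)]))"
    by (simp add: fpn_length fp_proj)
  then show ?thesis unfolding concat_unary by (simp add: fpn_def)
qed

section \<open>Binary numerals\<close>

fun inc :: "bool list \<Rightarrow> bool list" where
  "inc [] = [True]"
| "inc (True # w) = False # inc w"
| "inc (False # w) = True # w"

lemma length_inc: "length (inc w) \<le> length w + 1"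
  by (induction w rule: inc.induct) auto

lemma bits_of_nat_Suc: "bits_of_nat (Suc n) = inc (bits_of_nat n)"
proof (induction n rule: less_induct)
  case (less n)
  show ?case
  proof (cases "n = 0")
    case True
    then show ?thesis by (simp add: bits_of_nat.simps)
  next
    case False
    show ?thesis
    proof (cases "even n")
      case True
      then have "Suc n div 2 = n div 2" by simp
      then show ?thesis using False True by (simp add: bits_of_nat.simps[of n] bits_of_nat.simps[of "Suc n"])
    next
      case odd: False
      then have "Suc n div 2 = Suc (n div 2)" by simp
      moreover have "n div 2 < n" using False by simp
      ultimately show ?thesis using False odd less[of "n div 2"]
        by (simp add: bits_of_nat.simps[of n] bits_of_nat.simps[of "Suc n"])
    qed
  qed
qed

lemma bits_of_nat_0 [simp]: "bits_of_nat 0 = []"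
  by (simp add: bits_of_nat.simps)

text \<open>Counts up n times in binary, which is polynomial because n is given in unary.\<close>

lemma fp_bits_of_nat: assumes "fpn k n" shows "fp k (\<lambda>e. bits_of_nat (n e))"
proof -
  have "fp (0 + 1) (\<lambda>e. (\<lambda>x e. inc x) (e 0) (\<lambda>i. e (i + 1)))"
    by (rule fp_rec[where k = 0 and F = "\<lambda>x e. inc x" and G = "\<lambda>e. [True]" and BT = "\<lambda>e. False # e 1"
        and BF = "\<lambda>e. True # e 0" and T = "[:1, 1:]"]; (intro fp_proj fp_const fp_Cons)?;
        use length_inc in \<open>simp add: vol_def\<close>)
  then have inc: "fp 1 (\<lambda>e. inc (e 0))" by simp
  have "fp k (\<lambda>e. iter (\<lambda>i a. (\<lambda>e. inc (e (Suc k))) (e(k := unary i, Suc k := a))) ((\<lambda>e. []) e) (n e))"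
    by (rule fp_iter_small[where c = 1 and h = "\<lambda>e. inc (e (Suc k))"])
      (use assms length_inc in \<open>auto intro: fp_comp1[OF inc] fp_proj fp_nil\<close>)
  moreover have "iter (\<lambda>i. inc) [] n = bits_of_nat n" for n
    by (induction n) (simp_all add: bits_of_nat_Suc)
  ultimately show ?thesis by simp
qed

section \<open>Integer-valued polynomials\<close>

lemma degree_difference:
  fixes p :: "real poly" assumes "degree p > 0"
  shows "degree (pcompose p [:1, 1:] - p) < degree p"
proof -
  have d: "degree (pcompose p [:1, 1:]) = degree p" by (simp add: degree_pcompose)
  \<comment> \<open>Translation keeps the leading coefficient, so it cancels in the
    difference.\<close>
  have "lead_coeff (pcompose p [:1, 1:]) = lead_coeff p" by (subst lead_coeff_comp) auto
  then have "coeff (pcompose p [:1, 1:] - p) (degree p) = 0" by (simp add: d)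
  moreover have "degree (pcompose p [:1, 1:] - p) \<le> degree p" using degree_diff_le[of "pcompose p [:1, 1:]" "degree p" p] d by simp
  ultimately show ?thesis using assms
    by (metis bot_nat_0.not_eq_extremum degree_0 leading_coeff_0_iff le_neq_implies_less)
qed

text \<open>An integer-valued polynomial need not have integer coefficients; iterated differences reduce it
  to constants.\<close>

lemma fpn_integer_poly:
  fixes p :: "real poly"
  assumes "\<And>n. poly p (real n) \<in> \<int>"
  shows "\<exists>A B. fpn 1 (\<lambda>e. A (length (e 0))) \<and> fpn 1 (\<lambda>e. B (length (e 0)))
    \<and> (\<forall>n. poly p (real n) = real (A n) - real (B n))"
  using assms
proof (induction "degree p" arbitrary: p rule: less_induct)
  case less
  have "poly p 0 \<in> \<int>" using less(2)[of 0] by simp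
  then obtain c :: int where c: "poly p 0 = of_int c" by (auto elim: Ints_cases)
  show ?case
  proof (cases "degree p = 0")
    case True
    then obtain a where "p = [:a:]" by (auto elim: degree_eq_zeroE)
    then show ?thesis using c
      by (intro exI[of _ "\<lambda>_. nat c"] exI[of _ "\<lambda>_. nat (- c)"]) (auto intro: fpn_const)
  next
    case False
    define q where "q = pcompose p [:1, 1:] - p"
    have q: "poly q (real n) = poly p (real (Suc n)) - poly p (real n)" for n
      by (simp add: q_def poly_pcompose add.commute)
    then have "\<And>n. poly q (real n) \<in> \<int>" using less(2) by (metis Ints_diff)
    then obtain A B where AB: "fpn 1 (\<lambda>e. A (length (e 0)))" "fpn 1 (\<lambda>e. B (length (e 0)))"
      "\<And>n. poly q (real n) = real (A n) - real (B n)"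
      using less(1)[of q] degree_difference[of p] False unfolding q_def by blast
    \<comment> \<open>Summation recovers p from p(0) and its differences. Positive and negative
      parts are kept apart since only natural numbers are computed.\<close>
    have "poly p (real n) = of_int c + (\<Sum>i<n. real (A i) - real (B i))" for n
    proof (induction n)
      case (Suc n)
      then show ?case using q[of n] AB(3)[of n] by simp
    qed (simp add: c)
    moreover have "real_of_int c = real (nat c) - real (nat (- c))" by simp
    ultimately have "poly p (real n) = real (nat c + (\<Sum>i<n. A i)) - real (nat (- c) + (\<Sum>i<n. B i))" for n
      by (simp add: sum_subtractf)
    moreover have "fpn 1 (\<lambda>e. nat c + (\<Sum>i<length (e 0). A i))" "fpn 1 (\<lambda>e. nat (- c) + (\<Sum>i<length (e 0). B i))"
      by (intro fpn_add fpn_const fpn_sum_upto AB)+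
    ultimately show ?thesis
      by (intro exI[of _ "\<lambda>n. nat c + (\<Sum>i<n. A i)"] exI[of _ "\<lambda>n. nat (- c) + (\<Sum>i<n. B i)"]) simp
  qed
qed

lemma fpn_polynomial_fun:
  assumes "polynomial_fun (\<lambda>n. real (t n))" "fpn k n"
  shows "fpn k (\<lambda>e. t (n e))"
proof -
  obtain P where P: "\<And>n. real (t n) = poly P (real n)" using assms(1) by (auto simp: polynomial_fun_def)
  then have "poly P (real n) \<in> \<int>" for n by (metis Ints_of_nat)
  then obtain A B where AB: "fpn 1 (\<lambda>e. A (length (e 0)))" "fpn 1 (\<lambda>e. B (length (e 0)))"
      "\<And>n. poly P (real n) = real (A n) - real (B n)"
    using fpn_integer_poly by metis
  \<comment> \<open>Truncated subtraction is exact because the difference is the natural number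
    \<open>t n\<close>.\<close>
  have "t n = A n - B n" for n using AB(3)[of n] P[of n] by linarith
  moreover have "fpn 1 (\<lambda>e. A (length (e 0)) - B (length (e 0)))" by (intro fpn_diff AB)
  ultimately have "fpn 1 (\<lambda>e. t (length (e 0)))" by simp
  then show ?thesis using assms(2) by (rule fpn_comp1)
qed

lemma fp_call2:
  assumes "wf_tm M" "2 \<le> tapes M" "fp k a" "fp k b" "fp k c"
  shows "fp k (\<lambda>e. call M [a e, b e] (c e))"
proof (rule fp_comp3[where f = "\<lambda>a b c. call M [a, b] c", OF _ assms(3-5)])
  show "fp 3 (\<lambda>e. call M [e 0, e 1] (e 2))"
    using fp_call[OF assms(1,2)] by (simp add: numeral_2_eq_2 numeral_3_eq_3)
qed

lemma fp_comp4:
  assumes "fp 4 (\<lambda>e. f (e 0) (e 1) (e 2) (e 3))" "fp k a" "fp k b" "fp k c" "fp k d"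
  shows "fp k (\<lambda>e. f (a e) (b e) (c e) (d e))"
proof -
  have "fp k (if i = 0 then a else if i = 1 then b else if i = 2 then c else d)" for i :: nat
    using assms by simp
  from fp_comp[OF assms(1), of k "\<lambda>i. if i = 0 then a else if i = 1 then b else if i = 2 then c else d", OF this]
  show ?thesis by simp
qed

lemma fp_call3:
  assumes "wf_tm M" "3 \<le> tapes M" "fp k a" "fp k b" "fp k c" "fp k d"
  shows "fp k (\<lambda>e. call M [a e, b e, c e] (d e))"
proof (rule fp_comp4[where f = "\<lambda>a b c d. call M [a, b, c] d", OF _ assms(3-6)])
  show "fp 4 (\<lambda>e. call M [e 0, e 1, e 2] (e 3))"
    using fp_call[OF assms(1,2)] by (simp add: eval_nat_numeral)
qed

section \<open>Averages over bit strings\<close>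

definition bits :: "nat \<Rightarrow> bool list set" where
  "bits n = {x. length x = n}"

definition avg :: "nat \<Rightarrow> (bool list \<Rightarrow> real) \<Rightarrow> real" where
  "avg n h = (\<Sum>x\<in>bits n. h x) / 2 ^ n"

lemma finite_bits [simp]: "finite (bits n)" and card_bits [simp]: "card (bits n) = 2 ^ n"
  using finite_lists_length_eq[of "UNIV :: bool set" n] card_lists_length_eq[of "UNIV :: bool set" n]
  by (simp_all add: bits_def)

lemma bits_nonempty [simp]: "bits n \<noteq> {}"
  by (auto simp: bits_def intro: Ex_list_of_length)

lemma avg_cong: "(\<And>x. length x = n \<Longrightarrow> h x = h' x) \<Longrightarrow> avg n h = avg n h'"
  by (simp add: avg_def bits_def)

lemma avg_mono: "(\<And>x. length x = n \<Longrightarrow> h x \<le> h' x) \<Longrightarrow> avg n h \<le> avg n h'"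
  by (auto simp: avg_def bits_def intro!: divide_right_mono sum_mono)

lemma avg_const [simp]: "avg n (\<lambda>_. c) = c"
  by (simp add: avg_def)

lemma avg_add: "avg n (\<lambda>x. h x + h' x) = avg n h + avg n h'"
  by (simp add: avg_def sum.distrib add_divide_distrib)

lemma avg_diff: "avg n (\<lambda>x. h x - h' x) = avg n h - avg n h'"
  by (simp add: avg_def sum_subtractf diff_divide_distrib)

lemma avg_mult_left: "avg n (\<lambda>x. c * h x) = c * avg n h"
  by (simp add: avg_def sum_distrib_left)

lemma avg_mult_right: "avg n (\<lambda>x. h x * c) = avg n h * c"
  by (simp add: avg_def sum_distrib_right)

lemma avg_nonneg: "(\<And>x. length x = n \<Longrightarrow> 0 \<le> h x) \<Longrightarrow> 0 \<le> avg n h"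
  using avg_mono[of n "\<lambda>_. 0" h] by simp

lemma avg_le: "(\<And>x. length x = n \<Longrightarrow> h x \<le> c) \<Longrightarrow> avg n h \<le> c"
  using avg_mono[of n h "\<lambda>_. c"] by simp

lemma avg_sum: "avg n (\<lambda>x. \<Sum>i\<in>I. h i x) = (\<Sum>i\<in>I. avg n (h i))"
  unfolding avg_def by (subst sum.swap) (simp add: sum_divide_distrib)

lemma avg_swap: "avg a (\<lambda>x. avg b (h x)) = avg b (\<lambda>y. avg a (\<lambda>x. h x y))"
  unfolding avg_def sum_divide_distrib[symmetric] by (subst sum.swap) simp

lemma avg_append: "avg (a + b) h = avg a (\<lambda>u. avg b (\<lambda>v. h (u @ v)))"
proof -
  have "(\<Sum>x\<in>bits (a + b). h x) = (\<Sum>(u, v)\<in>bits a \<times> bits b. h (u @ v))"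
    by (rule sum.reindex_bij_witness[where i = "\<lambda>(u, v). u @ v" and j = "\<lambda>x. (take a x, drop a x)"])
      (auto simp: bits_def)
  also have "\<dots> = (\<Sum>u\<in>bits a. \<Sum>v\<in>bits b. h (u @ v))"
    by (rule sum.cartesian_product[symmetric])
  finally show ?thesis by (simp add: avg_def sum_divide_distrib[symmetric] power_add mult.commute)
qed

lemma avg_take: "k \<le> R \<Longrightarrow> avg R (\<lambda>r. h (take k r)) = avg k h"
proof -
  assume "k \<le> R"
  then have "avg R (\<lambda>r. h (take k r)) = avg (k + (R - k)) (\<lambda>r. h (take k r))" by simp
  also have "\<dots> = avg k (\<lambda>u. avg (R - k) (\<lambda>v. h (take k (u @ v))))" by (rule avg_append)
  also have "\<dots> = avg k (\<lambda>u. avg (R - k) (\<lambda>v. h u))" by (rule avg_cong, rule avg_cong) simp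
  finally show ?thesis by simp
qed

text \<open>Disjoint segments of a uniform string are independent; \<open>d\<close> leaves room for
  surplus bits.\<close>

lemma avg_segments:
  "avg (k * S + d) (\<lambda>r. \<Prod>l<k. h (take S (drop (l * S) r))) = avg S h ^ k"
proof (induction k)
  case (Suc k)
  have "avg (Suc k * S + d) (\<lambda>r. \<Prod>l<Suc k. h (take S (drop (l * S) r)))
      = avg (S + (k * S + d)) (\<lambda>r. h (take S r) * (\<Prod>l<k. h (take S (drop (l * S) (drop S r)))))"
    by (subst prod.lessThan_Suc_shift) (simp add: algebra_simps)
  also have "\<dots> = avg S (\<lambda>u. avg (k * S + d) (\<lambda>v. h u * (\<Prod>l<k. h (take S (drop (l * S) v)))))"
    unfolding avg_append by (rule avg_cong, rule avg_cong) simp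
  also have "\<dots> = avg S h * avg S h ^ k"
    by (simp add: avg_mult_left Suc avg_mult_right)
  finally show ?case by simp
qed simp

definition splice :: "nat \<Rightarrow> nat \<Rightarrow> bool list \<Rightarrow> bool list \<Rightarrow> bool list" where
  "splice n i x z = take (i * n) z @ x @ drop (i * n + n) z"

text \<open>Replacing one block of a uniform string by a fresh uniform block leaves it
  uniform.\<close>

lemma avg_splice:
  assumes "i * n + n \<le> N"
  shows "avg N h = avg n (\<lambda>x. avg N (\<lambda>z. h (splice n i x z)))"
proof -
  define a b where "a = i * n" and "b = N - (i * n + n)"
  have N: "N = a + (n + b)" using assms by (simp add: a_def b_def)
  have "avg N h = avg a (\<lambda>u. avg n (\<lambda>x. avg b (\<lambda>w. h (u @ x @ w))))"
    unfolding N avg_append by simp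
  also have "\<dots> = avg n (\<lambda>x. avg a (\<lambda>u. avg b (\<lambda>w. h (u @ x @ w))))"
    by (rule avg_swap)
  also have "\<dots> = avg n (\<lambda>x. avg N (\<lambda>z. h (splice n i x z)))"
  proof (rule avg_cong)
    fix x :: "bool list"
    have "avg N (\<lambda>z. h (splice n i x z))
        = avg a (\<lambda>u. avg n (\<lambda>v. avg b (\<lambda>w. h (splice n i x (u @ v @ w)))))"
      unfolding N avg_append by simp
    also have "\<dots> = avg a (\<lambda>u. avg n (\<lambda>v. avg b (\<lambda>w. h (u @ x @ w))))"
      by (intro avg_cong) (simp add: splice_def a_def)
    finally show "avg a (\<lambda>u. avg b (\<lambda>w. h (u @ x @ w))) = avg N (\<lambda>z. h (splice n i x z))" by simp
  qed
  finally show ?thesis .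
qed

section \<open>Experiments as averages\<close>

lemma pmf_uniform_bits:
  "pmf (uniform_bits n \<bind> f) y = avg n (\<lambda>x. pmf (f x) y)"
proof -
  have "uniform_bits n = pmf_of_set (bits n)" by (simp add: uniform_bits_def bits_def)
  then show ?thesis by (simp add: pmf_bind integral_pmf_of_set avg_def)
qed

lemma pmf_return_True: "pmf (return_pmf P) True = of_bool P"
  by (auto simp: pmf_return)

lemma success_prob_eq:
  "success_prob H \<rho> g n = avg n (\<lambda>x. avg (poly \<rho> n) (\<lambda>r. of_bool (result H [x, r] = Some (g x))))"
  unfolding success_prob_def random_result_def bind_map_pmf pmf_uniform_bits pmf_return_True
  by (rule avg_cong) (simp add: input_size_def pmf_uniform_bits pmf_return_True)

lemma inversion_prob_eq:
  "inversion_prob A \<rho> f n = avg n (\<lambda>x. avg (poly \<rho> (n + length (f x)))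
     (\<lambda>r. of_bool (result A [unary n, f x, r] \<in> Some ` (f -` {f x}))))"
  unfolding inversion_prob_def random_result_def bind_map_pmf pmf_uniform_bits pmf_return_True
  by (rule avg_cong) (simp add: input_size_def pmf_uniform_bits pmf_return_True)

section \<open>A weak one-way function from the hardness of time-bounded Kolmogorov complexity\<close>

text \<open>The machine with empty table halts at once with its input as output. Its descriptions
  have length at most |w| + c and work under every time bound, so one \<open>c\<close> serves all
  t.\<close>

lemma universal_tm_identity:
  assumes "universal_tm U"
  obtains c T where "wf_tm U" "2 \<le> tapes U"
    "\<And>d t. halts_within U [d, unary t] (poly T (length d + t))"
    "\<And>w. \<exists>d. length d \<le> length w + c \<and> (\<forall>t. result U [d, unary t] = Some w)"
proof -
  obtain dec :: "bool list \<Rightarrow> (tm \<times> bool list) option" and T :: "nat poly" where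
    U: "wf_tm U" "tapes U \<ge> 2"
    and dec: "\<And>M. wf_tm M \<Longrightarrow> \<exists>c. \<forall>w. \<exists>d. dec d = Some (M, w) \<and> length d \<le> length w + c"
    and T: "\<And>d t. halts_within U [d, unary t] (poly T (length d + t))"
      "\<And>d t. result U [d, unary t] =
        (case dec d of None \<Rightarrow> None | Some (M, w) \<Rightarrow> result_within M [w] t)"
    using assms unfolding universal_tm_def by blast
  define M where "M = TM 1 Map.empty"
  have "wf_tm M" by (simp add: M_def wf_tm_def)
  then obtain c where c: "\<And>w. \<exists>d. dec d = Some (M, w) \<and> length d \<le> length w + c" using dec by blast
  have "result_within M [w] t = Some w" for w t
  proof -
    have h: "halts_within M [w] 0" by (simp add: halts_within_def run_def init_def halted_def M_def)
    then have "halts_within M [w] t" "run M [w] t = init M [w]"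
      using halts_within_mono[OF h] halts_within_run[OF h] by (simp_all add: run_def)
    then show ?thesis using holds_string_input_tape[of w]
      by (simp add: result_within_def init_def M_def tape_output_eq_Some)
  qed
  then have "\<exists>d. length d \<le> length w + c \<and> (\<forall>t. result U [d, unary t] = Some w)" for w
    using c[of w] by (auto simp: T(2))
  with U T(1) show thesis by (rule that)
qed

lemma K_le: "result U [d, unary (t (length x))] = Some x \<Longrightarrow> K U t x \<le> length d"
  unfolding K_def by (rule cInf_lower) auto

lemma K_attained:
  assumes "result U [d0, unary (t (length x))] = Some x"
  obtains d where "length d = K U t x" "result U [d, unary (t (length x))] = Some x"
proof -
  have "Inf {length d |d. result U [d, unary (t (length x))] = Some x}
      \<in> {length d |d. result U [d, unary (t (length x))] = Some x}"
    by (rule Inf_nat_def1) (use assms in auto)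
  then show thesis unfolding K_def[symmetric] using that by auto
qed

fun strip :: "bool list \<Rightarrow> bool list" where
  "strip [] = []"
| "strip (True # w) = strip w"
| "strip (False # w) = w"

lemma strip_unary [simp]: "strip (unary j @ False # w) = w"
  by (induction j) auto

lemma length_strip: "length (strip z) \<le> length z"
  by (induction z rule: strip.induct) auto

lemma fp_strip: assumes "fp k a" shows "fp k (\<lambda>e. strip (a e))"
proof -
  have "fp (0 + 1) (\<lambda>e. (\<lambda>x e. strip x) (e 0) (\<lambda>i. e (i + 1)))"
    by (rule fp_rec[where k = 0 and F = "\<lambda>x e. strip x" and G = "\<lambda>e. []" and BT = "\<lambda>e. e 1"
        and BF = "\<lambda>e. e 0" and T = "[:0, 1:]"]; (intro fp_proj fp_const)?;
        use length_strip in \<open>simp add: vol_def\<close>)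
  then have "fp 1 (\<lambda>e. strip (e 0))" by simp
  then show ?thesis using assms by (rule fp_comp1)
qed

text \<open>Unary prefixes keep the three parts separable. \<open>N\<close> will be the length of
  the input, which fixes the time bound under which every preimage produces
  \<open>x\<close>.\<close>

definition code :: "nat \<Rightarrow> nat \<Rightarrow> bool list \<Rightarrow> bool list" where
  "code q N x = unary q @ False # unary N @ False # x"

lemma unary_False_eq: "unary a @ False # x = unary b @ False # y \<longleftrightarrow> a = b \<and> x = y"
proof (induction a arbitrary: b)
  case 0
  then show ?case by (cases b) auto
next
  case (Suc a)
  then show ?case by (cases b) auto
qed

lemma code_eq_iff: "code q N x = code q' N' x' \<longleftrightarrow> q = q' \<and> N = N' \<and> x = x'"
  by (auto simp: code_def unary_False_eq)

lemma length_code: "length (code q N x) = q + N + length x + 2"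
  by (simp add: code_def)

lemma fp_code: "fpn k q \<Longrightarrow> fpn k N \<Longrightarrow> fp k x \<Longrightarrow> fp k (\<lambda>e. code (q e) (N e) (x e))"
  unfolding code_def by (intro fp_append fp_Cons fp_unary)

text \<open>On inputs of length \<open>N = n + c + 1\<close>, the input \<open>1\<^sup>j 0 \<Pi>\<close> selects a description \<open>\<Pi>\<close> of length
  \<open>n + c - j\<close>. The geometric distribution of \<open>j\<close> compensates the number of descriptions, so every
  \<open>\<Pi>\<close> of any length up to \<open>n + c\<close> has the same probability \<open>2\<^sup>-\<^sup>N\<close>.\<close>

definition emulate :: "tm \<Rightarrow> nat poly \<Rightarrow> (nat \<Rightarrow> nat) \<Rightarrow> nat \<Rightarrow> bool list \<Rightarrow> bool list" where
  "emulate U T t c z =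
     (let d = strip z; s = t (length z - Suc c); y = call U [d, unary s] (unary (poly T (length d + s)))
      in if y = [] then [] else code (length d) (length z) (tl y))"

lemma emulate_eq:
  assumes "\<And>d t. halts_within U [d, unary t] (poly T (length d + t))"
  shows "emulate U T t c z = (case result U [strip z, unary (t (length z - Suc c))] of
     None \<Rightarrow> [] | Some x \<Rightarrow> code (length (strip z)) (length z) x)"
  using result_eq_result_within[OF assms[of "strip z" "t (length z - Suc c)"]]
  by (simp add: emulate_def call_def Let_def split: option.split)

lemma fp_emulate:
  assumes "wf_tm U" "2 \<le> tapes U" "polynomial_fun (\<lambda>n. real (t n))"
  shows "fp 1 (\<lambda>e. emulate U T t c (e 0))"
proof -
  let ?s = "\<lambda>e :: stacks. t (length (e 0) - Suc c)"
  have z: "fp 1 (\<lambda>e. e 0)" by (rule fp_proj) simp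
  have s: "fpn 1 ?s" by (intro fpn_polynomial_fun[OF assms(3)] fpn_diff fpn_length fpn_const z)
  have y: "fp 1 (\<lambda>e. call U [strip (e 0), unary (?s e)] (unary (poly T (length (strip (e 0)) + ?s e))))"
    by (intro fp_call2 assms fp_strip z fp_unary fpn_poly fpn_add fpn_length s)
  show ?thesis unfolding emulate_def Let_def
    by (intro fp_if_Nil y fp_nil fp_code fp_tl fpn_length fp_strip z)
qed

text \<open>An answer is kept only if \<open>f\<close> confirms it, so a nonempty value is
  \<open>True\<close> followed by a preimage. The randomness is cut to the length that the inverter
  expects, so that a caller may supply a longer string.\<close>

definition invert_trial ::
  "tm \<Rightarrow> nat poly \<Rightarrow> nat poly \<Rightarrow> (bool list \<Rightarrow> bool list) \<Rightarrow> nat \<Rightarrow> bool list \<Rightarrow> bool list \<Rightarrow> bool list" where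
  "invert_trial A \<rho> T f N y r =
     (let l = N + length y; a = call A [unary N, y, take (poly \<rho> l) r] (unary (poly T l))
      in if a \<noteq> [] \<and> f (tl a) = y then a else [])"

lemma fp_invert_trial:
  assumes "wf_tm A" "3 \<le> tapes A" and f: "\<And>k a. fp k a \<Longrightarrow> fp k (\<lambda>e. f (a e))"
    and "fpn k N" "fp k y" "fp k r"
  shows "fp k (\<lambda>e. invert_trial A \<rho> T f (N e) (y e) (r e))"
proof -
  have "fp k (\<lambda>e. call A [unary (N e), y e, take (poly \<rho> (N e + length (y e))) (r e)]
      (unary (poly T (N e + length (y e)))))" (is "fp k ?a")
    by (intro fp_call3 assms fp_unary fp_take fpn_poly fpn_add fpn_length)
  then show ?thesis unfolding invert_trial_def Let_def
    by (intro fp_if fpb_and fpb_not fpb_Nil fpb_eq f fp_tl fp_nil assms)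
qed

definition time_bound :: "nat \<Rightarrow> tm \<Rightarrow> nat poly \<Rightarrow> nat poly \<Rightarrow> bool" where
  "time_bound m A \<rho> T \<longleftrightarrow> (\<forall>xs r. length xs = m \<longrightarrow> length r = poly \<rho> (input_size xs) \<longrightarrow>
     halts_within A (xs @ [r]) (poly T (input_size xs)))"

lemma invert_trial_success:
  assumes T: "time_bound 2 A \<rho> T"
    and "poly \<rho> (N + length y) \<le> length r"
    and "result A [unary N, y, take (poly \<rho> (N + length y)) r] \<in> Some ` (f -` {y})"
  shows "invert_trial A \<rho> T f N y r \<noteq> []"
proof -
  let ?r = "take (poly \<rho> (N + length y)) r"
  have "halts_within A [unary N, y, ?r] (poly T (N + length y))"
    using T[unfolded time_bound_def, rule_format, of "[unary N, y]" ?r] assms(2)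
    by (simp add: input_size_def min_absorb2)
  then have "result_within A [unary N, y, ?r] (poly T (N + length y)) = result A [unary N, y, ?r]"
    by (rule result_eq_result_within[symmetric])
  then show ?thesis using assms(3) by (auto simp: invert_trial_def call_def)
qed

lemma invert_trial_sound: "invert_trial A \<rho> T f N y r \<noteq> [] \<Longrightarrow> f (tl (invert_trial A \<rho> T f N y r)) = y"
  by (auto simp: invert_trial_def Let_def split: if_splits)

lemma pptE:
  assumes "ppt m A \<rho>"
  obtains T where "wf_tm A" "Suc m \<le> tapes A"
    "time_bound m A \<rho> T"
  using assms unfolding ppt_def time_bound_def by auto

lemma search_program:
  assumes A: "wf_tm A" "3 \<le> tapes A" and f: "fp 1 (\<lambda>e. f (e 0))"
  shows "fp 2 (\<lambda>e. tl (first_hit (\<lambda>q. if invert_trial A \<rho> T f (length (e 0) + Suc c)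
      (code q (length (e 0) + Suc c) (e 0)) (e 1) = [] then [] else True # bits_of_nat q) (length (e 0) + Suc c)))"
proof -
  define h where "h = (\<lambda>e :: stacks. if invert_trial A \<rho> T f (length (e 0) + Suc c)
      (code (length (e 2)) (length (e 0) + Suc c) (e 0)) (e 1) = [] then [] else True # bits_of_nat (length (e 2)))"
  have p: "fp (Suc 2) (\<lambda>e. e 0)" "fp (Suc 2) (\<lambda>e. e 1)" "fp (Suc 2) (\<lambda>e. e 2)"
    by (rule fp_proj; simp)+
  have N: "fpn (Suc 2) (\<lambda>e. length (e 0) + Suc c)" by (intro fpn_add fpn_length fpn_const p)
  have "fp (Suc 2) (\<lambda>e. invert_trial A \<rho> T f (length (e 0) + Suc c)
      (code (length (e 2)) (length (e 0) + Suc c) (e 0)) (e 1))"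
    by (rule fp_invert_trial[OF A fp_comp1[OF f]]; (assumption | intro N fp_code fpn_length p))
  then have "fp (Suc 2) h" unfolding h_def
    by (intro fp_if_Nil fp_nil fp_Cons fp_bits_of_nat fpn_length p)
  moreover have "fpn 2 (\<lambda>e. length (e 0) + Suc c)"
    by (intro fpn_add fpn_length fpn_const fp_proj) simp
  ultimately have "fp 2 (\<lambda>e. first_hit (\<lambda>i. h (e(2 := unary i))) (length (e 0) + Suc c))"
    by (rule fp_first_hit)
  then have "fp 2 (\<lambda>e. tl (first_hit (\<lambda>i. h (e(2 := unary i))) (length (e 0) + Suc c)))"
    by (rule fp_tl)
  then show ?thesis by (simp add: h_def cong: if_cong)
qed

lemma weak_one_way_emulate:
  assumes U: "wf_tm U" "2 \<le> tapes U" "\<And>d t. halts_within U [d, unary t] (poly TU (length d + t))"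
    "\<And>w. \<exists>d. length d \<le> length w + c \<and> (\<forall>t. result U [d, unary t] = Some w)"
    and t: "polynomial_fun (\<lambda>n. real (t n))"
    and p: "polynomial_fun p" "\<And>n. p n > 0"
    and hard: "hard_on_average (\<lambda>n. 1 / p n) (\<lambda>x. bits_of_nat (K U t x))"
  shows "weak_one_way (emulate U TU t c)"
proof -
  define f where "f = emulate U TU t c"
  define g where "g = (\<lambda>x. bits_of_nat (K U t x))"
  have fp_f: "fp 1 (\<lambda>e. f (e 0))" unfolding f_def by (rule fp_emulate[OF U(1,2) t])
  have f_eq: "f z = (case result U [strip z, unary (t (length z - Suc c))] of
     None \<Rightarrow> [] | Some x \<Rightarrow> code (length (strip z)) (length z) x)" for z
    unfolding f_def by (rule emulate_eq[OF U(3)])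
  \<comment> \<open>Failed emulations are mapped to the empty string, which is no code; so a
    preimage of a code always contains a description of \<open>x\<close>.\<close>
  have f_code: "length z = N \<and> length (strip z) = q \<and> result U [strip z, unary (t (N - Suc c))] = Some x"
    if "f z = code q N x" for z q N x
    using that unfolding f_eq by (auto simp: code_eq_iff split: option.splits) (auto simp: code_def)
  have desc: "\<exists>d. length d = K U t x \<and> result U [d, unary (t (length x))] = Some x
      \<and> K U t x \<le> length x + c" for x
  proof -
    obtain d0 where d0: "length d0 \<le> length x + c" "result U [d0, unary (t (length x))] = Some x"
      using U(4)[of x] by blast
    have "K U t x \<le> length d0" by (rule K_le[of U d0 t x, OF d0(2)])
    moreover obtain d where "length d = K U t x" "result U [d, unary (t (length x))] = Some x"
      by (rule K_attained[of U d0 t x, OF d0(2)])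
    ultimately show ?thesis using d0(1) by auto
  qed
  define D where "D = (\<lambda>x. SOME d. length d = K U t x \<and> result U [d, unary (t (length x))] = Some x
      \<and> K U t x \<le> length x + c)"
  have D: "length (D x) = K U t x \<and> result U [D x, unary (t (length x))] = Some x
      \<and> K U t x \<le> length x + c" for x
    unfolding D_def using desc[of x] by (rule someI_ex)
  \<comment> \<open>The input on which the success for x depends: a shortest description, with a
    unary prefix filling up to length |x| + c + 1.\<close>
  define Z where "Z = (\<lambda>x. unary (length x + c - K U t x) @ False # D x)"
  have Z: "length (Z x) = length x + Suc c" "f (Z x) = code (K U t x) (length x + Suc c) x" for x
    using D[of x] by (simp_all add: Z_def f_eq)
  obtain P where P: "\<And>n. p n = poly P (real n)" using p(1) by (auto simp: polynomial_fun_def)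
  \<comment> \<open>\<open>2 ^ Suc c\<close> is the loss of the reduction. For N < c + 1 the
    polynomial is evaluated at a negative number, where it need not be positive; 1 + p^2 is positive
    everywhere and at least p.\<close>
  define q where "q = (\<lambda>N :: nat. 2 ^ Suc c * (1 + (poly P (real N - real (Suc c)))\<^sup>2))"
  have q_pos: "q N > 0" for N unfolding q_def by (simp add: add_pos_nonneg)
  have "q N = poly (smult (2 ^ Suc c) (1 + (pcompose P [:- real (Suc c), 1:])\<^sup>2)) (real N)" for N
    by (simp add: q_def poly_pcompose algebra_simps)
  then have q_poly: "polynomial_fun q" unfolding polynomial_fun_def by blast
  have main: "\<forall>\<^sub>F N in sequentially. inversion_prob A \<rho> f N < 1 - 1 / q N" if A: "ppt 2 A \<rho>" for A \<rho>
  proof -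
    obtain T where T: "wf_tm A" "Suc 2 \<le> tapes A" "time_bound 2 A \<rho> T"
      using A by (rule pptE) (rule that)
    have A3: "3 \<le> tapes A" using T(2) by simp
    define trial where "trial = (\<lambda>x r q. if invert_trial A \<rho> T f (length x + Suc c)
        (code q (length x + Suc c) x) r = [] then [] else True # bits_of_nat q)"
    define h where "h = (\<lambda>x r. tl (first_hit (trial x r) (length x + Suc c)))"
    have "fp 2 (\<lambda>e. h (e 0) (e 1))" unfolding h_def trial_def by (rule search_program[OF T(1) A3 fp_f])
    then have "fp (Suc 1) (\<lambda>e. h (e 0) (e 1))" by (simp add: numeral_2_eq_2)
    then obtain H where H: "\<And>\<rho>. ppt 1 H \<rho>" "\<And>x r. result H [x, r] = Some (h x r)"
    proof (rule fp_ppt)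
      fix B
      assume B: "\<And>\<rho>. ppt 1 B \<rho>" "\<And>xs r. length xs = 1 \<Longrightarrow> result B (xs @ [r]) =
          Some (h (if 0 < Suc 1 then (xs @ [r]) ! 0 else []) (if 1 < Suc 1 then (xs @ [r]) ! 1 else []))"
      have "result B [x, r] = Some (h x r)" for x r using B(2)[of "[x]" r] by simp
      with B(1) show thesis by (rule that)
    qed
    let ?N = "\<lambda>x :: bool list. length x + Suc c"
    let ?y = "\<lambda>x. code (K U t x) (?N x) x"
    let ?inv = "\<lambda>N y r. of_bool (result A [unary N, y, r] \<in> Some ` (f -` {y})) :: real"
    let ?I = "\<lambda>N y. avg (poly \<rho> (N + length y)) (?inv N y)"
    \<comment> \<open>The query that matters has total size N + |y|, which is at most 4n + 3c +
      4.\<close>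
    define \<rho>H where "\<rho>H = pcompose \<rho> [:4 * c + 10, 4:]"
    have good: "h x r = g x" if "length r = poly \<rho>H (length x)"
      "result A [unary (?N x), ?y x, take (poly \<rho> (?N x + length (?y x))) r] \<in> Some ` (f -` {?y x})" for x r
    proof -
      have "poly \<rho> (?N x + length (?y x)) \<le> length r"
        unfolding that(1) \<rho>H_def poly_pcompose
        by (rule poly_mono_nat) (use D[of x] in \<open>simp add: length_code\<close>)
      then have "trial x r (K U t x) \<noteq> []"
        using invert_trial_success[where f = f, OF T(3) _ that(2)] by (simp add: trial_def)
      \<comment> \<open>A confirmed answer for j would contain a description of x of length j <
        K^t(x) for the same time bound.\<close>
      moreover have "trial x r j = []" if "j < K U t x" for j
      proof (rule ccontr)
        assume "trial x r j \<noteq> []"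
        then have "f (tl (invert_trial A \<rho> T f (?N x) (code j (?N x) x) r)) = code j (?N x) x"
          by (intro invert_trial_sound) (auto simp: trial_def)
        then obtain z where "f z = code j (?N x) x" by blast
        from f_code[OF this] have "K U t x \<le> j" using K_le[of U "strip z" t x] by simp
        then show False using that by simp
      qed
      ultimately have "first_hit (trial x r) (?N x) = trial x r (K U t x)"
        by (intro first_hit_eq) (use D[of x] in auto)
      then show ?thesis using \<open>trial x r (K U t x) \<noteq> []\<close>
        by (auto simp: h_def g_def trial_def split: if_splits)
    qed
    have bound: "1 - success_prob H \<rho>H g n \<le> 2 ^ Suc c * (1 - inversion_prob A \<rho> f (n + Suc c))" for n
    proof -
      let ?M = "n + Suc c"
      have I1: "?I N y \<le> 1" for N y by (rule avg_le) simp
      have "avg n (\<lambda>x. ?I (?N x) (?y x)) \<le> success_prob H \<rho>H g n"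
        unfolding success_prob_eq
      proof (rule avg_mono)
        fix x :: "bool list" assume x: "length x = n"
        let ?k = "poly \<rho> (?N x + length (?y x))"
        have "?k \<le> poly \<rho>H n"
          unfolding \<rho>H_def poly_pcompose
          by (rule poly_mono_nat) (use D[of x] x in \<open>simp add: length_code\<close>)
        then have "?I (?N x) (?y x) = avg (poly \<rho>H n) (\<lambda>r. ?inv (?N x) (?y x) (take ?k r))"
          by (rule avg_take[symmetric])
        also have "\<dots> \<le> avg (poly \<rho>H n) (\<lambda>r. of_bool (result H [x, r] = Some (g x)))"
          by (rule avg_mono) (use good x in \<open>auto simp: H(2)\<close>)
        finally show "?I (?N x) (?y x) \<le> avg (poly \<rho>H n) (\<lambda>r. of_bool (result H [x, r] = Some (g x)))" .
      qed
      then have "1 - success_prob H \<rho>H g n \<le> avg n (\<lambda>x. 1 - ?I (?N x) (?y x))"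
        by (simp add: avg_diff)
      also have "\<dots> = (\<Sum>x\<in>bits n. 1 - ?I ?M (f (Z x))) / 2 ^ n"
        unfolding avg_def by (intro arg_cong2[of _ _ _ _ "(/)"] sum.cong) (auto simp: bits_def Z)
      also have "(\<Sum>x\<in>bits n. 1 - ?I ?M (f (Z x))) = (\<Sum>z\<in>Z ` bits n. 1 - ?I ?M (f z))"
      proof -
        have "inj_on Z (bits n)" by (rule inj_onI) (metis Z(2) code_eq_iff)
        then show ?thesis by (simp add: sum.reindex)
      qed
      \<comment> \<open>Distinct x have distinct \<open>Z x\<close>, and failure probabilities on
        the remaining inputs are nonnegative. The two normalizations differ by the factor
        \<open>2 ^ Suc c\<close>.\<close>
      also have "\<dots> \<le> (\<Sum>z\<in>bits ?M. 1 - ?I ?M (f z))"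
      proof (rule sum_mono2)
        show "Z ` bits n \<subseteq> bits ?M" using Z(1) by (auto simp: bits_def)
        show "0 \<le> 1 - ?I ?M (f z)" for z using I1[of ?M "f z"] by (simp only: diff_ge_0_iff_ge)
      qed simp
      finally have "1 - success_prob H \<rho>H g n \<le> (\<Sum>z\<in>bits ?M. 1 - ?I ?M (f z)) / 2 ^ n"
        by (simp add: divide_right_mono)
      also have "\<dots> = 2 ^ Suc c * avg ?M (\<lambda>z. 1 - ?I ?M (f z))"
        by (simp add: avg_def power_add)
      also have "avg ?M (\<lambda>z. 1 - ?I ?M (f z)) = 1 - inversion_prob A \<rho> f ?M"
        by (simp add: avg_diff inversion_prob_eq)
      finally show ?thesis .
    qed
    have "\<forall>\<^sub>F n in sequentially. success_prob H \<rho>H g n < 1 - 1 / p n"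
      using hard H(1) unfolding hard_on_average_def g_def by blast
    then have "\<forall>\<^sub>F n in sequentially. inversion_prob A \<rho> f (n + Suc c) < 1 - 1 / q (n + Suc c)"
    proof (rule eventually_mono)
      fix n assume "success_prob H \<rho>H g n < 1 - 1 / p n"
      then have "1 / p n < 2 ^ Suc c * (1 - inversion_prob A \<rho> f (n + Suc c))" using bound[of n] by simp
      moreover have "a / C < X" if "a < C * X" "0 < C" for a C X :: real
        using that by (simp add: pos_divide_less_eq mult.commute)
      ultimately have "1 / p n / 2 ^ Suc c < 1 - inversion_prob A \<rho> f (n + Suc c)"
        by (meson zero_less_numeral zero_less_power)
      then have *: "1 / (2 ^ Suc c * p n) < 1 - inversion_prob A \<rho> f (n + Suc c)"
        by (simp only: divide_divide_eq_left mult.commute)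
      have "p n \<le> 1 + (p n)\<^sup>2" using power2_diff[of "p n" 1] zero_le_power2[of "p n - 1"] p(2)[of n] by simp
      then have "2 ^ Suc c * p n \<le> q (n + Suc c)" by (simp add: q_def P)
      then have "1 / q (n + Suc c) \<le> 1 / (2 ^ Suc c * p n)"
        using p(2)[of n] q_pos[of "n + Suc c"] by (intro divide_left_mono) simp_all
      then show "inversion_prob A \<rho> f (n + Suc c) < 1 - 1 / q (n + Suc c)" using * by linarith
    qed
    then show ?thesis by (rule eventually_sequentially_seg[THEN iffD1])
  qed
  show ?thesis unfolding weak_one_way_def f_def[symmetric]
    using fp_poly_time_computable[OF fp_f] q_poly q_pos main by blast
qed

section \<open>Hardness amplification\<close>

text \<open>In the body of a loop whose counter is on tape \<open>k\<close>, this recovers the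
  arguments of the surrounding function.\<close>

definition cut :: "nat \<Rightarrow> stacks \<Rightarrow> nat \<Rightarrow> bool list" where
  "cut k e = (\<lambda>i. if i < k then e i else [])"

lemma cut_upd: "\<forall>i\<ge>k. e i = [] \<Longrightarrow> cut k (e(k := x)) = e"
  by (auto simp: cut_def fun_eq_iff)

lemma fp_cut: "fp k g \<Longrightarrow> fp (Suc k) (\<lambda>e. g (cut k e))"
  unfolding cut_def by (erule fp_weaken) simp

lemma fpn_cut: "fpn k g \<Longrightarrow> fpn (Suc k) (\<lambda>e. g (cut k e))"
  unfolding fpn_def by (rule fp_cut)

lemma fp_concat_upto:
  assumes "fp (Suc k) (\<lambda>e. H (cut k e) (length (e k)))" "fpn k n"
  shows "fp k (\<lambda>e. concat (map (H e) [0..<n e]))"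
  using fp_concat[OF assms] by (rule fp_cong) (simp add: cut_upd)

lemma fp_first_hit_upto:
  assumes "fp (Suc k) (\<lambda>e. H (cut k e) (length (e k)))" "fpn k n"
  shows "fp k (\<lambda>e. first_hit (H e) (n e))"
  using fp_first_hit[OF assms] by (rule fp_cong) (simp add: cut_upd)

text \<open>A prefix code: each bit is announced by \<open>True\<close>, and \<open>False\<close>
  ends the string. Concatenated code words can be split in one way only.\<close>

fun enc :: "bool list \<Rightarrow> bool list" where
  "enc [] = [False]"
| "enc (b # w) = True # b # enc w"

lemma length_enc: "length (enc x) = 2 * length x + 1"
  by (induction x) auto

lemma enc_append_eq: "enc x @ u = enc y @ v \<longleftrightarrow> x = y \<and> u = v"
proof (induction x arbitrary: y)
  case Nil
  then show ?case by (cases y) auto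
next
  case (Cons b x)
  then show ?case by (cases y) auto
qed

lemma concat_enc_eqD:
  "concat (map (\<lambda>i. enc (g i)) [0..<m]) = concat (map (\<lambda>i. enc (h i)) [0..<m]) \<Longrightarrow> i < m \<Longrightarrow> g i = h i"
proof -
  have "concat (map (\<lambda>i. enc (g i)) is) = concat (map (\<lambda>i. enc (h i)) is) \<Longrightarrow> i \<in> set is \<Longrightarrow> g i = h i" for "is"
    by (induction "is") (auto simp: enc_append_eq)
  then show "concat (map (\<lambda>i. enc (g i)) [0..<m]) = concat (map (\<lambda>i. enc (h i)) [0..<m]) \<Longrightarrow> i < m \<Longrightarrow> g i = h i"
    by simp
qed

lemma fp_enc: assumes "fp k a" shows "fp k (\<lambda>e. enc (a e))"
proof -
  have "fp (0 + 1) (\<lambda>e. (\<lambda>x e. enc x) (e 0) (\<lambda>i. e (i + 1)))"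
    by (rule fp_rec[where k = 0 and F = "\<lambda>x e. enc x" and G = "\<lambda>e. [False]" and BT = "\<lambda>e. True # True # e 1"
        and BF = "\<lambda>e. True # False # e 1" and T = "[:1, 2:]"]; (intro fp_proj fp_const fp_Cons)?;
        simp add: length_enc vol_def)
  then have "fp 1 (\<lambda>e. enc (e 0))" by simp
  then show ?thesis using assms by (rule fp_comp1)
qed

section \<open>Blocks and planted queries\<close>

definition block :: "nat \<Rightarrow> nat \<Rightarrow> bool list \<Rightarrow> bool list" where
  "block n i z = take n (drop (i * n) z)"

lemma fp_block: "fpn k n \<Longrightarrow> fpn k i \<Longrightarrow> fp k z \<Longrightarrow> fp k (\<lambda>e. block (n e) (i e) (z e))"
  unfolding block_def by (intro fp_take fp_drop fpn_mult)

lemma length_block: "length (block n i z) \<le> n"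
  by (simp add: block_def)

lemma mult_add_le_mult: "i < m \<Longrightarrow> i * n + n \<le> m * n" for i m n :: nat
  using mult_le_mono1[of "Suc i" m n] by simp

lemma block_splice:
  assumes "length x = n" "i * n + n \<le> length z"
  shows "block n j (splice n i x z) = (if j = i then x else block n j z)"
proof (cases j i rule: linorder_cases)
  case less
  then have "j * n + n \<le> i * n" by (rule mult_add_le_mult)
  then show ?thesis using less assms by (simp add: block_def splice_def drop_take min_absorb1)
next
  case equal
  then show ?thesis using assms by (simp add: block_def splice_def)
next
  case greater
  then have "i * n + n \<le> j * n" by (rule mult_add_le_mult)
  then show ?thesis using greater assms by (simp add: block_def splice_def)
qed

lemma length_splice: "length x = n \<Longrightarrow> i * n + n \<le> length z \<Longrightarrow> length (splice n i x z) = length z"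
  by (simp add: splice_def)

text \<open>For strictly increasing \<open>M\<close> with \<open>M 0 = 0\<close>, this is the largest \<open>n\<close> with \<open>M n \<le> N\<close>.\<close>

definition blocks :: "(nat \<Rightarrow> nat) \<Rightarrow> nat \<Rightarrow> nat" where
  "blocks M N = iter (\<lambda>i a. if M (Suc a) \<le> Suc i then Suc a else a) 0 N"

text \<open>The thresholds increase strictly, so going from N to N + 1 passes at most one of
  them.\<close>

lemma blocks_bounds:
  assumes "strict_mono M" "M 0 = 0"
  shows "M (blocks M N) \<le> N \<and> N < M (Suc (blocks M N))"
proof (induction N)
  case 0
  show ?case using strict_monoD[OF assms(1), of 0 1] assms(2) by (simp add: blocks_def)
next
  case (Suc N)
  have S: "blocks M (Suc N) = (if M (Suc (blocks M N)) \<le> Suc N then Suc (blocks M N) else blocks M N)"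
    by (simp add: blocks_def)
  have "M (Suc (blocks M N)) < M (Suc (Suc (blocks M N)))" using assms(1) by (simp add: strict_monoD)
  then show ?case using Suc unfolding S by auto
qed

lemma fpn_blocks:
  assumes "fpn k n" shows "fpn k (\<lambda>e. blocks (poly M) (n e))"
proof -
  define h where "h = (\<lambda>e :: stacks. if poly M (length (e 2) + 1) \<le> length (e 1) + 1
     then True # e 2 else e 2)"
  have p: "fp 3 (\<lambda>e. e 1)" "fp 3 (\<lambda>e. e 2)" by (rule fp_proj; simp)+
  have "fp 3 h" unfolding h_def
    by (intro fp_if fpb_le fpn_poly fpn_add fpn_length fpn_const fp_Cons p)
  then have "fp (1 + 2) h" by (simp add: numeral_3_eq_3)
  then have "fp 1 (\<lambda>e. iter (\<lambda>i a. h (e(1 := unary i, Suc 1 := a))) [] (length (e 0)))"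
  proof (rule fp_iter_small[where c = 1])
    show "fpn 1 (\<lambda>e. length (e 0))" by (intro fpn_length fp_proj) simp
  qed (auto intro: fp_nil simp: h_def numeral_2_eq_2)
  moreover have "iter (\<lambda>i a. h (e(1 := unary i, Suc 1 := a))) [] N = unary (blocks (poly M) N)" for e N
    by (induction N) (auto simp: h_def blocks_def numeral_2_eq_2)
  ultimately have "fpn 1 (\<lambda>e. blocks (poly M) (length (e 0)))" by (simp add: fpn_def)
  then show ?thesis using assms by (rule fpn_comp1)
qed

text \<open>The image of a product whose blocks come from \<open>z\<close>, except that the
  challenge \<open>y\<close> stands at position \<open>i\<close>. The header \<open>N\<close> forces
  every preimage under the product to have length \<open>N\<close>, hence the same division into
  blocks.\<close>

definition query ::
  "(bool list \<Rightarrow> bool list) \<Rightarrow> nat \<Rightarrow> nat \<Rightarrow> nat \<Rightarrow> nat \<Rightarrow> bool list \<Rightarrow> bool list \<Rightarrow> bool list" where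
  "query f N n m i y z = unary N @ False #
     concat (map (\<lambda>j. enc (if j = i then y else f (block n j z))) [0..<m])"

lemma fp_query:
  assumes f: "fp 1 (\<lambda>e. f (e 0))"
    and "fpn k N" "fpn k n" "fpn k m" "fpn k i" "fp k y" "fp k z"
  shows "fp k (\<lambda>e. query f (N e) (n e) (m e) (i e) (y e) (z e))"
proof -
  have j: "fpn (Suc k) (\<lambda>e. length (e k))" by (intro fpn_length fp_proj) simp
  have "fp (Suc k) (\<lambda>e. enc (if length (e k) = i (cut k e) then y (cut k e)
      else f (block (n (cut k e)) (length (e k)) (z (cut k e)))))"
    by (intro fp_enc fp_if fpb_eq_nat j fp_comp1[OF f] fp_block fp_cut fpn_cut assms)
  then show ?thesis unfolding query_def
    by (intro fp_append fp_Cons fp_unary fp_concat_upto[where H = "\<lambda>e j. enc (if j = i e then y e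
        else f (block (n e) j (z e)))"] assms)
qed

text \<open>No position below \<open>m\<close> equals \<open>m\<close>, so nothing is planted in this query.\<close>

definition direct_product ::
  "(bool list \<Rightarrow> bool list) \<Rightarrow> nat poly \<Rightarrow> nat poly \<Rightarrow> bool list \<Rightarrow> bool list" where
  "direct_product f mp Mp z =
     (let n = blocks (poly Mp) (length z); m = poly mp n in query f (length z) n m m [] z)"

lemma fp_direct_product:
  assumes f: "fp 1 (\<lambda>e. f (e 0))" shows "fp 1 (\<lambda>e. direct_product f mp Mp (e 0))"
proof -
  have z: "fp 1 (\<lambda>e. e 0)" by (rule fp_proj) simp
  show ?thesis unfolding direct_product_def Let_def
    by (intro fp_query f fpn_length z fpn_blocks fpn_poly fp_nil)
qed

lemma query_eqD:
  assumes "query f N n m m [] z = query f N' n' m' i y z'"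
  shows "N = N' \<and> concat (map (\<lambda>j. enc (f (block n j z))) [0..<m])
     = concat (map (\<lambda>j. enc (if j = i then y else f (block n' j z'))) [0..<m'])"
proof -
  have *: "map (\<lambda>j. enc (if j = m then [] else f (block n j z))) [0..<m] = map (\<lambda>j. enc (f (block n j z))) [0..<m]"
    by (rule map_cong) auto
  show ?thesis using assms unfolding query_def unary_False_eq * .
qed

text \<open>Equal headers give equal numbers and sizes of blocks, and \<open>enc\<close> splits
  uniquely; so block \<open>i\<close> of any preimage of the query inverts the challenge.\<close>

lemma direct_product_eq_query:
  assumes "direct_product f mp Mp z = query f N n m i y z'" "n = blocks (poly Mp) N" "m = poly mp n" "i < m"
  shows "f (block n i z) = y"
proof -
  from query_eqD[OF assms(1)[unfolded direct_product_def Let_def]]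
  have "length z = N" and *: "concat (map (\<lambda>j. enc (f (block (blocks (poly Mp) (length z)) j z)))
      [0..<poly mp (blocks (poly Mp) (length z))])
     = concat (map (\<lambda>j. enc (if j = i then y else f (block n j z'))) [0..<m])" by blast+
  then have "concat (map (\<lambda>j. enc (f (block n j z))) [0..<m])
     = concat (map (\<lambda>j. enc (if j = i then y else f (block n j z'))) [0..<m])"
    using assms(2,3) by simp
  from concat_enc_eqD[OF this assms(4)] show ?thesis by simp
qed

text \<open>With a challenge \<open>f x\<close> the planted query is a genuine value of the product,
  so for uniform \<open>x\<close> and \<open>z\<close> the inverter meets its usual
  distribution.\<close>

lemma query_splice:
  assumes "length x = n" "length z = N" "n = blocks (poly Mp) N" "m = poly mp n" "m * n \<le> N" "i < m"
  shows "query f N n m i (f x) z = direct_product f mp Mp (splice n i x z)"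
proof -
  have i: "i * n + n \<le> length z" using mult_add_le_mult[OF assms(6), of n] assms(2,5) by simp
  have "length (splice n i x z) = N" using length_splice[OF assms(1) i] assms(2) by simp
  then show ?thesis
    unfolding direct_product_def Let_def query_def using assms(3,4) block_splice[OF assms(1) i]
    by (auto intro!: arg_cong[of _ _ concat])
qed

lemma length_query:
  assumes "\<And>x. length x \<le> n \<Longrightarrow> length (f x) \<le> L"
  shows "length (query f N n m i y z) \<le> N + 1 + m * (2 * (L + length y) + 1)"
proof -
  have "length (concat (map (\<lambda>j. enc (if j = i then y else f (block n j z))) [0..<m]))
      = (\<Sum>j<m. length (enc (if j = i then y else f (block n j z))))"
    by (simp add: length_concat o_def interv_sum_list_conv_sum_set_nat atLeast0LessThan)
  also have "\<dots> \<le> of_nat (card {..<m}) * (2 * (L + length y) + 1)"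
  proof (rule sum_bounded_above)
    fix j
    show "length (enc (if j = i then y else f (block n j z))) \<le> 2 * (L + length y) + 1"
      using assms[OF length_block[of n j z]] by (simp add: length_enc)
  qed
  finally show ?thesis by (simp add: query_def)
qed

text \<open>The seed \<open>s\<close> serves two purposes: its first \<open>N\<close> bits fill the
  other blocks, the rest is the randomness of \<open>A\<close>.\<close>

definition trial ::
  "tm \<Rightarrow> nat poly \<Rightarrow> nat poly \<Rightarrow> (bool list \<Rightarrow> bool list) \<Rightarrow> nat poly \<Rightarrow> nat poly \<Rightarrow> nat
    \<Rightarrow> nat \<Rightarrow> nat \<Rightarrow> bool list \<Rightarrow> bool list \<Rightarrow> bool list" where
  "trial A \<rho> T f mp Mp n N i y s =
     (let b = invert_trial A \<rho> T (direct_product f mp Mp) N (query f N n (poly mp n) i y (take N s)) (drop N s)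
      in if b = [] then [] else True # block n i (tl b))"

lemma fp_trial:
  assumes A: "wf_tm A" "3 \<le> tapes A" and f: "fp 1 (\<lambda>e. f (e 0))"
    and "fpn k n" "fpn k N" "fpn k i" "fp k y" "fp k s"
  shows "fp k (\<lambda>e. trial A \<rho> T f mp Mp (n e) (N e) (i e) (y e) (s e))"
proof -
  have "fp k (\<lambda>e. invert_trial A \<rho> T (direct_product f mp Mp) (N e)
      (query f (N e) (n e) (poly mp (n e)) (i e) (y e) (take (N e) (s e))) (drop (N e) (s e)))" (is "fp k ?b")
    by (rule fp_invert_trial[OF A fp_comp1[OF fp_direct_product[OF f]]];
        (assumption | intro fp_query f fp_take fp_drop fpn_poly assms))
  then show ?thesis unfolding trial_def Let_def
    by (intro fp_if_Nil fp_nil fp_Cons fp_block fp_tl assms)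
qed

lemma trial_sound:
  assumes "trial A \<rho> T f mp Mp n N i y s \<noteq> []" "n = blocks (poly Mp) N" "i < poly mp n"
  shows "f (tl (trial A \<rho> T f mp Mp n N i y s)) = y"
proof -
  let ?b = "invert_trial A \<rho> T (direct_product f mp Mp) N (query f N n (poly mp n) i y (take N s)) (drop N s)"
  have b: "?b \<noteq> []" using assms(1) by (auto simp: trial_def)
  have "f (block n i (tl ?b)) = y"
    by (rule direct_product_eq_query[OF invert_trial_sound[OF b] assms(2) refl assms(3)])
  then show ?thesis using b by (simp add: trial_def)
qed

lemma blocks_eqI:
  assumes "strict_mono M" "M 0 = 0" "M n \<le> N" "N < M (Suc n)"
  shows "blocks M N = n"
proof -
  have b: "M (blocks M N) \<le> N" "N < M (Suc (blocks M N))" using blocks_bounds[OF assms(1,2)] by auto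
  have "M n < M (Suc (blocks M N))" "M (blocks M N) < M (Suc n)" using b assms(3,4) by linarith+
  then show ?thesis using strict_mono_less[OF assms(1)] by simp
qed

text \<open>A string is bad if completing it at any position rarely leads to an inversion. If there were
  many bad strings, almost every input of the direct product would contain one.\<close>

lemma amplify:
  fixes J :: "bool list \<Rightarrow> real"
  assumes J: "\<And>z. length z = N \<Longrightarrow> 0 \<le> J z" "\<And>z. length z = N \<Longrightarrow> J z \<le> 1"
    and N: "m * n \<le> N" and a: "0 \<le> a"
    and bad: "\<And>x. bad x \<longleftrightarrow> (\<forall>i<m. avg N (\<lambda>z. J (splice n i x z)) < a)"
  shows "avg N J \<le> (1 - avg n (\<lambda>x. of_bool (bad x))) ^ m + real m * a"
proof -
  let ?b = "\<lambda>x. of_bool (bad x) :: real"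
  \<comment> \<open>If some block is bad, its summand alone is J z; otherwise the product is
    1.\<close>
  have "J z \<le> (\<Prod>i<m. 1 - ?b (block n i z)) + (\<Sum>i<m. ?b (block n i z) * J z)" if z: "length z = N" for z
  proof (cases "\<exists>i<m. bad (block n i z)")
    case True
    then obtain i where i: "i < m" "bad (block n i z)" by blast
    have "?b (block n i z) * J z \<le> (\<Sum>i<m. ?b (block n i z) * J z)"
      by (rule member_le_sum) (use i J(1)[OF z] in auto)
    moreover have "0 \<le> (\<Prod>i<m. 1 - ?b (block n i z))" by (rule prod_nonneg) auto
    ultimately show ?thesis using i by simp
  next
    case False
    then show ?thesis using J(2)[OF z] by simp
  qed
  then have "avg N J \<le> avg N (\<lambda>z. (\<Prod>i<m. 1 - ?b (block n i z)) + (\<Sum>i<m. ?b (block n i z) * J z))"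
    by (rule avg_mono)
  also have "\<dots> = avg N (\<lambda>z. \<Prod>i<m. 1 - ?b (block n i z)) + (\<Sum>i<m. avg N (\<lambda>z. ?b (block n i z) * J z))"
    by (simp only: avg_add avg_sum)
  also have "avg N (\<lambda>z. \<Prod>i<m. 1 - ?b (block n i z)) = (1 - avg n ?b) ^ m"
    using avg_segments[of m n "N - m * n" "\<lambda>x. 1 - ?b x"] N by (simp add: block_def avg_diff)
  also have "(\<Sum>i<m. avg N (\<lambda>z. ?b (block n i z) * J z)) \<le> of_nat (card {..<m}) * a"
  proof (rule sum_bounded_above)
    fix i assume "i \<in> {..<m}"
    then have i: "i < m" by simp
    then have iN: "i * n + n \<le> N" using mult_add_le_mult[of i m n] N by simp
    \<comment> \<open>Block \<open>i\<close> is drawn separately: averaged over the rest, a bad x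
      contributes less than \<open>a\<close> and any other x contributes 0.\<close>
    have "avg N (\<lambda>z. ?b (block n i z) * J z)
        = avg n (\<lambda>x. avg N (\<lambda>z. ?b (block n i (splice n i x z)) * J (splice n i x z)))"
      by (rule avg_splice[OF iN])
    also have "\<dots> = avg n (\<lambda>x. avg N (\<lambda>z. ?b x * J (splice n i x z)))"
      by (intro avg_cong) (use iN in \<open>simp add: block_splice\<close>)
    also have "\<dots> \<le> a"
      by (rule avg_le) (use bad i a in \<open>force simp: avg_mult_left\<close>)
    finally show "avg N (\<lambda>z. ?b (block n i z) * J z) \<le> a" .
  qed
  finally show ?thesis by simp
qed

section \<open>Estimates for the parameters\<close>

lemma power_le_exp: "0 \<le> x \<Longrightarrow> x \<le> 1 \<Longrightarrow> (1 - x) ^ k \<le> exp (- (real k * x))" for x :: real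
proof -
  assume x: "0 \<le> x" "x \<le> 1"
  have "(1 - x) ^ k \<le> exp (- x) ^ k"
    using exp_ge_add_one_self[of "- x"] x by (intro power_mono) auto
  also have "\<dots> = exp (- (real k * x))" by (simp add: exp_of_nat_mult[symmetric])
  finally show ?thesis .
qed

text \<open>If \<beta> were at least 1/(2q), then m \<beta> would be at least n and (1 - \<beta>)^m
  at most exp(-n) < 1/(2s). The other summand equals 1/(2s), so the sum would stay below
  1/s.\<close>

lemma few_bad:
  fixes s q \<beta> :: real
  assumes b: "0 \<le> \<beta>" "\<beta> \<le> 1" and s: "s > 0" and q: "q > 0" "2 * real n * q \<le> real m" and m: "m > 0"
    and "1 / s \<le> (1 - \<beta>) ^ m + real m * (1 / (2 * real m * s))"
    and "exp (- real n) < 1 / (2 * s)"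
  shows "\<beta> < 1 / (2 * q)"
proof (rule ccontr)
  assume "\<not> \<beta> < 1 / (2 * q)"
  then have "real m * (1 / (2 * q)) \<le> real m * \<beta>" by (intro mult_left_mono) auto
  moreover have "real n \<le> real m * (1 / (2 * q))" using q by (simp add: field_simps)
  ultimately have "real n \<le> real m * \<beta>" by linarith
  then have "exp (- (real m * \<beta>)) \<le> exp (- real n)" by simp
  then have "(1 - \<beta>) ^ m \<le> exp (- real n)" using power_le_exp[OF b, of m] by linarith
  moreover have "real m * (1 / (2 * real m * s)) = 1 / (2 * s)" using m by simp
  moreover have "1 / s = 1 / (2 * s) + 1 / (2 * s)" using s by (simp add: field_simps)
  ultimately show False using assms(7,8) by linarith
qed

lemma poly_less_exp: "\<forall>\<^sub>F n in sequentially. real (poly p n) < exp (real n)" for p :: "nat poly"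
proof -
  \<comment> \<open>The factor n^k carries the induction on p: the variable in front of the tail of
    p is absorbed by passing to k + 1.\<close>
  have "(\<lambda>n. real n ^ k * real (poly p n) / exp (real n)) \<longlonglongrightarrow> 0" for k
  proof (induction p arbitrary: k)
    case (pCons a p)
    have "((\<lambda>x :: real. x ^ k / exp x) \<longlongrightarrow> 0) at_top" by (rule tendsto_power_div_exp_0)
    then have "(\<lambda>n. real n ^ k / exp (real n)) \<longlonglongrightarrow> 0"
      by (rule filterlim_compose[OF _ filterlim_real_sequentially])
    from tendsto_add[OF tendsto_mult_left_zero[OF this, of "real a"] pCons(2)[of "Suc k"]]
    show ?case by (simp add: algebra_simps add_divide_distrib)
  qed simp
  from this[of 0] have "(\<lambda>n. real (poly p n) / exp (real n)) \<longlonglongrightarrow> 0" by simp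
  then have "\<forall>\<^sub>F n in sequentially. real (poly p n) / exp (real n) < 1" by (rule order_tendstoD) simp
  then show ?thesis by (rule eventually_mono) simp
qed

text \<open>At natural arguments, rounding coefficients up and replacing negative ones by 0 does not
  decrease the value.\<close>

lemma polynomial_fun_le_nat_poly:
  assumes "polynomial_fun q" obtains Q :: "nat poly" where "\<And>n. q n \<le> real (poly Q n)"
proof -
  have "\<exists>Q :: nat poly. \<forall>n. poly P (real n) \<le> real (poly Q n)" for P :: "real poly"
  proof (induction P)
    case 0
    show ?case by (intro exI[of _ 0]) simp
  next
    case (pCons a P)
    then obtain Q :: "nat poly" where Q: "\<And>n. poly P (real n) \<le> real (poly Q n)" by blast
    have "poly (pCons a P) (real n) \<le> real (poly (pCons (nat \<lceil>a\<rceil>) Q) n)" for n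
      using mult_left_mono[OF Q[of n], of "real n"] real_nat_ceiling_ge[of a] by simp
    then show ?case by blast
  qed
  then show thesis using assms that unfolding polynomial_fun_def by metis
qed

text \<open>An inverter of the product may behave differently on the many input lengths that share the block
  length \<open>n\<close>; since the good ones are unknown, all of them are tried.\<close>

definition try_seeds where
  "try_seeds A \<rho> T f mp Mp kp SP n y r a i = first_hit (\<lambda>l. trial A \<rho> T f mp Mp n (poly Mp n + a) i y
     (take (poly SP (n + length y)) (drop (l * poly SP (n + length y)) r))) (poly kp n)"

definition try_positions where
  "try_positions A \<rho> T f mp Mp kp SP n y r a = first_hit (try_seeds A \<rho> T f mp Mp kp SP n y r a) (poly mp n)"

definition try_lengths where
  "try_lengths A \<rho> T f mp Mp kp SP n y r =
     first_hit (try_positions A \<rho> T f mp Mp kp SP n y r) (poly Mp (n + 1) - poly Mp n)"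

lemma fp_try_lengths:
  assumes A: "wf_tm A" "3 \<le> tapes A" and f: "fp 1 (\<lambda>e. f (e 0))"
  shows "fp 3 (\<lambda>e. try_lengths A \<rho> T f mp Mp kp SP (length (e 0)) (e 1) (e 2))"
proof -
  have l: "fpn (Suc k) (\<lambda>e. length (e k))" for k by (intro fpn_length fp_proj) simp
  have 1: "fp k (\<lambda>e. try_seeds A \<rho> T f mp Mp kp SP (n e) (y e) (r e) (a e) (i e))"
    if h: "fpn k n" "fp k y" "fp k r" "fpn k a" "fpn k i" for k n y r a i
  proof -
    have "fp (Suc k) (\<lambda>e. trial A \<rho> T f mp Mp (n (cut k e)) (poly Mp (n (cut k e)) + a (cut k e)) (i (cut k e))
      (y (cut k e)) (take (poly SP (n (cut k e) + length (y (cut k e))))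
      (drop (length (e k) * poly SP (n (cut k e) + length (y (cut k e)))) (r (cut k e)))))"
      by (rule fp_trial[OF A f]; (intro fpn_add fpn_poly fp_take fp_drop fpn_mult fpn_length l fp_cut fpn_cut h))
    then show ?thesis unfolding try_seeds_def
      by (rule fp_first_hit_upto[where H = "\<lambda>e l. trial A \<rho> T f mp Mp (n e) (poly Mp (n e) + a e) (i e) (y e)
        (take (poly SP (n e + length (y e))) (drop (l * poly SP (n e + length (y e))) (r e)))"])
        (intro fpn_poly h)
  qed
  have 2: "fp k (\<lambda>e. try_positions A \<rho> T f mp Mp kp SP (n e) (y e) (r e) (a e))"
    if h: "fpn k n" "fp k y" "fp k r" "fpn k a" for k n y r a
    unfolding try_positions_def
    by (rule fp_first_hit_upto; (intro 1 fpn_poly l fp_cut fpn_cut h))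
  have 3: "fp k (\<lambda>e. try_lengths A \<rho> T f mp Mp kp SP (n e) (y e) (r e))"
    if h: "fpn k n" "fp k y" "fp k r" for k n y r
    unfolding try_lengths_def
    by (rule fp_first_hit_upto; (intro 2 fpn_diff fpn_add fpn_const fpn_poly l fp_cut fpn_cut h))
  show ?thesis by (rule 3; (intro fpn_length)?; rule fp_proj; simp)
qed

lemma try_lengths_sound:
  assumes M: "strict_mono (poly Mp)" "poly Mp 0 = 0"
    and "try_lengths A \<rho> T f mp Mp kp SP n y r \<noteq> []"
  shows "f (tl (try_lengths A \<rho> T f mp Mp kp SP n y r)) = y"
proof -
  obtain a where a: "a < poly Mp (n + 1) - poly Mp n"
    "try_lengths A \<rho> T f mp Mp kp SP n y r = try_positions A \<rho> T f mp Mp kp SP n y r a"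
    using assms(3) first_hit_cases unfolding try_lengths_def by metis
  then obtain i where i: "i < poly mp n"
    "try_lengths A \<rho> T f mp Mp kp SP n y r = try_seeds A \<rho> T f mp Mp kp SP n y r a i"
    using assms(3) first_hit_cases unfolding try_positions_def by metis
  then obtain s where s:
    "try_lengths A \<rho> T f mp Mp kp SP n y r = trial A \<rho> T f mp Mp n (poly Mp n + a) i y s"
    using assms(3) first_hit_cases unfolding try_seeds_def by metis
  \<comment> \<open>All lengths tried have block length \<open>n\<close>, as the soundness of a
    trial requires.\<close>
  have "blocks (poly Mp) (poly Mp n + a) = n"
    by (rule blocks_eqI[OF M]) (use a(1) in simp_all)
  then show ?thesis using trial_sound[of A \<rho> T f mp Mp n "poly Mp n + a" i y s] assms(3) i(1)
    unfolding s by simp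
qed

lemma try_lengths_complete:
  assumes "a < poly Mp (n + 1) - poly Mp n" "i < poly mp n" "l < poly kp n"
    and "trial A \<rho> T f mp Mp n (poly Mp n + a) i y
      (take (poly SP (n + length y)) (drop (l * poly SP (n + length y)) r)) \<noteq> []"
  shows "try_lengths A \<rho> T f mp Mp kp SP n y r \<noteq> []"
  using assms unfolding try_lengths_def try_positions_def try_seeds_def first_hit_eq_Nil by blast

lemma trial_success:
  assumes "time_bound 2 A \<rho> T"
    and "length x = n" "length z = N" "n = blocks (poly Mp) N" "poly mp n * n \<le> N" "i < poly mp n"
    and "y = direct_product f mp Mp (splice n i x z)"
    and "poly \<rho> (N + length y) \<le> length v"
    and "result A [unary N, y, take (poly \<rho> (N + length y)) v] \<in> Some ` (direct_product f mp Mp -` {y})"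
  shows "trial A \<rho> T f mp Mp n N i (f x) (z @ v) \<noteq> []"
proof -
  have "query f N n (poly mp n) i (f x) z = y"
    unfolding assms(7) by (rule query_splice[OF assms(2-4) refl assms(5,6)])
  then show ?thesis
    using invert_trial_success[where f = "direct_product f mp Mp", OF assms(1) assms(8,9)] assms(3)
    by (simp add: trial_def)
qed

text \<open>One length \<open>N\<close> and one position \<open>i\<close> account for the whole
  bound. The average of \<open>J\<close> bounds the chance of a single seed from below, and the
  \<open>kp n\<close> seeds are independent; hits at other lengths or positions only help.\<close>

lemma try_lengths_prob:
  fixes f A \<rho> mp Mp
  defines "F \<equiv> direct_product f mp Mp"
  defines "J \<equiv> \<lambda>N z. avg (poly \<rho> (N + length (F z)))
       (\<lambda>r. of_bool (result A [unary N, F z, r] \<in> Some ` (F -` {F z}))) :: real"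
  assumes T: "time_bound 2 A \<rho> T"
    and M: "strict_mono (poly Mp)" "poly Mp 0 = 0" "poly Mp n = n * poly mp n"
    and N: "poly Mp n \<le> N" "N < poly Mp (Suc n)"
    and x: "length x = n" and i: "i < poly mp n"
    and S: "\<And>z. N + poly \<rho> (N + length (query f N n (poly mp n) i (f x) z)) \<le> poly SP (n + length (f x))"
    and R: "poly kp n * poly SP (n + length (f x)) \<le> R"
  shows "1 - (1 - avg N (\<lambda>z. J N (splice n i x z))) ^ poly kp n
     \<le> avg R (\<lambda>r. of_bool (try_lengths A \<rho> T f mp Mp kp SP n (f x) r \<noteq> []))"
proof -
  let ?S = "poly SP (n + length (f x))"
  let ?k = "poly kp n"
  let ?t = "\<lambda>s. trial A \<rho> T f mp Mp n N i (f x) s"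
  have n: "n = blocks (poly Mp) N" using blocks_eqI[OF M(1,2) N] by simp
  have mn: "poly mp n * n \<le> N" using N(1) M(3) by (simp add: mult.commute)
  have q: "query f N n (poly mp n) i (f x) z = F (splice n i x z)" if "length z = N" for z
    unfolding F_def by (rule query_splice[OF x that n refl mn i])
  define P where "P = avg ?S (\<lambda>s. of_bool (?t s \<noteq> []) :: real)"
  define p where "p = avg N (\<lambda>z. J N (splice n i x z))"
  \<comment> \<open>A seed is split into the filling z and the randomness v of the inverter;
    \<open>S\<close> makes v long enough.\<close>
  have "p \<le> avg N (\<lambda>z. avg (?S - N) (\<lambda>v. of_bool (?t (z @ v) \<noteq> [])))"
    unfolding p_def
  proof (rule avg_mono)
    fix z :: "bool list" assume z: "length z = N"
    define y where "y = F (splice n i x z)"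
    let ?l = "poly \<rho> (N + length y)"
    let ?inv = "\<lambda>r. of_bool (result A [unary N, y, r] \<in> Some ` (F -` {y})) :: real"
    have l: "?l \<le> ?S - N" using S[of z] unfolding q[OF z] y_def by simp
    have "J N (splice n i x z) = avg ?l ?inv" by (simp add: J_def y_def)
    also have "\<dots> = avg (?S - N) (\<lambda>v. ?inv (take ?l v))" by (rule avg_take[OF l, symmetric])
    also have "\<dots> \<le> avg (?S - N) (\<lambda>v. of_bool (?t (z @ v) \<noteq> []))"
    proof (rule avg_mono)
      fix v :: "bool list" assume v: "length v = ?S - N"
      show "?inv (take ?l v) \<le> of_bool (?t (z @ v) \<noteq> [])"
        using trial_success[OF T x z n mn i y_def[unfolded F_def], where v = v] l v
        unfolding F_def[symmetric] by auto
    qed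
    finally show "J N (splice n i x z) \<le> avg (?S - N) (\<lambda>v. of_bool (?t (z @ v) \<noteq> []))" .
  qed
  also have "\<dots> = P"
  proof -
    have "P = avg (N + (?S - N)) (\<lambda>s. of_bool (?t s \<noteq> []))" using S[of x] by (simp add: P_def)
    then show ?thesis by (simp only: avg_append)
  qed
  finally have "p \<le> P" .
  moreover have "P \<le> 1" unfolding P_def by (rule avg_le) simp
  ultimately have "(1 - P) ^ ?k \<le> (1 - p) ^ ?k" by (intro power_mono) auto
  moreover have "1 - (1 - P) ^ ?k \<le> avg R (\<lambda>r. of_bool (try_lengths A \<rho> T f mp Mp kp SP n (f x) r \<noteq> []))"
  proof -
    let ?h = "\<lambda>s. 1 - of_bool (?t s \<noteq> []) :: real"
    let ?seg = "\<lambda>l r. take ?S (drop (l * ?S) r)"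
    have "avg R (\<lambda>r. \<Prod>l<?k. ?h (?seg l r)) = avg (?k * ?S + (R - ?k * ?S)) (\<lambda>r. \<Prod>l<?k. ?h (?seg l r))"
      using R by simp
    also have "\<dots> = avg ?S ?h ^ ?k" by (rule avg_segments)
    also have "avg ?S ?h = 1 - P" by (simp add: P_def avg_diff)
    finally have "1 - (1 - P) ^ ?k = avg R (\<lambda>r. 1 - (\<Prod>l<?k. ?h (?seg l r)))" by (simp add: avg_diff)
    also have "\<dots> \<le> avg R (\<lambda>r. of_bool (try_lengths A \<rho> T f mp Mp kp SP n (f x) r \<noteq> []))"
    proof (rule avg_mono)
      fix r :: "bool list"
      show "1 - (\<Prod>l<?k. ?h (?seg l r)) \<le> of_bool (try_lengths A \<rho> T f mp Mp kp SP n (f x) r \<noteq> [])"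
      proof (cases "\<exists>l<?k. ?t (?seg l r) \<noteq> []")
        case True
        then obtain l where l: "l < ?k" "?t (?seg l r) \<noteq> []" by blast
        have "try_lengths A \<rho> T f mp Mp kp SP n (f x) r \<noteq> []"
          by (rule try_lengths_complete[of "N - poly Mp n" Mp n i mp l kp]) (use N i l in simp_all)
        moreover have "0 \<le> (\<Prod>l<?k. ?h (?seg l r))" by (rule prod_nonneg) auto
        ultimately show ?thesis by simp
      next
        case False
        then have "(\<Prod>l<?k. ?h (?seg l r)) = 1" by (intro prod.neutral) auto
        then show ?thesis by simp
      qed
    qed
    finally show ?thesis .
  qed
  ultimately show ?thesis unfolding p_def by linarith
qed

theorem weak_one_way_imp_one_way:
  assumes "weak_one_way f" shows "\<exists>F. one_way F"
proof -
  have fp_f: "fp 1 (\<lambda>e. f (e 0))"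
    using assms poly_time_computable_fp[of f] unfolding weak_one_way_def by blast
  obtain q where q: "polynomial_fun q" "\<And>n. q n > 0"
    and weak: "\<And>A \<rho>. ppt 2 A \<rho> \<Longrightarrow> \<forall>\<^sub>F n in sequentially. inversion_prob A \<rho> f n < 1 - 1 / q n"
    using assms unfolding weak_one_way_def by blast
  obtain Q where Q: "\<And>n. q n \<le> real (poly Q n)" by (rule polynomial_fun_le_nat_poly[OF q(1)]) (rule that)
  have Q_pos: "poly Q n > 0" for n using Q[of n] q(2)[of n] by (cases "poly Q n") auto
  \<comment> \<open>With m at least 2nq, a set of density 1/(2q) is missed by m independent blocks
    with probability at most exp(-n). The summand 1 keeps m positive at n = 0.\<close>
  define mp where "mp = [:0, 2:] * Q + 1"
  define Mp where "Mp = [:0, 1:] * mp"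
  define F where "F = direct_product f mp Mp"
  have Mp: "poly Mp n = n * poly mp n" for n by (simp add: Mp_def)
  have m_pos: "poly mp n > 0" for n by (simp add: mp_def)
  have M: "strict_mono (poly Mp)" "poly Mp 0 = 0"
  proof -
    have "poly Mp n < poly Mp (Suc n)" for n
    proof -
      have "n * poly mp n \<le> n * poly mp (Suc n)" by (intro mult_le_mono2 poly_mono_nat) simp
      then show ?thesis using m_pos[of "Suc n"] unfolding Mp mult_Suc by linarith
    qed
    then show "strict_mono (poly Mp)" by (simp add: strict_mono_Suc_iff)
  qed (simp add: Mp)
  obtain Lf where Lf: "\<And>e. (\<forall>i\<ge>1. e i = []) \<Longrightarrow> length (f (e 0)) \<le> poly Lf (vol 1 e)"
    by (rule fp_length[OF fp_f]) auto
  have Lf': "length (f x) \<le> poly Lf n" if "length x \<le> n" for x n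
  proof -
    have "length (f x) \<le> poly Lf (length x)" using Lf[of "\<lambda>i. if i = 0 then x else []"] by simp
    then show ?thesis using poly_mono_nat[OF that, of Lf] by simp
  qed
  have main: "negligible_fun (inversion_prob A \<rho> F)" if A: "ppt 2 A \<rho>" for A \<rho>
  proof (rule ccontr)
    assume "\<not> negligible_fun (inversion_prob A \<rho> F)"
    \<comment> \<open>Success of at least 1/N^c is known at infinitely many N only; one of them that
      is large enough will contradict \<open>weak\<close>.\<close>
    then obtain c where c: "\<exists>\<^sub>F N in sequentially. \<not> \<bar>inversion_prob A \<rho> F N\<bar> < 1 / real N ^ c"
      unfolding negligible_fun_def frequently_def by auto
    obtain T where T: "wf_tm A" "Suc 2 \<le> tapes A" "time_bound 2 A \<rho> T"
      using A by (rule pptE) (rule that)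
    have A3: "3 \<le> tapes A" using T(2) by simp
    define M1 where "M1 = pcompose Mp [:1, 1:]"
    have M1: "poly M1 n = poly Mp (Suc n)" for n by (simp add: M1_def poly_pcompose)
    \<comment> \<open>\<open>M1 n\<close> exceeds every N with block length n, so 1/N^c is at least
      1/s(n), a bound in terms of n alone.\<close>
    define sp where "sp = M1 ^ c"
    \<comment> \<open>Chosen so that k a = n for the threshold a = 1/(2 m s): if each seed succeeds
      with probability at least a, all k fail with probability at most exp(-n).\<close>
    define kp where "kp = [:0, 2:] * mp * sp"
    \<comment> \<open>Bounds the size of the inverter's input, N plus the length of the query, in
      terms of n + |f x|. Consequently \<open>SP\<close> has room for the filling and the randomness
      of one seed.\<close>
    define lp where "lp = M1 + (M1 + 1 + mp * (smult 2 (Lf + [:0, 1:]) + 1))"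
    define SP where "SP = M1 + pcompose \<rho> lp"
    define \<rho>B where "\<rho>B = kp * SP"
    define B where "B = (\<lambda>n y r. try_lengths A \<rho> T f mp Mp kp SP n y r)"
    have "fp 3 (\<lambda>e. tl (B (length (e 0)) (e 1) (e 2)))"
      unfolding B_def by (intro fp_tl fp_try_lengths T(1) A3 fp_f)
    then have "fp (Suc 2) (\<lambda>e. tl (B (length (e 0)) (e 1) (e 2)))" by simp
    then obtain C where C: "\<And>\<rho>. ppt 2 C \<rho>" "\<And>x y r. result C [x, y, r] = Some (tl (B (length x) y r))"
    proof (rule fp_ppt)
      fix C
      assume C: "\<And>\<rho>. ppt 2 C \<rho>" "\<And>xs r. length xs = 2 \<Longrightarrow> result C (xs @ [r]) =
          Some (tl (B (length (if 0 < Suc 2 then (xs @ [r]) ! 0 else []))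
            (if 1 < Suc 2 then (xs @ [r]) ! 1 else []) (if 2 < Suc 2 then (xs @ [r]) ! 2 else [])))"
      have "result C [x, y, r] = Some (tl (B (length x) y r))" for x y r using C(2)[of "[x, y]" r] by simp
      with C(1) show thesis by (rule that)
    qed
    have sp_pos: "poly sp n > 0" for n
    proof -
      have "poly M1 n > 0" using strict_monoD[OF M(1), of 0 "Suc n"] by (simp add: M1 M(2))
      then show ?thesis by (simp add: sp_def)
    qed
    have bound: "1 - 1 / q n \<le> inversion_prob C \<rho>B f n"
      if n: "n = blocks (poly Mp) N" "N > 0"
        and inv: "1 / real N ^ c \<le> inversion_prob A \<rho> F N"
        and large: "real (poly (smult 2 sp) n) < exp (real n)" "real (poly (smult 2 Q) n) < exp (real n)"
      for n N
    proof -
      let ?m = "poly mp n" and ?k = "poly kp n" and ?s = "real (poly sp n)"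
      define J where "J = (\<lambda>z. avg (poly \<rho> (N + length (F z)))
        (\<lambda>r. of_bool (result A [unary N, F z, r] \<in> Some ` (F -` {F z}))) :: real)"
      \<comment> \<open>Half of the success 1/s, spread evenly over the m positions.\<close>
      define a where "a = 1 / (2 * real ?m * ?s)"
      define bad where "bad = (\<lambda>x. \<forall>i<?m. avg N (\<lambda>z. J (splice n i x z)) < a)"
      define \<beta> where "\<beta> = avg n (\<lambda>x. of_bool (bad x) :: real)"
      have b: "poly Mp n \<le> N" "N < poly Mp (Suc n)" using blocks_bounds[OF M, of N] n(1) by auto
      have s_pos: "?s > 0" using sp_pos by simp
      have mr: "real ?m \<ge> 1" using m_pos[of n] by simp
      have s1: "?s \<ge> 1" using sp_pos[of n] by simp
      have a_pos: "a > 0" unfolding a_def using mr s1 by simp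
      have "1 \<le> real ?m * ?s" using mult_mono[OF mr s1] by simp
      then have a1: "a \<le> 1" unfolding a_def by (simp add: field_simps)
      have J01: "0 \<le> J z" "J z \<le> 1" for z unfolding J_def by (auto intro: avg_nonneg avg_le)
      have "avg N J \<le> (1 - \<beta>) ^ ?m + real ?m * a"
        unfolding \<beta>_def
        by (rule amplify) (use J01 b(1) a_pos in \<open>auto simp: bad_def Mp mult.commute\<close>)
      moreover have "1 / ?s \<le> avg N J"
      proof -
        have "real N ^ c \<le> ?s"
          using b(2) by (simp add: sp_def M1 power_mono)
        then have "1 / ?s \<le> 1 / real N ^ c" using n(2) by (simp add: frac_le)
        also have "\<dots> \<le> avg N J" using inv by (simp add: inversion_prob_eq J_def)
        finally show ?thesis .
      qed
      ultimately have am: "1 / ?s \<le> (1 - \<beta>) ^ ?m + real ?m * (1 / (2 * real ?m * ?s))"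
        by (simp add: a_def)
      have \<beta>01: "0 \<le> \<beta>" "\<beta> \<le> 1" unfolding \<beta>_def by (auto intro: avg_nonneg avg_le)
      have "2 * real n * q n \<le> real ?m"
        using mult_left_mono[OF Q[of n], of "2 * real n"] by (simp add: mp_def)
      moreover have "exp (- real n) < 1 / (2 * ?s)"
        using large(1) s_pos by (simp add: exp_minus field_simps)
      ultimately have \<beta>: "\<beta> < 1 / (2 * q n)"
        using few_bad[OF \<beta>01 s_pos q(2) _ m_pos am] by blast
      have "real ?k * a = real n"
        using mr s1 by (simp add: kp_def a_def)
      then have "(1 - a) ^ ?k \<le> exp (- real n)" using power_le_exp[of a ?k] a_pos a1 by simp
      also have "\<dots> \<le> 1 / (2 * q n)"
      proof -
        have "2 * q n \<le> exp (real n)" using Q[of n] large(2) by simp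
        then show ?thesis using q(2)[of n] by (simp add: exp_minus field_simps)
      qed
      finally have fail: "(1 - a) ^ ?k \<le> 1 / (2 * q n)" .
      have x_bound: "(1 - of_bool (bad x)) * (1 - (1 - a) ^ ?k) \<le> avg (poly \<rho>B (n + length (f x)))
          (\<lambda>r. of_bool (result C [unary n, f x, r] \<in> Some ` (f -` {f x})))" if x: "length x = n" for x
      proof (cases "bad x")
        case True
        then show ?thesis by (simp add: avg_nonneg)
      next
        case False
        then obtain i where i: "i < ?m" "a \<le> avg N (\<lambda>z. J (splice n i x z))"
          by (auto simp: bad_def not_less)
        have p1: "avg N (\<lambda>z. J (splice n i x z)) \<le> 1" by (rule avg_le) (rule J01)
        let ?l = "n + length (f x)"
        have S: "N + poly \<rho> (N + length (query f N n ?m i (f x) z)) \<le> poly SP ?l" for z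
        proof -
          have "length (query f N n ?m i (f x) z) \<le> N + 1 + ?m * (2 * (poly Lf n + length (f x)) + 1)"
            by (rule length_query) (rule Lf')
          also have "\<dots> \<le> poly M1 ?l + 1 + poly mp ?l * (2 * (poly Lf ?l + ?l) + 1)"
            using b(2) poly_mono_nat[of n ?l M1] poly_mono_nat[of n ?l mp] poly_mono_nat[of n ?l Lf]
            by (intro add_mono mult_mono) (auto simp: M1)
          finally have "N + length (query f N n ?m i (f x) z) \<le> poly lp ?l"
            using b(2) poly_mono_nat[of n ?l M1] by (simp add: lp_def M1)
          from poly_mono_nat[OF this, of \<rho>] show ?thesis
            using b(2) poly_mono_nat[of n ?l M1] by (simp add: SP_def M1 poly_pcompose)
        qed
        have R: "?k * poly SP ?l \<le> poly \<rho>B ?l"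
          using poly_mono_nat[of n ?l kp] by (simp add: \<rho>B_def mult_right_mono)
        have "1 - (1 - a) ^ ?k \<le> 1 - (1 - avg N (\<lambda>z. J (splice n i x z))) ^ ?k"
          using i(2) p1 by (simp add: power_mono)
        also have "\<dots> \<le> avg (poly \<rho>B ?l) (\<lambda>r. of_bool (B n (f x) r \<noteq> []))"
          unfolding J_def F_def B_def
          by (rule try_lengths_prob[OF T(3) M Mp b x i(1) S R])
        also have "\<dots> \<le> avg (poly \<rho>B ?l) (\<lambda>r. of_bool (result C [unary n, f x, r] \<in> Some ` (f -` {f x})))"
          using try_lengths_sound[OF M] by (intro avg_mono) (auto simp: C(2) B_def)
        finally show ?thesis using False by simp
      qed
      have "(1 - \<beta>) * (1 - (1 - a) ^ ?k) = avg n (\<lambda>x. (1 - of_bool (bad x)) * (1 - (1 - a) ^ ?k))"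
        by (simp add: avg_mult_right avg_diff \<beta>_def)
      also have "\<dots> \<le> inversion_prob C \<rho>B f n"
        unfolding inversion_prob_eq by (rule avg_mono) (rule x_bound)
      finally have "(1 - \<beta>) * (1 - (1 - a) ^ ?k) \<le> inversion_prob C \<rho>B f n" .
      \<comment> \<open>The permitted failure 1/q is shared equally: 1/(2q) for bad strings and
        1/(2q) for seeds that all fail.\<close>
      moreover have "1 - \<beta> - (1 - a) ^ ?k \<le> (1 - \<beta>) * (1 - (1 - a) ^ ?k)"
      proof -
        have "0 \<le> \<beta> * (1 - a) ^ ?k" using \<beta>01(1) a1 by simp
        then show ?thesis by (simp add: algebra_simps)
      qed
      moreover have "1 / q n = 1 / (2 * q n) + 1 / (2 * q n)" using q(2)[of n] by (simp add: field_simps)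
      ultimately show ?thesis using \<beta> fail by linarith
    qed
    have "\<forall>\<^sub>F n in sequentially. inversion_prob C \<rho>B f n < 1 - 1 / q n
        \<and> real (poly (smult 2 sp) n) < exp (real n) \<and> real (poly (smult 2 Q) n) < exp (real n)"
      by (intro eventually_conj weak C(1) poly_less_exp)
    then obtain n0 where n0: "\<And>n. n \<ge> n0 \<Longrightarrow> inversion_prob C \<rho>B f n < 1 - 1 / q n
        \<and> real (poly (smult 2 sp) n) < exp (real n) \<and> real (poly (smult 2 Q) n) < exp (real n)"
      unfolding eventually_sequentially by blast
    \<comment> \<open>Beyond \<open>poly Mp n0\<close> the block length is at least
      \<open>n0\<close>; the successor also makes N positive.\<close>
    obtain N where N: "N \<ge> Suc (poly Mp n0)" "\<not> \<bar>inversion_prob A \<rho> F N\<bar> < 1 / real N ^ c"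
      using c unfolding frequently_sequentially by blast
    define n where "n = blocks (poly Mp) N"
    have "n \<ge> n0"
    proof -
      have "poly Mp n0 < poly Mp (Suc n)" using blocks_bounds[OF M, of N] N(1) n_def by simp
      then show ?thesis using strict_mono_less[OF M(1)] by simp
    qed
    moreover have "0 \<le> inversion_prob A \<rho> F N" unfolding inversion_prob_eq by (intro avg_nonneg) auto
    ultimately have "1 - 1 / q n \<le> inversion_prob C \<rho>B f n"
      using n0[of n] N by (intro bound[OF n_def]) auto
    then show False using n0[OF \<open>n \<ge> n0\<close>] by simp
  qed
  have "poly_time_computable F"
    unfolding F_def by (rule fp_poly_time_computable[OF fp_direct_product[OF fp_f]])
  then have "one_way F" unfolding one_way_def using main by blast
  then show ?thesis by blast
qed

theorem theorem4p1:
  fixes U :: tm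
  assumes "universal_tm U"
    and "\<exists>(t :: nat \<Rightarrow> nat) (p :: nat \<Rightarrow> real).
           polynomial_fun (\<lambda>n. real (t n)) \<and> (\<forall>n. t n > 0) \<and>
           polynomial_fun p \<and> (\<forall>n. p n > 0) \<and>
           hard_on_average (\<lambda>n. 1 / p n) (\<lambda>x. bits_of_nat (K U t x))"
  shows "(\<exists>f. weak_one_way f) \<and> (\<exists>f. one_way f)"
proof -
  obtain t p where tp: "polynomial_fun (\<lambda>n. real (t n))" "polynomial_fun p" "\<And>n. p n > 0"
    "hard_on_average (\<lambda>n. 1 / p n) (\<lambda>x. bits_of_nat (K U t x))"
    using assms(2) by blast
  obtain c T where "wf_tm U" "2 \<le> tapes U" "\<And>d t. halts_within U [d, unary t] (poly T (length d + t))"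
    "\<And>w. \<exists>d. length d \<le> length w + c \<and> (\<forall>t. result U [d, unary t] = Some w)"
    using assms(1) by (rule universal_tm_identity) (rule that)
  then have "weak_one_way (emulate U T t c)" using tp by (rule weak_one_way_emulate)
  then show ?thesis using weak_one_way_imp_one_way by blast
qed

end
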